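(* For every even integer $L\geq 6$, every asymptotic cone of the group $G_L$ is simply connected.
   Context: For an even integer $L\ge 6$, $G_L$ is the group $$G_L:=\langle a,x,y,s,t\mid sas^{-1}=x,\ tat^{-1}=y,\ a^L=xy,\ [a,x]=[x,y]=[y,a]=1\rangle .$$ For a finitely generated group $G$ with finite generating set $S$, let $\mathrm{Cay}(G,S)$ be its Cayley graph with the path metric $d$. Given a non-principal ultrafilter $\omega$ on $\mathbb{N}$, a scaling sequence $\mathbf{s}=(s_n)$ of positive reals tending to infinity, and a sequence $\mathbf{o}=(o_n)$ of observation points in $X=\mathrm{Cay}(G,S)$, define the pseudometric $d_{\omega,\mathbf{s}}(\mathbf{x},\mathbf{y}):=\lim_\omega d(x_n,y_n)/s_n$ on sequences of points of $X$. The asymptotic cone $\mathrm{Cone}_\omega(X,\mathbf{o},\mathbf{s})$ is the quotient of the set of sequences at finite $d_{\omega,\mathbf{s}}$-distance from $\mathbf{o}$ obtained by identifying sequences at $d_{\omega,\mathbf{s}}$-distance $0$. The asymptotic cones of $G$ are all of these metric spaces, over all $\omega,\mathbf{s}$ (by homogeneity of $X$ one may take $\mathbf{o}$ constant at the identity; changing the finite generating set changes the cones by biLipschitz homeomorphism). *)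

theory Defs
  imports "HOL-Analysis.Analysis" "HOL-Algebra.Generated_Groups"
begin

section \<open>Group presentations\<close>

text \<open>A letter \<open>(x, True)\<close> is the generator \<open>x\<close>, and \<open>(x, False)\<close> is its formal inverse.\<close>

type_synonym 'x gword = "('x \<times> bool) list"

definition gen :: "'x \<Rightarrow> 'x gword" where
  "gen x = [(x, True)]"

definition word_inv :: "'x gword \<Rightarrow> 'x gword" where
  "word_inv w = rev (map (\<lambda>(x, b). (x, \<not> b)) w)"

definition word_pow :: "'x gword \<Rightarrow> nat \<Rightarrow> 'x gword" where
  "word_pow w n = concat (replicate n w)"

definition word_comm :: "'x gword \<Rightarrow> 'x gword \<Rightarrow> 'x gword" where
  "word_comm u v = u @ v @ word_inv u @ word_inv v"

text \<open>A pair \<open>(l, r)\<close> in \<open>R\<close> stands for the defining relation \<open>l = r\<close>. The relation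
  \<open>pres_eq R\<close> is the least congruence on words that contains \<open>R\<close> and free cancellation.\<close>

inductive pres_eq :: "('x gword \<times> 'x gword) set \<Rightarrow> 'x gword \<Rightarrow> 'x gword \<Rightarrow> bool"
  for R where
  refl: "pres_eq R w w"
| sym: "pres_eq R u v \<Longrightarrow> pres_eq R v u"
| trans: "pres_eq R u v \<Longrightarrow> pres_eq R v w \<Longrightarrow> pres_eq R u w"
| cancel: "pres_eq R (p @ [(x, b), (x, \<not> b)] @ q) (p @ q)"
| relation: "(l, r) \<in> R \<Longrightarrow> pres_eq R (p @ l @ q) (p @ r @ q)"

definition pres_class :: "('x gword \<times> 'x gword) set \<Rightarrow> 'x gword \<Rightarrow> 'x gword set" where
  "pres_class R w = {v. pres_eq R w v}"

definition presented_group :: "('x gword \<times> 'x gword) set \<Rightarrow> 'x gword set monoid" where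
  "presented_group R =
    \<lparr>carrier = UNIV // {(u, v). pres_eq R u v},
     mult = (\<lambda>A B. {w. \<exists>u\<in>A. \<exists>v\<in>B. pres_eq R (u @ v) w}),
     one = pres_class R []\<rparr>"

lemma pres_eq_append_left: "pres_eq R u v \<Longrightarrow> pres_eq R (w @ u) (w @ v)"
proof (induction rule: pres_eq.induct)
  case (trans u v w')
  show ?case using trans.IH by (rule pres_eq.trans)
next
  case (cancel p x b q)
  show ?case using pres_eq.cancel[of R "w @ p" x b q] by simp
next
  case (relation l r p q)
  show ?case using pres_eq.relation[OF relation, of "w @ p" q] by simp
qed (simp_all add: pres_eq.refl pres_eq.sym)

lemma pres_eq_append_right: "pres_eq R u v \<Longrightarrow> pres_eq R (u @ w) (v @ w)"
proof (induction rule: pres_eq.induct)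
  case (trans u v w')
  show ?case using trans.IH by (rule pres_eq.trans)
next
  case (cancel p x b q)
  show ?case using pres_eq.cancel[of R p x b "q @ w"] by simp
next
  case (relation l r p q)
  show ?case using pres_eq.relation[OF relation, of p "q @ w"] by simp
qed (simp_all add: pres_eq.refl pres_eq.sym)

lemma pres_eq_append: "pres_eq R u u' \<Longrightarrow> pres_eq R v v' \<Longrightarrow> pres_eq R (u @ v) (u' @ v')"
  by (meson pres_eq.trans pres_eq_append_left pres_eq_append_right)

lemma pres_eq_word_inv: "pres_eq R (word_inv w @ w) []"
proof (induction w)
  case Nil
  show ?case by (simp add: word_inv_def pres_eq.refl)
next
  case (Cons c w)
  obtain x b where c: "c = (x, b)" by (cases c)
  have "word_inv (c # w) @ c # w = word_inv w @ [(x, \<not> b), (x, \<not> \<not> b)] @ w"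
    by (simp add: word_inv_def c)
  then show ?case
    unfolding c using pres_eq.trans[OF pres_eq.cancel[of R "word_inv w" x "\<not> b" w] Cons.IH] by simp
qed

lemma carrier_presented_group: "carrier (presented_group R) = range (pres_class R)"
  by (auto simp: presented_group_def quotient_def pres_class_def)

lemma one_presented_group: "\<one>\<^bsub>presented_group R\<^esub> = pres_class R []"
  by (simp add: presented_group_def)

lemma pres_class_eq_iff: "pres_class R u = pres_class R v \<longleftrightarrow> pres_eq R u v"
proof
  assume "pres_class R u = pres_class R v"
  then have "v \<in> pres_class R u"
    by (simp add: pres_class_def pres_eq.refl)
  then show "pres_eq R u v"
    by (simp add: pres_class_def)
next
  assume uv: "pres_eq R u v"
  have "pres_eq R u w \<longleftrightarrow> pres_eq R v w" for w
    using pres_eq.trans[OF uv, of w] pres_eq.trans[OF pres_eq.sym[OF uv], of w] by blast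
  then show "pres_class R u = pres_class R v"
    by (simp add: pres_class_def)
qed

lemma mult_presented_group:
  "pres_class R u \<otimes>\<^bsub>presented_group R\<^esub> pres_class R v = pres_class R (u @ v)"
proof -
  have "(\<exists>u'. pres_eq R u u' \<and> (\<exists>v'. pres_eq R v v' \<and> pres_eq R (u' @ v') w)) \<longleftrightarrow> pres_eq R (u @ v) w"
    for w
  proof
    assume "\<exists>u'. pres_eq R u u' \<and> (\<exists>v'. pres_eq R v v' \<and> pres_eq R (u' @ v') w)"
    then obtain u' v' where *: "pres_eq R u u'" "pres_eq R v v'" "pres_eq R (u' @ v') w"
      by blast
    show "pres_eq R (u @ v) w"
      using pres_eq_append[OF *(1,2)] *(3) by (rule pres_eq.trans)
  next
    assume "pres_eq R (u @ v) w"
    then show "\<exists>u'. pres_eq R u u' \<and> (\<exists>v'. pres_eq R v v' \<and> pres_eq R (u' @ v') w)"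
      using pres_eq.refl[of R u] pres_eq.refl[of R v] by blast
  qed
  then show ?thesis
    by (simp add: presented_group_def pres_class_def Bex_def)
qed

lemma group_presented_group: "group (presented_group R)"
proof (rule groupI)
  show "\<exists>y\<in>carrier (presented_group R). y \<otimes>\<^bsub>presented_group R\<^esub> x = \<one>\<^bsub>presented_group R\<^esub>"
    if x: "x \<in> carrier (presented_group R)" for x
  proof -
    obtain w where "x = pres_class R w"
      using x by (auto simp: carrier_presented_group)
    then show ?thesis
      by (auto simp: carrier_presented_group mult_presented_group one_presented_group
          pres_class_eq_iff pres_eq_word_inv intro: exI[of _ "word_inv w"])
  qed
qed (auto simp: carrier_presented_group mult_presented_group one_presented_group)


section \<open>The groups \<open>G\<^sub>L\<close>\<close>

datatype GL_gen = Gen_a | Gen_x | Gen_y | Gen_s | Gen_t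

definition GL_relations :: "nat \<Rightarrow> (GL_gen gword \<times> GL_gen gword) set" where
  "GL_relations L =
    (let a = gen Gen_a; x = gen Gen_x; y = gen Gen_y; s = gen Gen_s; t = gen Gen_t in
     {(s @ a @ word_inv s, x),
      (t @ a @ word_inv t, y),
      (word_pow a L, x @ y),
      (word_comm a x, []),
      (word_comm x y, []),
      (word_comm y a, [])})"

definition GL :: "nat \<Rightarrow> GL_gen gword set monoid" where
  "GL L = presented_group (GL_relations L)"


section \<open>Cayley graphs\<close>

definition cayley_adj :: "('g, 'b) monoid_scheme \<Rightarrow> 'g set \<Rightarrow> ('g \<times> 'g) set" where
  "cayley_adj G S =
    {(g, h). g \<in> carrier G \<and> h \<in> carrier G \<and> (\<exists>s\<in>S. h = g \<otimes>\<^bsub>G\<^esub> s \<or> g = h \<otimes>\<^bsub>G\<^esub> s)}"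

definition vertex_dist :: "('g, 'b) monoid_scheme \<Rightarrow> 'g set \<Rightarrow> 'g \<Rightarrow> 'g \<Rightarrow> nat" where
  "vertex_dist G S g h = (LEAST n. (g, h) \<in> cayley_adj G S ^^ n)"

text \<open>The points of the Cayley graph as a metric graph: besides the vertices there are the interior
  points of the edges. There is one edge of length 1 for each \<open>g \<in> G\<close> and \<open>s \<in> S\<close>; it
  goes from \<open>g\<close> to \<open>g s\<close>, and \<open>Inner g s r\<close> is its point at distance \<open>r\<close> from \<open>g\<close>,
  measured along the edge.\<close>

datatype 'g cayley_pt = Vertex 'g | Inner 'g 'g real

definition Cay :: "('g, 'b) monoid_scheme \<Rightarrow> 'g set \<Rightarrow> 'g cayley_pt set" where
  "Cay G S = Vertex ` carrier G \<union> {Inner g s r | g s r. g \<in> carrier G \<and> s \<in> S \<and> 0 < r \<and> r < 1}"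

text \<open>The pairs \<open>(v, \<alpha>)\<close> such that the vertex \<open>v\<close> is reached from the point by a segment of
  length \<open>\<alpha>\<close> that passes through no other vertex.\<close>

fun vertex_exits :: "('g, 'b) monoid_scheme \<Rightarrow> 'g cayley_pt \<Rightarrow> ('g \<times> real) set" where
  "vertex_exits G (Vertex g) = {(g, 0)}"
| "vertex_exits G (Inner g s r) = {(g, r), (g \<otimes>\<^bsub>G\<^esub> s, 1 - r)}"

text \<open>The path metric: a shortest path either passes through a vertex, or stays inside one edge.\<close>

definition dist_via_vertices ::
  "('g, 'b) monoid_scheme \<Rightarrow> 'g set \<Rightarrow> 'g cayley_pt \<Rightarrow> 'g cayley_pt \<Rightarrow> real" where
  "dist_via_vertices G S p q =
    Min ((\<lambda>((u, \<alpha>), (v, \<beta>)). \<alpha> + real (vertex_dist G S u v) + \<beta>) `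
         (vertex_exits G p \<times> vertex_exits G q))"

definition Cay_dist ::
  "('g, 'b) monoid_scheme \<Rightarrow> 'g set \<Rightarrow> 'g cayley_pt \<Rightarrow> 'g cayley_pt \<Rightarrow> real" where
  "Cay_dist G S p q =
    (if p \<in> Cay G S \<and> q \<in> Cay G S then
      (case (p, q) of
         (Inner g s r, Inner g' s' r') \<Rightarrow>
           if g = g' \<and> s = s' then min \<bar>r - r'\<bar> (dist_via_vertices G S p q)
           else dist_via_vertices G S p q
       | _ \<Rightarrow> dist_via_vertices G S p q)
     else 0)"


lemma sym_cayley_adj: "sym (cayley_adj G S)"
  by (auto simp: sym_def cayley_adj_def)

lemma vertex_dist_commute: "vertex_dist G S g h = vertex_dist G S h g"
proof -
  have *: "(h, g) \<in> cayley_adj G S ^^ n" if "(g, h) \<in> cayley_adj G S ^^ n" for n g h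
    using that
  proof (induction n arbitrary: h)
    case (Suc n)
    then obtain k where "(g, k) \<in> cayley_adj G S ^^ n" "(k, h) \<in> cayley_adj G S"
      by auto
    then show ?case
      using Suc.IH sym_cayley_adj[of G S] by (intro relpow_Suc_I2) (auto dest: symD)
  qed auto
  have "(g, h) \<in> cayley_adj G S ^^ n \<longleftrightarrow> (h, g) \<in> cayley_adj G S ^^ n" for n
    using *[of g h n] *[of h g n] by blast
  then show ?thesis
    by (simp add: vertex_dist_def)
qed

lemma vertex_dist_le: "(g, h) \<in> cayley_adj G S ^^ n \<Longrightarrow> vertex_dist G S g h \<le> n"
  by (simp add: vertex_dist_def Least_le)

lemma vertex_dist_refl: "vertex_dist G S g g = 0"
  using vertex_dist_le[of g g 0 G S] by simp

context
  fixes G (structure) and S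
  assumes G: "group G" and S: "S \<subseteq> carrier G" and gen: "generate G S = carrier G"
begin

interpretation group G by (rule G)

lemma vertex_dist_attained:
  assumes g: "g \<in> carrier G" and h: "h \<in> carrier G"
  shows "(g, h) \<in> cayley_adj G S ^^ vertex_dist G S g h"
proof -
  have *: "(g', g' \<otimes> k) \<in> (cayley_adj G S)\<^sup>*" if k: "k \<in> generate G S" and g': "g' \<in> carrier G" for k g'
    using k g'
  proof (induction k arbitrary: g')
    case one
    then show ?case by simp
  next
    case (incl s)
    then have "(g', g' \<otimes> s) \<in> cayley_adj G S"
      using S by (auto simp: cayley_adj_def)
    then show ?case by (rule r_into_rtrancl)
  next
    case (inv s)
    then have s: "s \<in> carrier G" using S by auto
    have "g' = g' \<otimes> inv s \<otimes> s"
      using s inv.prems by (simp add: m_assoc)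
    then have "(g', g' \<otimes> inv s) \<in> cayley_adj G S"
      using s inv unfolding cayley_adj_def by blast
    then show ?case by (rule r_into_rtrancl)
  next
    case (eng k l)
    have kl: "k \<in> carrier G" "l \<in> carrier G"
      using eng.hyps gen by auto
    have "(g', g' \<otimes> k) \<in> (cayley_adj G S)\<^sup>*"
      using eng by blast
    moreover have "(g' \<otimes> k, g' \<otimes> k \<otimes> l) \<in> (cayley_adj G S)\<^sup>*"
      using eng kl by blast
    ultimately have "(g', g' \<otimes> k \<otimes> l) \<in> (cayley_adj G S)\<^sup>*"
      by (rule rtrancl_trans)
    then show ?case
      using kl eng.prems by (simp add: m_assoc)
  qed
  have "inv g \<otimes> h \<in> generate G S"
    using g h gen by simp
  from *[OF this g] have "(g, h) \<in> (cayley_adj G S)\<^sup>*"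
    using g h by (simp flip: m_assoc)
  then obtain n where "(g, h) \<in> cayley_adj G S ^^ n"
    by (auto simp: rtrancl_power)
  then show ?thesis
    unfolding vertex_dist_def by (rule LeastI)
qed

lemma vertex_dist_triangle:
  assumes "g \<in> carrier G" "h \<in> carrier G" "k \<in> carrier G"
  shows "vertex_dist G S g k \<le> vertex_dist G S g h + vertex_dist G S h k"
  using vertex_dist_attained[OF assms(1,2)] vertex_dist_attained[OF assms(2,3)]
  by (intro vertex_dist_le) (auto simp: relpow_add)

lemma vertex_dist_eq_0:
  assumes "g \<in> carrier G" "h \<in> carrier G" "vertex_dist G S g h = 0"
  shows "g = h"
  using vertex_dist_attained[OF assms(1,2)] assms(3) by simp

lemma vertex_dist_edge:
  assumes "g \<in> carrier G" "s \<in> S"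
  shows "vertex_dist G S g (g \<otimes> s) \<le> 1"
proof (rule vertex_dist_le)
  show "(g, g \<otimes> s) \<in> cayley_adj G S ^^ 1"
    using assms S by (auto simp: cayley_adj_def)
qed

lemma vertex_exits_nonneg:
  assumes "p \<in> Cay G S" "(u, \<alpha>) \<in> vertex_exits G p"
  shows "u \<in> carrier G" "0 \<le> \<alpha>"
  using assms S by (auto simp: Cay_def subset_iff)

lemma finite_vertex_exits: "finite (vertex_exits G p)"
  by (cases p) auto

lemma vertex_exits_nonempty: "vertex_exits G p \<noteq> {}"
  by (cases p) auto

lemma dist_via_vertices_le:
  assumes "(u, \<alpha>) \<in> vertex_exits G p" "(v, \<beta>) \<in> vertex_exits G q"
  shows "dist_via_vertices G S p q \<le> \<alpha> + real (vertex_dist G S u v) + \<beta>"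
  unfolding dist_via_vertices_def
  by (rule Min_le) (use assms in \<open>force simp: finite_vertex_exits\<close>)+

lemma dist_via_vertices_attained:
  obtains u \<alpha> v \<beta> where "(u, \<alpha>) \<in> vertex_exits G p" "(v, \<beta>) \<in> vertex_exits G q"
    "dist_via_vertices G S p q = \<alpha> + real (vertex_dist G S u v) + \<beta>"
proof -
  have "dist_via_vertices G S p q \<in> (\<lambda>((u, \<alpha>), (v, \<beta>)). \<alpha> + real (vertex_dist G S u v) + \<beta>) `
      (vertex_exits G p \<times> vertex_exits G q)"
    unfolding dist_via_vertices_def
    by (rule Min_in) (auto simp: finite_vertex_exits vertex_exits_nonempty)
  then show thesis
    using that by auto
qed

lemma dist_via_vertices_commute: "dist_via_vertices G S p q = dist_via_vertices G S q p"
proof (rule antisym)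
  have "dist_via_vertices G S p q \<le> dist_via_vertices G S q p" for p q
  proof -
    obtain u \<alpha> v \<beta> where *: "(u, \<alpha>) \<in> vertex_exits G q" "(v, \<beta>) \<in> vertex_exits G p"
        "dist_via_vertices G S q p = \<alpha> + real (vertex_dist G S u v) + \<beta>"
      by (rule dist_via_vertices_attained)
    show ?thesis
      using dist_via_vertices_le[OF *(2,1)] *(3) vertex_dist_commute[of G S u v] by simp
  qed
  then show "dist_via_vertices G S p q \<le> dist_via_vertices G S q p"
    and "dist_via_vertices G S q p \<le> dist_via_vertices G S p q"
    by blast+
qed

lemma vertex_exits_dist:
  assumes "p \<in> Cay G S" "(u, \<alpha>) \<in> vertex_exits G p" "(v, \<beta>) \<in> vertex_exits G p"
  shows "real (vertex_dist G S u v) \<le> \<alpha> + \<beta>"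
proof (cases p)
  case (Vertex g)
  then show ?thesis using assms by (simp add: vertex_dist_refl)
next
  case (Inner g s r)
  then have gs: "g \<in> carrier G" "s \<in> S" "0 < r" "r < 1"
    using assms(1) by (auto simp: Cay_def)
  have "vertex_dist G S g (g \<otimes> s) \<le> 1" "vertex_dist G S (g \<otimes> s) g \<le> 1"
    using vertex_dist_edge[OF gs(1,2)] by (auto simp: vertex_dist_commute)
  then show ?thesis
    using assms(2,3) gs(3,4) Inner by (auto simp: vertex_dist_refl)
qed

lemma dist_via_vertices_nonneg:
  assumes "p \<in> Cay G S" "q \<in> Cay G S"
  shows "0 \<le> dist_via_vertices G S p q"
proof -
  obtain u \<alpha> v \<beta> where *: "(u, \<alpha>) \<in> vertex_exits G p" "(v, \<beta>) \<in> vertex_exits G q"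
      "dist_via_vertices G S p q = \<alpha> + real (vertex_dist G S u v) + \<beta>"
    by (rule dist_via_vertices_attained)
  then show ?thesis
    using vertex_exits_nonneg(2)[OF assms(1) *(1)] vertex_exits_nonneg(2)[OF assms(2) *(2)] by simp
qed

lemma Cay_dist_cases:
  assumes "p \<in> Cay G S" "q \<in> Cay G S"
  obtains (via) "Cay_dist G S p q = dist_via_vertices G S p q"
  | (edge) g s r r' where "p = Inner g s r" "q = Inner g s r'" "Cay_dist G S p q = \<bar>r - r'\<bar>"
proof (cases "\<exists>g s r r'. p = Inner g s r \<and> q = Inner g s r' \<and> Cay_dist G S p q = \<bar>r - r'\<bar>")
  case True
  then show thesis using edge by blast
next
  case False
  then have "Cay_dist G S p q = dist_via_vertices G S p q"
    using assms by (cases p; cases q) (auto simp: Cay_dist_def min_def split: if_splits)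
  then show thesis by (rule via)
qed

lemma Cay_dist_le_via:
  assumes "p \<in> Cay G S" "q \<in> Cay G S"
  shows "Cay_dist G S p q \<le> dist_via_vertices G S p q"
  using assms unfolding Cay_dist_def by (auto split: cayley_pt.splits)

lemma Cay_dist_le_edge:
  assumes "Inner g s r \<in> Cay G S" "Inner g s r' \<in> Cay G S"
  shows "Cay_dist G S (Inner g s r) (Inner g s r') \<le> \<bar>r - r'\<bar>"
  using assms unfolding Cay_dist_def by auto

lemma Cay_dist_commute: "Cay_dist G S p q = Cay_dist G S q p"
  unfolding Cay_dist_def
  by (auto split: cayley_pt.splits simp: dist_via_vertices_commute abs_minus_commute)

lemma vertex_exits_edge:
  assumes "(u, \<beta>) \<in> vertex_exits G (Inner g s r)"
  obtains \<beta>' where "(u, \<beta>') \<in> vertex_exits G (Inner g s r')" "\<beta>' \<le> \<beta> + \<bar>r - r'\<bar>"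
proof -
  consider "u = g" "\<beta> = r" | "u = g \<otimes> s" "\<beta> = 1 - r"
    using assms by auto
  then show thesis
  proof cases
    case 1
    show thesis by (rule that[of r']) (use 1 in auto)
  next
    case 2
    show thesis by (rule that[of "1 - r'"]) (use 2 in auto)
  qed
qed

lemma Cay_dist_triangle_edge:
  assumes p: "p \<in> Cay G S" and q: "Inner g s r \<in> Cay G S" and q': "Inner g s r' \<in> Cay G S"
  shows "Cay_dist G S p (Inner g s r') \<le> Cay_dist G S p (Inner g s r) + \<bar>r - r'\<bar>"
  using p q
proof (cases rule: Cay_dist_cases)
  case via
  obtain u \<alpha> v \<beta> where *: "(u, \<alpha>) \<in> vertex_exits G p" "(v, \<beta>) \<in> vertex_exits G (Inner g s r)"
      "dist_via_vertices G S p (Inner g s r) = \<alpha> + real (vertex_dist G S u v) + \<beta>"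
    by (rule dist_via_vertices_attained)
  obtain \<beta>' where **: "(v, \<beta>') \<in> vertex_exits G (Inner g s r')" "\<beta>' \<le> \<beta> + \<bar>r - r'\<bar>"
    using *(2) by (rule vertex_exits_edge)
  then show ?thesis
    using dist_via_vertices_le[OF *(1) **(1)] **(2) Cay_dist_le_via[OF p q'] *(3) via by linarith
next
  case (edge g' s' r1 r2)
  then show ?thesis
    using Cay_dist_le_edge[of g s r1 r'] p q' by force
qed

lemma Metric_space_Cay: "Metric_space (Cay G S) (Cay_dist G S)"
proof
  show nonneg: "0 \<le> Cay_dist G S p q" for p q
  proof (cases "p \<in> Cay G S \<and> q \<in> Cay G S")
    case True
    then have pq: "p \<in> Cay G S" "q \<in> Cay G S" by auto
    then show ?thesis
      by (cases rule: Cay_dist_cases) (simp_all add: dist_via_vertices_nonneg[OF pq])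
  next
    case False
    then show ?thesis by (auto simp: Cay_dist_def)
  qed
  show "Cay_dist G S p q = Cay_dist G S q p" for p q
    by (rule Cay_dist_commute)
  show "Cay_dist G S p q = 0 \<longleftrightarrow> p = q" if p: "p \<in> Cay G S" and q: "q \<in> Cay G S" for p q
  proof
    assume eq: "p = q"
    have "Cay_dist G S p p \<le> 0"
    proof (cases p)
      case (Vertex g)
      then show ?thesis
        using Cay_dist_le_via[OF p p] dist_via_vertices_le[of g 0 p g 0 p]
        by (simp add: vertex_dist_refl)
    next
      case (Inner g s r)
      then show ?thesis
        using Cay_dist_le_edge[of g s r r] p by simp
    qed
    then show "Cay_dist G S p q = 0"
      using nonneg[of p p] eq by simp
  next
    assume 0: "Cay_dist G S p q = 0"
    from p q show "p = q"
    proof (cases rule: Cay_dist_cases)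
      case via
      obtain u \<alpha> v \<beta> where *: "(u, \<alpha>) \<in> vertex_exits G p" "(v, \<beta>) \<in> vertex_exits G q"
          "dist_via_vertices G S p q = \<alpha> + real (vertex_dist G S u v) + \<beta>"
        by (rule dist_via_vertices_attained)
      have nn: "u \<in> carrier G" "v \<in> carrier G" "0 \<le> \<alpha>" "0 \<le> \<beta>"
        using vertex_exits_nonneg[OF p *(1)] vertex_exits_nonneg[OF q *(2)] by auto
      then have **: "\<alpha> = 0" "\<beta> = 0" "vertex_dist G S u v = 0"
        using via 0 *(3) by linarith+
      then have "u = v"
        using vertex_dist_eq_0 nn by blast
      moreover have "p = Vertex u" "q = Vertex v"
        using * ** p q by (cases p; cases q; force simp: Cay_def)+
      ultimately show ?thesis by simp
    next
      case (edge g s r r')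
      then show ?thesis using 0 by simp
    qed
  qed
  show "Cay_dist G S p r \<le> Cay_dist G S p q + Cay_dist G S q r"
    if p: "p \<in> Cay G S" and q: "q \<in> Cay G S" and r: "r \<in> Cay G S" for p q r
    using p q
  proof (cases rule: Cay_dist_cases)
    case via1: via
    show ?thesis
      using q r
    proof (cases rule: Cay_dist_cases)
      case via2: via
      obtain u \<alpha> v \<beta> where *: "(u, \<alpha>) \<in> vertex_exits G p" "(v, \<beta>) \<in> vertex_exits G q"
          "dist_via_vertices G S p q = \<alpha> + real (vertex_dist G S u v) + \<beta>"
        by (rule dist_via_vertices_attained)
      obtain v' \<beta>' w \<gamma> where **: "(v', \<beta>') \<in> vertex_exits G q" "(w, \<gamma>) \<in> vertex_exits G r"
          "dist_via_vertices G S q r = \<beta>' + real (vertex_dist G S v' w) + \<gamma>"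
        by (rule dist_via_vertices_attained)
      have c: "u \<in> carrier G" "v \<in> carrier G" "v' \<in> carrier G" "w \<in> carrier G"
        using vertex_exits_nonneg(1) * ** p q r by blast+
      have "real (vertex_dist G S u w) \<le>
          real (vertex_dist G S u v) + real (vertex_dist G S v v') + real (vertex_dist G S v' w)"
        using vertex_dist_triangle[OF c(1,2,4)] vertex_dist_triangle[OF c(2,3,4)] by linarith
      then show ?thesis
        using vertex_exits_dist[OF q *(2) **(1)] dist_via_vertices_le[OF *(1) **(2)]
          Cay_dist_le_via[OF p r] via1 via2 *(3) **(3)
        by linarith
    next
      case (edge g s t t')
      then show ?thesis
        using Cay_dist_triangle_edge[of p g s t t'] p q r by simp
    qed
  next
    case (edge g s t t')
    then show ?thesis
      using Cay_dist_triangle_edge[of r g s t' t] p q r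
      by (simp add: Cay_dist_commute[of r] abs_minus_commute)
  qed
qed

end


section \<open>Asymptotic cones\<close>

definition nonprincipal_ultrafilter :: "'i filter \<Rightarrow> bool" where
  "nonprincipal_ultrafilter \<omega> \<longleftrightarrow>
    \<omega> \<noteq> bot \<and>
    (\<forall>P. eventually P \<omega> \<or> eventually (\<lambda>i. \<not> P i) \<omega>) \<and>
    (\<forall>i. \<omega> \<noteq> principal {i})"

text \<open>The limit is taken in \<open>[0, \<infinity>]\<close>, where every ultralimit exists.\<close>

definition ultra_dist ::
  "('a \<Rightarrow> 'a \<Rightarrow> real) \<Rightarrow> nat filter \<Rightarrow> (nat \<Rightarrow> real) \<Rightarrow> (nat \<Rightarrow> 'a) \<Rightarrow> (nat \<Rightarrow> 'a) \<Rightarrow> ennreal" where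
  "ultra_dist d \<omega> \<sigma> x y = Lim \<omega> (\<lambda>n. ennreal (d (x n) (y n) / \<sigma> n))"

definition cone_seqs ::
  "'a set \<Rightarrow> ('a \<Rightarrow> 'a \<Rightarrow> real) \<Rightarrow> nat filter \<Rightarrow> (nat \<Rightarrow> 'a) \<Rightarrow> (nat \<Rightarrow> real) \<Rightarrow> (nat \<Rightarrow> 'a) set" where
  "cone_seqs X d \<omega> obs \<sigma> = {x. (\<forall>n. x n \<in> X) \<and> ultra_dist d \<omega> \<sigma> x obs < \<infinity>}"

definition cone_points ::
  "'a set \<Rightarrow> ('a \<Rightarrow> 'a \<Rightarrow> real) \<Rightarrow> nat filter \<Rightarrow> (nat \<Rightarrow> 'a) \<Rightarrow> (nat \<Rightarrow> real) \<Rightarrow> (nat \<Rightarrow> 'a) set set" where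
  "cone_points X d \<omega> obs \<sigma> =
    cone_seqs X d \<omega> obs \<sigma> //
      {(x, y). x \<in> cone_seqs X d \<omega> obs \<sigma> \<and> y \<in> cone_seqs X d \<omega> obs \<sigma> \<and> ultra_dist d \<omega> \<sigma> x y = 0}"

definition cone_dist ::
  "('a \<Rightarrow> 'a \<Rightarrow> real) \<Rightarrow> nat filter \<Rightarrow> (nat \<Rightarrow> real) \<Rightarrow> (nat \<Rightarrow> 'a) set \<Rightarrow> (nat \<Rightarrow> 'a) set \<Rightarrow> real" where
  "cone_dist d \<omega> \<sigma> A B = enn2real (ultra_dist d \<omega> \<sigma> (SOME x. x \<in> A) (SOME y. y \<in> B))"

lemma ultrafilter_tendsto_ennreal:
  fixes f :: "'i \<Rightarrow> ennreal"
  assumes "nonprincipal_ultrafilter \<omega>"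
  shows "(f \<longlongrightarrow> Lim \<omega> f) \<omega>"
proof -
  have bot: "\<omega> \<noteq> bot" and ultra: "\<And>P. eventually P \<omega> \<or> eventually (\<lambda>i. \<not> P i) \<omega>"
    using assms by (auto simp: nonprincipal_ultrafilter_def)
  have "filtermap f \<omega> \<noteq> bot"
    using bot by (simp add: filtermap_bot_iff)
  then obtain l where l: "inf (nhds l) (filtermap f \<omega>) \<noteq> bot"
    using compact_UNIV[where 'a = ennreal] unfolding compact_filter by force
  have "(f \<longlongrightarrow> l) \<omega>"
  proof (rule topological_tendstoI)
    fix U assume U: "open U" "l \<in> U"
    have "\<not> eventually (\<lambda>i. f i \<notin> U) \<omega>"
    proof
      assume "eventually (\<lambda>i. f i \<notin> U) \<omega>"
      then have "eventually (\<lambda>y. y \<notin> U) (filtermap f \<omega>)"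
        by (simp add: eventually_filtermap)
      moreover have "eventually (\<lambda>y. y \<in> U) (nhds l)"
        using U by (rule eventually_nhds_in_open)
      ultimately have "eventually (\<lambda>_. False) (inf (nhds l) (filtermap f \<omega>))"
        unfolding eventually_inf by blast
      then show False
        using l by (simp add: trivial_limit_def)
    qed
    then show "eventually (\<lambda>i. f i \<in> U) \<omega>"
      using ultra by blast
  qed
  then show ?thesis
    using tendsto_Lim[OF bot] by metis
qed

lemma Metric_space_cone:
  assumes X: "Metric_space X d" and \<omega>: "nonprincipal_ultrafilter \<omega>"
    and \<sigma>: "\<And>n. \<sigma> n > 0" and obs: "\<And>n. obs n \<in> X"
  shows "Metric_space (cone_points X d \<omega> obs \<sigma>) (cone_dist d \<omega> \<sigma>)"
proof -
  interpret X: Metric_space X d by (rule X)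
  have bot: "\<omega> \<noteq> bot"
    using \<omega> by (simp add: nonprincipal_ultrafilter_def)
  let ?D = "ultra_dist d \<omega> \<sigma>"
  let ?Q = "cone_seqs X d \<omega> obs \<sigma>"
  let ?E = "{(x, y). x \<in> ?Q \<and> y \<in> ?Q \<and> ?D x y = 0}"
  have commute: "?D x y = ?D y x" for x y
    by (simp add: ultra_dist_def X.commute)
  have triangle: "?D x z \<le> ?D x y + ?D y z"
    if "\<And>n. x n \<in> X" "\<And>n. y n \<in> X" "\<And>n. z n \<in> X" for x y z
    unfolding ultra_dist_def
  proof (rule tendsto_le[OF bot tendsto_add])
    show "\<forall>\<^sub>F n in \<omega>. ennreal (d (x n) (z n) / \<sigma> n)
        \<le> ennreal (d (x n) (y n) / \<sigma> n) + ennreal (d (y n) (z n) / \<sigma> n)"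
    proof (intro always_eventually allI)
      fix n
      have "d (x n) (z n) / \<sigma> n \<le> d (x n) (y n) / \<sigma> n + d (y n) (z n) / \<sigma> n"
        using X.triangle[OF that] less_imp_le[OF \<sigma>]
        by (simp add: divide_right_mono flip: add_divide_distrib)
      then show "ennreal (d (x n) (z n) / \<sigma> n)
          \<le> ennreal (d (x n) (y n) / \<sigma> n) + ennreal (d (y n) (z n) / \<sigma> n)"
        using less_imp_le[OF \<sigma>] by (simp add: ennreal_leI flip: ennreal_plus)
    qed
  qed (rule ultrafilter_tendsto_ennreal[OF \<omega>])+
  have refl: "?D x x = 0" if "\<And>n. x n \<in> X" for x
    using that bot by (simp add: ultra_dist_def tendsto_Lim)
  have QX: "x n \<in> X" if "x \<in> ?Q" for x n
    using that by (simp add: cone_seqs_def)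
  have fin: "?D x y < \<infinity>" if xy: "x \<in> ?Q" "y \<in> ?Q" for x y
  proof -
    have "?D x y \<le> ?D x obs + ?D y obs"
      using triangle[of x obs y] QX xy obs by (simp add: commute)
    also have "\<dots> < \<infinity>"
      using xy by (simp add: cone_seqs_def)
    finally show ?thesis .
  qed
  have "equiv ?Q ?E"
  proof (rule equivI)
    show "refl_on ?Q ?E"
      using refl QX by (auto simp: refl_on_def)
    show "sym ?E"
      by (auto simp: sym_def commute)
    show "trans ?E"
    proof (rule transI)
      fix x y z assume "(x, y) \<in> ?E" "(y, z) \<in> ?E"
      then show "(x, z) \<in> ?E"
        using triangle[of x y z] QX by simp
    qed
  qed auto
  note E = this
  have rep: "(SOME x. x \<in> A) \<in> A" "(SOME x. x \<in> A) \<in> ?Q"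
    if A: "A \<in> cone_points X d \<omega> obs \<sigma>" for A
  proof -
    have "A \<noteq> {}" "A \<subseteq> ?Q"
      using in_quotient_imp_non_empty[OF E A[unfolded cone_points_def]]
        in_quotient_imp_subset[OF E A[unfolded cone_points_def]] .
    from \<open>A \<noteq> {}\<close> show "(SOME x. x \<in> A) \<in> A"
      by (simp add: some_in_eq)
    with \<open>A \<subseteq> ?Q\<close> show "(SOME x. x \<in> A) \<in> ?Q"
      by (rule subsetD)
  qed
  show ?thesis
  proof
    show "0 \<le> cone_dist d \<omega> \<sigma> A B" for A B
      by (simp add: cone_dist_def)
    show "cone_dist d \<omega> \<sigma> A B = cone_dist d \<omega> \<sigma> B A" for A B
      by (simp add: cone_dist_def commute)
    show "cone_dist d \<omega> \<sigma> A B = 0 \<longleftrightarrow> A = B"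
      if A: "A \<in> cone_points X d \<omega> obs \<sigma>" and B: "B \<in> cone_points X d \<omega> obs \<sigma>" for A B
    proof -
      have "cone_dist d \<omega> \<sigma> A B = 0 \<longleftrightarrow> ?D (SOME x. x \<in> A) (SOME y. y \<in> B) = 0"
        using fin[OF rep(2)[OF A] rep(2)[OF B]] by (auto simp: cone_dist_def enn2real_eq_0_iff)
      also have "\<dots> \<longleftrightarrow> ((SOME x. x \<in> A), (SOME y. y \<in> B)) \<in> ?E"
        using rep[OF A] rep[OF B] by simp
      also have "\<dots> \<longleftrightarrow> A = B"
        using quotient_eq_iff[OF E A[unfolded cone_points_def] B[unfolded cone_points_def]
            rep(1)[OF A] rep(1)[OF B]] by (rule HOL.sym)
      finally show ?thesis .
    qed
    show "cone_dist d \<omega> \<sigma> A C \<le> cone_dist d \<omega> \<sigma> A B + cone_dist d \<omega> \<sigma> B C"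
      if A: "A \<in> cone_points X d \<omega> obs \<sigma>" and B: "B \<in> cone_points X d \<omega> obs \<sigma>"
        and C: "C \<in> cone_points X d \<omega> obs \<sigma>" for A B C
    proof -
      note r = rep(2)[OF A] rep(2)[OF B] rep(2)[OF C]
      show ?thesis
        unfolding cone_dist_def
        using triangle[OF QX[OF r(1)] QX[OF r(2)] QX[OF r(3)]] fin[OF r(1,2)] fin[OF r(2,3)]
        by (simp add: enn2real_mono flip: enn2real_plus)
    qed
  qed
qed

definition cone_topology ::
  "'a set \<Rightarrow> ('a \<Rightarrow> 'a \<Rightarrow> real) \<Rightarrow> nat filter \<Rightarrow> (nat \<Rightarrow> 'a) \<Rightarrow> (nat \<Rightarrow> real) \<Rightarrow> (nat \<Rightarrow> 'a) set topology" where
  "cone_topology X d \<omega> obs \<sigma> =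
    Metric_space.mtopology (cone_points X d \<omega> obs \<sigma>) (cone_dist d \<omega> \<sigma>)"


section \<open>Simple connectedness\<close>

text \<open>The library's \<open>simply_connected\<close> is about subsets of a topological type; this is
  the notion for abstract topologies: path-connected with trivial fundamental group.\<close>

definition simply_connected_space :: "'a topology \<Rightarrow> bool" where
  "simply_connected_space X \<longleftrightarrow>
    topspace X \<noteq> {} \<and> path_connected_space X \<and>
    (\<forall>p c. pathin X p \<and> p 0 = c \<and> p 1 = c \<longrightarrow>
       homotopic_with (\<lambda>q. q 0 = c \<and> q 1 = c) (top_of_set {0..1}) X p (\<lambda>_. c))"

end

theory Submission
  imports Defs
begin

text \<open>The group is a multiple HNN extension of the free abelian group generated by \<open>a\<close>, \<open>x\<close>, \<open>y\<close>. Let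
  \<open>L\<^sup>\<beta> = 2\<close> and let the norm of \<open>x\<^sup>i y\<^sup>j\<close> be \<open>\<bar>i\<bar>\<^sup>\<beta> + \<bar>j\<bar>\<^sup>\<beta>\<close>. Then \<open>a\<^sup>k\<close>, \<open>x\<^sup>k\<close>, \<open>y\<^sup>k\<close> all have norm \<open>\<bar>k\<bar>\<^sup>\<beta>\<close>, so
  conjugation by stable letters preserves the norm, and the norm is comparable to word length in the
  whole group: the vertex group is a snowflaked plane, in which configurations of size \<open>R m\<close> are filled
  by a number of relations of length \<open>m\<close> that depends on \<open>R\<close> only.

  A trivial word of length \<open>N m\<close> is, by Britton's lemma, a nest of pinches. Descend to the deepest pinched
  word that still has nearly full length: its own pinches are shorter and are filled by induction on
  \<open>N\<close>, and its value is pushed outwards along a thin strip. Hence equal words of length at most \<open>N m\<close>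
  differ by a number of replacements of size \<open>m\<close> that depends on \<open>N\<close> only.

  A replacement moves a path uniformly by a multiple of its size. Cutting along short transversals,
  two loops of the cone at uniform distance \<open>\<epsilon>\<close> are therefore joined by a chain of loops with steps
  \<open>\<epsilon> / 2\<close> that stays within a multiple of \<open>\<epsilon>\<close>. Iterating this between a given loop and the constant one
  and passing to the limit in the complete cone gives the null homotopy.\<close>

section \<open>Words over the generators\<close>

text \<open>The obstacle is that pinches may be nested as deeply as the word is long, so an
  induction on the nesting depth would lose every bound on the number of moves. The way out is a
  dichotomy for the whole nest at once. Outside a core of nearly full length only short words
  remain. If consecutive pinches always agree in direction, the short prefix carries powers of one
  generator to powers of another; if two of them disagree, transversality of the lines in the
  snowflake norm bounds the value of the core by the lengths of the short words. Either way one
  stage costs boundedly many moves, whatever the depth. Fillings are recorded as linear sequences of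
  words and not as planar diagrams. The number of words does not depend on the scale, so such a
  sequence passes to the ultralimit, where it is read directly as a sweep of paths. The price is
  that the sweep must also keep its two ends on prescribed sides; otherwise sweeps of neighbouring
  squares could not be glued to loops.\<close>

definition linv :: "'x \<times> bool \<Rightarrow> 'x \<times> bool" where
  "linv c = (fst c, \<not> snd c)"

lemma linv_linv [simp]: "linv (linv c) = c"
  by (simp add: linv_def)

lemma word_inv_Nil [simp]: "word_inv [] = []"
  by (simp add: word_inv_def)

lemma word_inv_Cons [simp]: "word_inv (c # w) = word_inv w @ [linv c]"
  by (simp add: word_inv_def linv_def split: prod.splits)

lemma word_inv_append [simp]: "word_inv (u @ v) = word_inv v @ word_inv u"
  by (simp add: word_inv_def)

lemma word_inv_word_inv [simp]: "word_inv (word_inv w) = w"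
  by (induction w) auto

lemma length_word_inv [simp]: "length (word_inv w) = length w"
  by (simp add: word_inv_def)

lemma pres_eq_cancel_linv: "pres_eq R (p @ [c, linv c] @ q) (p @ q)"
  using pres_eq.cancel[of R p "fst c" "snd c" q] by (simp add: linv_def)

lemma pres_eq_word_inv_right: "pres_eq R (w @ word_inv w) []"
  using pres_eq_word_inv[of R "word_inv w"] by simp

definition plane_gens :: "GL_gen set" where
  "plane_gens = {Gen_a, Gen_x, Gen_y}"

definition stable :: "GL_gen \<times> bool \<Rightarrow> bool" where
  "stable c \<longleftrightarrow> fst c \<in> {Gen_s, Gen_t}"

lemma plane_gens_simps [simp]: "Gen_a \<in> plane_gens" "Gen_x \<in> plane_gens" "Gen_y \<in> plane_gens"
  by (simp_all add: plane_gens_def)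

lemma not_stable [simp]: "g \<in> plane_gens \<Longrightarrow> \<not> stable (g, b)"
  by (auto simp: plane_gens_def stable_def)

lemma stable_simps [simp]: "stable (Gen_s, b)" "stable (Gen_t, b)"
  by (simp_all add: stable_def)

text \<open>The relations say \<open>c r c\<^sup>-\<^sup>1 = l\<close> for a stable letter \<open>c\<close>, where \<open>l\<close> is
  \<open>lft c\<close> and \<open>r\<close> is \<open>rgt c\<close>.\<close>

definition lft :: "GL_gen \<times> bool \<Rightarrow> GL_gen" where
  "lft c = (if snd c then (if fst c = Gen_s then Gen_x else Gen_y) else Gen_a)"

abbreviation rgt :: "GL_gen \<times> bool \<Rightarrow> GL_gen" where
  "rgt c \<equiv> lft (linv c)"

lemma lft_plane [simp]: "lft c \<in> plane_gens"
  by (simp add: lft_def plane_gens_def)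

lemma stable_linv [simp]: "stable (linv c) \<longleftrightarrow> stable c"
  by (simp add: linv_def stable_def)

lemma not_plane_imp_stable: "g \<notin> plane_gens \<Longrightarrow> stable (g, b)"
  by (cases g) auto

definition bsign :: "bool \<Rightarrow> int" where
  "bsign b = (if b then 1 else - 1)"

lemma bsign_simps [simp]: "bsign True = 1" "bsign False = - 1" "bsign (\<not> b) = - bsign b"
  by (simp_all add: bsign_def)

locale snowflake_group =
  fixes L :: nat
  assumes L2: "2 \<le> L"
begin

abbreviation geq :: "GL_gen gword \<Rightarrow> GL_gen gword \<Rightarrow> bool" (infix "\<simeq>" 50) where
  "u \<simeq> v \<equiv> pres_eq (GL_relations L) u v"

subsection \<open>Parsing words as elements of the vertex group\<close>

text \<open>The vertex group generated by \<open>a\<close>, \<open>x\<close>, \<open>y\<close> is free abelian on \<open>a\<close> and \<open>x\<close>;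
  in this basis \<open>y = a\<^sup>L x\<^sup>-\<^sup>1\<close> is \<open>(L, -1)\<close>.\<close>

definition vmul :: "int \<Rightarrow> GL_gen \<Rightarrow> int \<times> int" where
  "vmul k g = (case g of Gen_a \<Rightarrow> (k, 0) | Gen_x \<Rightarrow> (0, k) | Gen_y \<Rightarrow> (k * int L, - k) | _ \<Rightarrow> 0)"

lemma vmul_simps [simp]:
  "vmul k Gen_a = (k, 0)" "vmul k Gen_x = (0, k)" "vmul k Gen_y = (k * int L, - k)"
  by (simp_all add: vmul_def)

lemma vmul_add: "vmul (k + l) g = vmul k g + vmul l g"
  by (simp add: vmul_def algebra_simps zero_prod_def split: GL_gen.splits)

lemma vmul_minus: "vmul (- k) g = - vmul k g"
  by (simp add: vmul_def algebra_simps zero_prod_def split: GL_gen.splits)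

lemma vmul_diff: "vmul (k - l) g = vmul k g - vmul l g"
  using vmul_add[of k "- l" g] by (simp add: vmul_minus)

lemma vmul_0 [simp]: "vmul 0 g = 0"
  by (simp add: vmul_def zero_prod_def split: GL_gen.splits)

lemma vmul_eq_0: "g \<in> plane_gens \<Longrightarrow> vmul k g = 0 \<Longrightarrow> k = 0"
  by (auto simp: zero_prod_def plane_gens_def)

text \<open>Britton's lemma is the statement that this parsing predicate depends only on the group
  element.\<close>

inductive parses :: "GL_gen gword \<Rightarrow> int \<times> int \<Rightarrow> bool" where
  Nil: "parses [] 0"
| letter: "parses u z \<Longrightarrow> g \<in> plane_gens \<Longrightarrow>
    parses (u @ [(g, b)]) (z + vmul (bsign b) g)"
| pinch: "parses u z \<Longrightarrow> parses v (vmul k (rgt c)) \<Longrightarrow> stable c \<Longrightarrow>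
    parses (u @ [c] @ v @ [linv c]) (z + vmul k (lft c))"

lemma parses_letter: "g \<in> plane_gens \<Longrightarrow> parses [(g, b)] (vmul (bsign b) g)"
  using letter[OF Nil, of g b] by simp

lemma parses_pinch:
  "parses v (vmul k (rgt c)) \<Longrightarrow> stable c \<Longrightarrow> parses ([c] @ v @ [linv c]) (vmul k (lft c))"
  using pinch[OF Nil, of v k c] by simp

lemma parses_append: "parses v z' \<Longrightarrow> parses u z \<Longrightarrow> parses (u @ v) (z + z')"
proof (induction rule: parses.induct)
  case (letter v z' g b)
  then show ?case
    using parses.letter[of "u @ v" "z + z'" g b] by (simp add: add.assoc)
next
  case (pinch v z' w k c)
  then show ?case
    using parses.pinch[of "u @ v" "z + z'" w k c] by (simp add: add.assoc)
qed simp

lemma parses_word_inv: "parses u z \<Longrightarrow> parses (word_inv u) (- z)"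
proof (induction rule: parses.induct)
  case Nil
  show ?case by (simp add: parses.Nil)
next
  case (letter u z g b)
  have "parses [linv (g, b)] (- vmul (bsign b) g)"
    using parses_letter[OF letter.hyps(2), of "\<not> b"] by (simp add: linv_def vmul_minus)
  from parses_append[OF letter.IH this] show ?case by (simp add: algebra_simps)
next
  case (pinch u z v k c)
  have "parses (word_inv v) (vmul (- k) (rgt c))"
    using pinch.IH(2) by (simp add: vmul_minus)
  from parses_append[OF pinch.IH(1) parses_pinch[OF this pinch.hyps(3)]]
  show ?case by (simp add: vmul_minus algebra_simps)
qed

lemma parses_Nil_iff: "parses [] z \<longleftrightarrow> z = 0"
  by (auto elim: parses.cases intro: parses.Nil)

lemma parses_snoc_letter:
  assumes "parses (p @ [(g, b)]) z" "g \<in> plane_gens"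
  shows "parses p (z - vmul (bsign b) g)"
  using assms(1)
proof cases
  case (pinch u z v k c)
  then have "(g, b) = linv c"
    by (auto simp flip: append_assoc append_Cons)
  then show ?thesis using assms(2) pinch(5) stable_linv[of c] by (metis not_stable)
qed auto

text \<open>A final stable letter can only close a pinch, so inverting the last rule finds its
  partner.\<close>

lemma parses_snoc_stable:
  assumes "parses (p @ [c]) z" "stable c"
  obtains u v k z' where "p = u @ [linv c] @ v" "parses u z'" "parses v (vmul k (lft c))"
    "z = z' + vmul k (rgt c)"
  using assms(1)
proof cases
  case (letter u z' g b)
  then show ?thesis using assms(2) by auto
next
  case (pinch u z' v k c')
  then have "c' = linv c" "p = u @ [linv c] @ v"
    using pinch(1) by (auto simp flip: append_assoc append_Cons)
  then show ?thesis using that[of u v z' k] pinch by simp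
qed auto

text \<open>Parses grow to the right, so the pinch opened by the first letter need not be the last
  rule; the induction strips off what was parsed after it.\<close>

lemma parses_Cons_stable:
  assumes "parses w z" "w = c # q" "stable c"
  shows "\<exists>v u k z'. q = v @ [linv c] @ u \<and> parses v (vmul k (rgt c)) \<and> parses u z' \<and>
    z = vmul k (lft c) + z'"
  using assms
proof (induction arbitrary: q rule: parses.induct)
  case (letter u z g b)
  show ?case
  proof (cases u)
    case Nil
    then show ?thesis using letter by auto
  next
    case (Cons d u')
    then obtain v u'' k z' where *: "u' = v @ [linv c] @ u''" "parses v (vmul k (rgt c))"
        "parses u'' z'" "z = vmul k (lft c) + z'"
      using letter.IH[of u'] letter.prems by auto
    then have "q = v @ [linv c] @ (u'' @ [(g, b)])"
      using letter.prems Cons by simp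
    then show ?thesis
      using *(2,4) parses.letter[OF *(3) letter.hyps(2), of b] by (metis add.assoc)
  qed
next
  case (pinch u z v k d)
  show ?case
  proof (cases u)
    case Nil
    then have "z = 0" using pinch.hyps(1) by (simp add: parses_Nil_iff)
    then show ?thesis
      using pinch Nil parses.Nil
      by (intro exI[of _ v] exI[of _ "[]"] exI[of _ k] exI[of _ 0]) auto
  next
    case (Cons e u')
    then obtain v' u'' k' z' where *: "u' = v' @ [linv c] @ u''" "parses v' (vmul k' (rgt c))"
        "parses u'' z'" "z = vmul k' (lft c) + z'"
      using pinch.IH(1)[of u'] pinch.prems by auto
    then have "q = v' @ [linv c] @ (u'' @ [d] @ v @ [linv d])"
      using pinch.prems Cons by simp
    then show ?thesis
      using *(2,4) parses.pinch[OF *(3) pinch.hyps(2,3)] by (metis add.assoc)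
  qed
qed simp

text \<open>The heart of Britton's lemma. When the cancelled pair destroys a pinch, the stable
  letters left over find new partners: neighbouring pinches merge, or a nested pinch is turned
  inside out. The values still add up because \<open>vmul\<close> is additive in the
  exponent.\<close>

lemma parses_cancel:
  "parses w z \<Longrightarrow> w = p @ [c, linv c] @ q \<Longrightarrow> parses (p @ q) z"
proof (induction arbitrary: p q rule: parses.induct)
  case (letter u z g b)
  show ?case
  proof (cases q rule: rev_cases)
    case Nil
    then have u: "u = p @ [(g, \<not> b)]"
      using letter.prems by (cases u rule: rev_cases) (auto simp: linv_def prod_eq_iff)
    have "parses p (z - vmul (bsign (\<not> b)) g)"
      using letter.hyps(1)[unfolded u] letter.hyps(2) by (rule parses_snoc_letter)
    then show ?thesis using Nil by (simp add: vmul_minus)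
  next
    case (snoc q' d)
    then have "parses (p @ q') z" using letter.IH[of p q'] letter.prems by simp
    then show ?thesis
      using parses.letter[OF _ letter.hyps(2), of "p @ q'" z b] letter.prems snoc by simp
  qed
next
  case (pinch u z v k d)
  show ?case
  proof (cases q rule: rev_cases)
    case Nil
    then have eq: "u @ [d] @ v = p @ [c]" "c = d"
      using pinch.prems by (auto simp: linv_def prod_eq_iff)
    show ?thesis
    proof (cases v rule: rev_cases)
      case v: Nil
      \<comment> \<open>The empty interior has value 0, and \<open>vmul\<close> is injective on
        plane generators, so the pinch contributes nothing.\<close>
      then have "k = 0"
        using pinch.hyps(2) vmul_eq_0[OF lft_plane] by (simp add: parses_Nil_iff)
      then show ?thesis using pinch.hyps(1) eq v Nil by simp
    next
      case (snoc v' e)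
      then have v: "v = v' @ [d]" "p = u @ [d] @ v'"
        using eq by (auto simp flip: append_assoc append_Cons)
      \<comment> \<open>The interior ends in \<open>d\<close>, which closes a pinch opened by
        \<open>linv d\<close> inside it. After the cancellation that \<open>linv d\<close> closes
        the outer \<open>d\<close>, and \<open>v1\<close> is left outside on the right.\<close>
      obtain u1 v1 k1 z1 where *: "v' = u1 @ [linv d] @ v1" "parses u1 z1"
          "parses v1 (vmul k1 (lft d))" "vmul k (rgt d) = z1 + vmul k1 (rgt d)"
        using parses_snoc_stable[OF pinch.hyps(2)[unfolded v(1)] pinch.hyps(3)] by metis
      have "z1 = vmul (k - k1) (rgt d)"
        using *(4) by (simp add: vmul_diff)
      then have "parses (u @ [d] @ u1 @ [linv d]) (z + vmul (k - k1) (lft d))"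
        using parses.pinch[OF pinch.hyps(1) _ pinch.hyps(3)] *(2) by blast
      from parses_append[OF *(3) this] show ?thesis
        using v * Nil by (simp add: vmul_diff)
    qed
  next
    case (snoc q' e)
    then have eq: "u @ [d] @ v = p @ [c, linv c] @ q'" and q: "q = q' @ [linv d]"
      using pinch.prems by (auto simp flip: append_assoc append_Cons)
    from eq consider (left) r where "u = p @ [c, linv c] @ r" "q' = r @ [d] @ v"
      | (split1) "u = p @ [c]" "linv c = d" "q' = v"
      | (split2) "u = p" "c = d" "v = linv c # q'"
      | (right) r where "p = u @ [d] @ r" "v = r @ [c, linv c] @ q'"
      by (auto simp: append_eq_append_conv2 append_eq_Cons_conv Cons_eq_append_conv)
    then show ?thesis
    proof cases
      case left
      then show ?thesis
        using parses.pinch[OF pinch.IH(1)[OF left(1)] pinch.hyps(2,3)] q by simp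
    next
      case split1
      then have c: "c = linv d" by auto
      \<comment> \<open>The adjacent pinches around \<open>v1\<close> and around \<open>v\<close>
        become one pinch around \<open>v1 @ v\<close>.\<close>
      then obtain u1 v1 k1 z1 where *: "p = u1 @ [d] @ v1" "parses u1 z1"
          "parses v1 (vmul k1 (rgt d))" "z = z1 + vmul k1 (lft d)"
        using parses_snoc_stable[of p c z] pinch.hyps(1,3) split1 by (metis linv_linv stable_linv)
      have "parses (v1 @ v) (vmul (k1 + k) (rgt d))"
        using parses_append[OF pinch.hyps(2) *(3)] by (simp add: vmul_add)
      from parses.pinch[OF *(2) this pinch.hyps(3)] show ?thesis
        using * split1 q by (simp add: vmul_add add.assoc)
    next
      case split2
      \<comment> \<open>Mirror image of the interior ending in \<open>d\<close>: now
        \<open>v1\<close> leaves the pinch on the left.\<close>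
      then obtain v1 u1 k1 z1 where *: "q' = v1 @ [d] @ u1" "parses v1 (vmul k1 (lft d))"
          "parses u1 z1" "vmul k (rgt d) = vmul k1 (rgt d) + z1"
        using parses_Cons_stable[OF pinch.hyps(2), of "linv d" q'] pinch.hyps(3)
        unfolding stable_linv linv_linv by blast
      have "z1 = vmul (k - k1) (rgt d)"
        using *(4) by (simp add: vmul_diff)
      then have "parses ((u @ v1) @ [d] @ u1 @ [linv d]) (z + vmul k1 (lft d) + vmul (k - k1) (lft d))"
        using parses.pinch[OF parses_append[OF *(2) pinch.hyps(1)] _ pinch.hyps(3)] *(3) by blast
      then show ?thesis
        using * split2 q by (simp add: vmul_diff)
    next
      case right
      then show ?thesis
        using parses.pinch[OF pinch.hyps(1) pinch.IH(2)[OF right(2)] pinch.hyps(3)] q by simp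
    qed
  qed
qed simp

text \<open>A word of value 0 may even be placed inside a pinch, since it leaves the exponent of the
  interior unchanged.\<close>

lemma parses_insert:
  "parses w z \<Longrightarrow> w = p @ q \<Longrightarrow> parses w0 0 \<Longrightarrow> parses (p @ w0 @ q) z"
proof (induction arbitrary: p q rule: parses.induct)
  case Nil
  then show ?case by simp
next
  case (letter u z g b)
  show ?case
  proof (cases q rule: rev_cases)
    case Nil
    then show ?thesis
      using parses_append[OF letter.prems(2) parses.letter[OF letter.hyps, of b]] letter.prems by simp
  next
    case (snoc q' d)
    then have "parses (p @ w0 @ q') z" using letter.IH[of p q'] letter.prems by simp
    then show ?thesis
      using parses.letter[OF _ letter.hyps(2), of "p @ w0 @ q'" z b] letter.prems snoc by simp
  qed
next
  case (pinch u z v k d)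
  show ?case
  proof (cases q rule: rev_cases)
    case Nil
    then show ?thesis
      using parses_append[OF pinch.prems(2) parses.pinch[OF pinch.hyps]] pinch.prems by auto
  next
    case (snoc q' e)
    then have eq: "u @ [d] @ v = p @ q'" and q: "q = q' @ [linv d]"
      using pinch.prems by (auto simp flip: append_assoc append_Cons)
    from eq consider (left) r where "u = p @ r" "q' = r @ [d] @ v"
      | (right) r where "p = u @ [d] @ r" "v = r @ q'"
      by (auto simp: append_eq_append_conv2 append_eq_Cons_conv Cons_eq_append_conv)
    then show ?thesis
    proof cases
      case left
      then show ?thesis
        using parses.pinch[OF pinch.IH(1)[OF left(1) pinch.prems(2)] pinch.hyps(2,3)] q by simp
    next
      case right
      then show ?thesis
        using parses.pinch[OF pinch.hyps(1) pinch.IH(2)[OF right(2) pinch.prems(2)] pinch.hyps(3)] q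
        by simp
    qed
  qed
qed

lemma parses_delete: "parses (p @ w @ word_inv w @ q) z \<Longrightarrow> parses (p @ q) z"
proof (induction w arbitrary: p q)
  case (Cons c w)
  have "parses ((p @ [c]) @ w @ word_inv w @ [linv c] @ q) z"
    using Cons.prems by simp
  from Cons.IH[OF this] have "parses (p @ [c, linv c] @ q) z" by simp
  then show ?case by (rule parses_cancel) simp
qed simp

text \<open>Insert \<open>word_inv l @ r\<close>, which has value 0, after \<open>l\<close>; then
  delete \<open>l\<close> against its inverse.\<close>

lemma parses_swap:
  assumes "parses l z0" "parses r z0" "parses (p @ l @ q) z"
  shows "parses (p @ r @ q) z"
proof -
  have "parses (word_inv l @ r) 0"
    using parses_append[OF assms(2) parses_word_inv[OF assms(1)]] by simp
  from parses_insert[OF assms(3) _ this, of "p @ l" q]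
  have "parses (p @ l @ word_inv l @ r @ q) z" by simp
  then show ?thesis by (rule parses_delete)
qed

lemma parses_replicate: "parses (concat (replicate n [(Gen_a, True)])) (int n, 0)"
proof (induction n)
  case 0
  then show ?case by (simp add: parses.Nil flip: zero_prod_def)
next
  case (Suc n)
  have *: "concat (replicate (Suc n) [(Gen_a, True)]) = [(Gen_a, True)] @ concat (replicate n [(Gen_a, True)])"
    by simp
  show ?case
    unfolding * using parses_append[OF Suc parses_letter[of Gen_a True]] by simp
qed

lemma parses_relations:
  assumes "(l, r) \<in> GL_relations L"
  shows "\<exists>z. parses l z \<and> parses r z"
proof -
  have comm: "parses (word_comm (gen g) (gen h)) 0" if "g \<in> plane_gens" "h \<in> plane_gens" for g h
  proof -
    have *: "parses [(g, True)] (vmul 1 g)" "parses [(h, True)] (vmul 1 h)"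
      using parses_letter[of g True] parses_letter[of h True] that by simp_all
    show ?thesis
      using parses_append[OF parses_append[OF parses_append[OF parses_word_inv[OF *(2)]
        parses_word_inv[OF *(1)]] *(2)] *(1)]
      by (simp add: word_comm_def gen_def)
  qed
  have conj: "parses (gen g @ gen Gen_a @ word_inv (gen g)) (vmul 1 (lft (g, True)))"
    if "stable (g, True)" for g
    using parses_pinch[of "gen Gen_a" 1 "(g, True)"] parses_letter[of Gen_a True] that
    by (auto simp: gen_def lft_def linv_def word_inv_def)
  have xy: "parses (gen Gen_x @ gen Gen_y) (int L, 0)"
    using parses_append[OF parses_letter[of Gen_y True] parses_letter[of Gen_x True]]
    by (simp add: gen_def)
  have pow: "parses (word_pow (gen Gen_a) L) (int L, 0)"
    using parses_replicate[of L] by (simp add: word_pow_def gen_def)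
  have x: "parses (gen Gen_x) (vmul 1 Gen_x)" and y: "parses (gen Gen_y) (vmul 1 Gen_y)"
    using parses_letter[of Gen_x True] parses_letter[of Gen_y True] by (simp_all add: gen_def)
  show ?thesis
    using assms conj[of Gen_s] conj[of Gen_t] xy pow x y comm[of Gen_a Gen_x] comm[of Gen_x Gen_y]
      comm[of Gen_y Gen_a] parses.Nil
    by (auto simp: GL_relations_def Let_def lft_def zero_prod_def)
qed

text \<open>This is Britton's lemma: in particular every word that is trivial in the group parses to
  0, hence is a nest of pinches.\<close>

theorem parses_cong: "u \<simeq> v \<Longrightarrow> parses u z \<longleftrightarrow> parses v z"
proof (induction rule: pres_eq.induct)
  case (cancel p x b q)
  have *: "[(x, b), (x, \<not> b)] = [(x, b), linv (x, b)]"
    by (simp add: linv_def)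
  have "parses [(x, b), linv (x, b)] 0"
  proof (cases "x \<in> plane_gens")
    case True
    then show ?thesis
      using parses_append[OF parses_word_inv[OF parses_letter[of x b]] parses_letter[of x b]] by simp
  next
    case False
    then show ?thesis
      using parses_pinch[of "[]" 0 "(x, b)"] not_plane_imp_stable[of x b] by (simp add: parses.Nil)
  qed
  then show ?case
    unfolding * using parses_cancel parses_insert by blast
next
  case (relation l r p q)
  then show ?case
    using parses_relations parses_swap by blast
qed auto

subsection \<open>Parsed words are equal in the group\<close>


abbreviation GG where
  "GG \<equiv> presented_group (GL_relations L)"

interpretation GL: group GG
  by (rule group_presented_group)

abbreviation gmul (infixl "\<cdot>" 70) where "g \<cdot> h \<equiv> g \<otimes>\<^bsub>GG\<^esub> h"
abbreviation gpow :: "GL_gen gword set \<Rightarrow> int \<Rightarrow> GL_gen gword set" (infixr "\<up>" 75) where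
  "g \<up> k \<equiv> g [^]\<^bsub>GG\<^esub> k"
abbreviation ginv where "ginv g \<equiv> inv\<^bsub>GG\<^esub> g"
abbreviation ev where "ev \<equiv> pres_class (GL_relations L)"

lemma ev_closed [simp]: "ev u \<in> carrier GG"
  by (simp add: carrier_presented_group)

lemma ev_append: "ev (u @ v) = ev u \<cdot> ev v"
  by (simp add: mult_presented_group)

lemma ev_Nil: "ev [] = \<one>\<^bsub>GG\<^esub>"
  by (simp add: one_presented_group)

lemma ev_word_inv: "ev (word_inv u) = ginv (ev u)"
  by (rule GL.inv_equality[symmetric])
    (simp_all add: one_presented_group mult_presented_group pres_class_eq_iff pres_eq_word_inv)

lemma ev_relation: "(l, r) \<in> GL_relations L \<Longrightarrow> ev l = ev r"
  using pres_eq.relation[of l r "GL_relations L" "[]" "[]"] by (simp add: pres_class_eq_iff)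

lemma conj_int_pow:
  assumes g: "g \<in> carrier GG" and h: "h \<in> carrier GG"
  shows "g \<cdot> h \<up> k \<cdot> ginv g = (g \<cdot> h \<cdot> ginv g) \<up> k"
proof -
  have "(\<lambda>h. g \<cdot> h \<cdot> ginv g) \<in> hom GG GG"
  proof (rule homI)
    fix x y assume xy: "x \<in> carrier GG" "y \<in> carrier GG"
    have "ginv g \<cdot> (g \<cdot> z) = z" if "z \<in> carrier GG" for z
      using g that by (simp flip: GL.m_assoc)
    then show "g \<cdot> (x \<cdot> y) \<cdot> ginv g = g \<cdot> x \<cdot> ginv g \<cdot> (g \<cdot> y \<cdot> ginv g)"
      using g xy by (simp add: GL.m_assoc)
  qed (use g in auto)
  from hom_int_pow[OF this h GL.is_group GL.is_group] show ?thesis .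
qed

lemma int_pow_commute:
  assumes g: "g \<in> carrier GG" and h: "h \<in> carrier GG" and comm: "g \<cdot> h = h \<cdot> g"
  shows "g \<cdot> h \<up> k = h \<up> k \<cdot> g"
proof -
  have "g \<cdot> h \<cdot> ginv g = h"
    using g h comm by (simp add: GL.m_assoc)
  then have "g \<cdot> h \<up> k \<cdot> ginv g = h \<up> k"
    using conj_int_pow[OF g h] by simp
  then have "g \<cdot> h \<up> k \<cdot> ginv g \<cdot> g = h \<up> k \<cdot> g" by simp
  then show ?thesis
    using g h by (simp add: GL.m_assoc)
qed

abbreviation gl :: "GL_gen \<Rightarrow> GL_gen gword set" where
  "gl g \<equiv> ev [(g, True)]"

lemma gl_commute: "gl Gen_a \<cdot> gl Gen_x = gl Gen_x \<cdot> gl Gen_a"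
proof -
  have "ev (word_comm (gen Gen_a) (gen Gen_x)) = ev []"
    using ev_relation[of "word_comm (gen Gen_a) (gen Gen_x)" "[]"]
    by (simp add: GL_relations_def Let_def)
  then have *: "gl Gen_a \<cdot> (gl Gen_x \<cdot> (ginv (gl Gen_a) \<cdot> ginv (gl Gen_x))) = \<one>\<^bsub>GG\<^esub>"
    by (simp only: word_comm_def gen_def ev_append ev_word_inv ev_Nil)
  have "gl Gen_a \<cdot> gl Gen_x =
      gl Gen_a \<cdot> (gl Gen_x \<cdot> (ginv (gl Gen_a) \<cdot> ginv (gl Gen_x))) \<cdot> (gl Gen_x \<cdot> gl Gen_a)"
    by (simp add: GL.m_assoc) (simp flip: GL.m_assoc)
  then show ?thesis
    unfolding * by simp
qed

definition gvec :: "int \<times> int \<Rightarrow> GL_gen gword set" where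
  "gvec z = gl Gen_a \<up> fst z \<cdot> gl Gen_x \<up> snd z"

lemma gvec_closed [simp]: "gvec z \<in> carrier GG"
  by (simp add: gvec_def)

lemma gvec_add: "gvec (z + z') = gvec z \<cdot> gvec z'"
proof -
  have "gl Gen_x \<up> j \<cdot> gl Gen_a \<up> i = gl Gen_a \<up> i \<cdot> gl Gen_x \<up> j" for i j
    using gl_commute by (intro int_pow_commute int_pow_commute[symmetric]) auto
  then have "gl Gen_x \<up> j \<cdot> (gl Gen_a \<up> i \<cdot> h) = gl Gen_a \<up> i \<cdot> (gl Gen_x \<up> j \<cdot> h)"
    if "h \<in> carrier GG" for i j h
    using that by (simp flip: GL.m_assoc)
  then show ?thesis
    by (simp add: gvec_def GL.int_pow_mult GL.m_assoc)
qed

text \<open>Only \<open>y\<close> needs an argument: the relation \<open>a^L = x y\<close> gives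
  \<open>y = x^-1 a^L\<close>, and powers distribute over the two commuting factors.\<close>

lemma gvec_vmul:
  assumes "g \<in> plane_gens"
  shows "gvec (vmul k g) = gl g \<up> k"
proof -
  consider "g = Gen_a" | "g = Gen_x" | "g = Gen_y"
    using assms by (auto simp: plane_gens_def)
  then show ?thesis
  proof cases
    case 3
    have "ev (word_pow (gen Gen_a) L) = ev (gen Gen_x @ gen Gen_y)"
      using ev_relation[of "word_pow (gen Gen_a) L" "gen Gen_x @ gen Gen_y"]
      by (simp add: GL_relations_def Let_def)
    moreover have "ev (word_pow (gen Gen_a) n) = gl Gen_a \<up> int n" for n
    proof (induction n)
      case 0
      then show ?case by (simp add: word_pow_def ev_Nil)
    next
      case (Suc n)
      have "word_pow (gen Gen_a) (Suc n) = [(Gen_a, True)] @ word_pow (gen Gen_a) n"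
        by (simp add: word_pow_def gen_def)
      then show ?case
        using GL.int_pow_mult[of "gl Gen_a" 1 "int n"] Suc by (simp only: ev_append) simp
    qed
    ultimately have "gl Gen_a \<up> int L = gl Gen_x \<cdot> gl Gen_y"
      by (simp only: ev_append gen_def)
    then have y: "gl Gen_y = ginv (gl Gen_x) \<cdot> gl Gen_a \<up> int L"
      by (simp flip: GL.m_assoc)
    have "gl Gen_y = gvec (vmul 1 Gen_y)"
      using gvec_add[of "(0, -1)" "(int L, 0)"] y by (simp add: gvec_def GL.int_pow_neg)
    moreover have "gvec (vmul k Gen_y) = gvec (vmul 1 Gen_y) \<up> k"
    proof -
      have "gvec z \<cdot> gvec z' = gvec z' \<cdot> gvec z" for z z'
        by (simp flip: gvec_add add: add.commute)
      from this[of "(int L, 0)" "(0, -1)"] show ?thesis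
        using GL.int_pow_mult_distrib[of "gl Gen_a \<up> int L" "gl Gen_x \<up> -1" k]
        by (simp add: gvec_def GL.int_pow_pow mult.commute)
    qed
    ultimately show ?thesis using 3 by simp
  qed (simp_all add: gvec_def)
qed

lemma gl_conj:
  assumes "stable c"
  shows "ev [c] \<cdot> gl (rgt c) \<cdot> ginv (ev [c]) = gl (lft c)"
proof -
  have s: "ev (gen Gen_s @ gen Gen_a @ word_inv (gen Gen_s)) = gl Gen_x"
    and t: "ev (gen Gen_t @ gen Gen_a @ word_inv (gen Gen_t)) = gl Gen_y"
    using ev_relation[of "gen Gen_s @ gen Gen_a @ word_inv (gen Gen_s)" "gen Gen_x"]
      ev_relation[of "gen Gen_t @ gen Gen_a @ word_inv (gen Gen_t)" "gen Gen_y"]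
    by (simp_all add: GL_relations_def Let_def gen_def)
  have st: "gl h \<cdot> gl Gen_a \<cdot> ginv (gl h) = ev (gen h @ gen Gen_a @ word_inv (gen h))" for h
    by (simp only: ev_append gen_def ev_word_inv) (simp add: GL.m_assoc)
  have inv: "ginv (gl h) \<cdot> (gl h \<cdot> u \<cdot> ginv (gl h)) \<cdot> gl h = u" if "u \<in> carrier GG" for u h
    using that by (simp add: GL.m_assoc) (simp flip: GL.m_assoc)
  have neg: "ev [(h, False)] = ginv (gl h)" for h
    using ev_word_inv[of "[(h, True)]"] by (simp add: linv_def)
  obtain h b where c: "c = (h, b)" by (cases c)
  show ?thesis
    using assms s t st[of Gen_s] st[of Gen_t] inv[of "gl Gen_a" h]
    by (cases b) (auto simp: c lft_def linv_def stable_def neg)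
qed

lemma parses_imp_ev: "parses u z \<Longrightarrow> ev u = gvec z"
proof (induction rule: parses.induct)
  case Nil
  show ?case by (simp add: gvec_def ev_Nil)
next
  case (letter u z g b)
  have "ev [(g, b)] = gvec (vmul (bsign b) g)"
    using ev_word_inv[of "[(g, True)]"] letter.hyps(2)
    by (cases b) (simp_all add: gvec_vmul linv_def GL.int_pow_neg)
  then show ?case
    using letter.IH by (simp only: ev_append gvec_add)
next
  case (pinch u z v k c)
  have "ev [c] \<cdot> gl (rgt c) \<up> k \<cdot> ginv (ev [c]) = gl (lft c) \<up> k"
    by (subst conj_int_pow) (simp_all add: gl_conj pinch.hyps(3))
  then show ?case
    using pinch.IH ev_word_inv[of "[c]"]
    by (simp only: ev_append gvec_add gvec_vmul lft_plane word_inv_Cons word_inv_Nil append_Nil)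
      (simp add: GL.m_assoc)
qed

text \<open>Turns every relation that is used as a move later on into a computation with pairs of
  integers.\<close>

lemma parses_imp_eq: "parses u z \<Longrightarrow> parses v z \<Longrightarrow> u \<simeq> v"
  by (simp add: parses_imp_ev flip: pres_class_eq_iff)

subsection \<open>The snowflaked norm on the vertex group\<close>

definition \<beta> :: real where "\<beta> = log L 2"

lemma \<beta>: "0 < \<beta>" "\<beta> \<le> 1"
  using L2 by (simp_all add: \<beta>_def)

lemma L_powr_\<beta>: "real L powr \<beta> = 2"
  using L2 by (simp add: \<beta>_def)

text \<open>After division by \<open>x + y\<close> both fractions lie between 0 and 1, where raising
  to the power \<beta> \<le> 1 does not decrease.\<close>

lemma powr_subadditive:
  assumes "0 \<le> x" "0 \<le> y"
  shows "(x + y) powr \<beta> \<le> x powr \<beta> + y powr \<beta>"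
proof (cases "x + y = 0")
  case True
  then show ?thesis using assms by simp
next
  case False
  then have pos: "0 < x + y" using assms by linarith
  have le: "u / (x + y) \<le> (u / (x + y)) powr \<beta>" if "0 \<le> u" "u \<le> x + y" for u
  proof (cases "u = 0")
    case False
    then have "0 < u / (x + y)" "u / (x + y) \<le> 1" using that pos by auto
    then show ?thesis
      using powr_mono'[of \<beta> 1 "u / (x + y)"] \<beta> powr_one[of "u / (x + y)"] by (simp only:)
  qed simp
  have "1 = x / (x + y) + y / (x + y)"
    using pos by (simp flip: add_divide_distrib)
  also have "\<dots> \<le> (x / (x + y)) powr \<beta> + (y / (x + y)) powr \<beta>"
    using le[of x] le[of y] assms by linarith
  also have "\<dots> = (x powr \<beta> + y powr \<beta>) / (x + y) powr \<beta>"
    using assms pos by (simp add: powr_divide add_divide_distrib)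
  finally show ?thesis
    using pos by (simp add: field_simps)
qed

lemma abs_powr_subadditive: "\<bar>x + y\<bar> powr \<beta> \<le> \<bar>x\<bar> powr \<beta> + \<bar>y\<bar> powr \<beta>"
proof -
  have "\<bar>x + y\<bar> powr \<beta> \<le> (\<bar>x\<bar> + \<bar>y\<bar>) powr \<beta>"
    using \<beta> by (intro powr_mono2) auto
  also have "\<dots> \<le> \<bar>x\<bar> powr \<beta> + \<bar>y\<bar> powr \<beta>"
    by (rule powr_subadditive) auto
  finally show ?thesis .
qed

text \<open>Coordinates are taken with respect to \<open>x\<close> and \<open>y\<close>. The exponent \<open>\<beta>\<close> is chosen so that \<open>a\<^sup>k\<close>,
  \<open>x\<^sup>k\<close> and \<open>y\<^sup>k\<close> have equal norm; conjugation by stable letters then preserves the norm.\<close>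

definition pnorm :: "int \<times> int \<Rightarrow> real" where
  "pnorm z = \<bar>real_of_int (fst z) / L + real_of_int (snd z)\<bar> powr \<beta> + \<bar>real_of_int (fst z) / L\<bar> powr \<beta>"

abbreviation snow :: "int \<Rightarrow> real" where
  "snow k \<equiv> \<bar>real_of_int k\<bar> powr \<beta>"

lemma pnorm_add: "pnorm (z + z') \<le> pnorm z + pnorm z'"
  using abs_powr_subadditive[of "real_of_int (fst z) / L + real_of_int (snd z)"
      "real_of_int (fst z') / L + real_of_int (snd z')"]
    abs_powr_subadditive[of "real_of_int (fst z) / L" "real_of_int (fst z') / L"]
  by (simp add: pnorm_def add_divide_distrib algebra_simps)

lemma snow_div_L: "(\<bar>x\<bar> / L) powr \<beta> = \<bar>x\<bar> powr \<beta> / 2"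
  by (simp add: powr_divide L_powr_\<beta>)

lemma snow_mult_L: "snow (int L * k) = 2 * snow k"
  by (simp add: abs_mult powr_mult L_powr_\<beta>)

lemma pnorm_vmul: "g \<in> plane_gens \<Longrightarrow> pnorm (vmul k g) = snow k"
  using L2 snow_mult_L[of k] by (auto simp: plane_gens_def pnorm_def snow_div_L abs_divide mult.commute)

lemma pnorm_nonneg: "0 \<le> pnorm z"
  by (simp add: pnorm_def)

lemma snow_fst_le: "snow (fst z) \<le> 2 * pnorm z"
proof -
  have "snow (fst z) = 2 * \<bar>real_of_int (fst z) / L\<bar> powr \<beta>"
    using snow_div_L[of "real_of_int (fst z)"] by (simp add: abs_divide)
  also have "\<dots> \<le> 2 * pnorm z"
    unfolding pnorm_def by (intro mult_left_mono) auto
  finally show ?thesis .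
qed

lemma snow_snd_le: "snow (snd z) \<le> pnorm z"
  using abs_powr_subadditive[of "real_of_int (fst z) / L + real_of_int (snd z)" "- (real_of_int (fst z) / L)"]
  by (simp add: pnorm_def)

lemma snow_add: "snow (k + l) \<le> snow k + snow l"
  using abs_powr_subadditive[of k l] by simp

lemma snow_mono: "\<bar>k\<bar> \<le> \<bar>l\<bar> \<Longrightarrow> snow k \<le> snow l"
  using \<beta> by (intro powr_mono2) linarith+

lemma one_le_snow: "k \<noteq> 0 \<Longrightarrow> 1 \<le> snow k"
  using snow_mono[of 1 k] by simp

text \<open>A pinch replaces a power of one generator by the same power of another, which has the
  same norm; the bound for the interior is simply inherited.\<close>

lemma pnorm_le_length: "parses w z \<Longrightarrow> pnorm z \<le> length w"
proof (induction rule: parses.induct)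
  case (letter u z g b)
  have "snow (bsign b) = 1" by (simp add: bsign_def)
  then show ?case
    using letter.IH pnorm_add[of z "vmul (bsign b) g"] pnorm_vmul[OF letter.hyps(2)] by simp
next
  case (pinch u z v k c)
  then show ?case
    using pnorm_add[of z "vmul k (lft c)"] by (simp add: pnorm_vmul)
qed (simp add: pnorm_def zero_prod_def)

text \<open>Lines in two of the three directions diverge: one coordinate, or both coordinates
  together, bound \<open>l\<close>. In \<open>heavy_core\<close> this makes the value small as soon
  as the direction changes between two pinches.\<close>

lemma snow_le_pnorm_diff:
  assumes "g \<in> plane_gens" "h \<in> plane_gens" "g \<noteq> h"
  shows "snow l \<le> 2 * pnorm (vmul k g - vmul l h)"
proof -
  have half: "2 * \<bar>real_of_int l / L\<bar> powr \<beta> = snow l"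
    using snow_div_L[of l] by (simp add: abs_divide)
  have diff: "snow l \<le> \<bar>x - l\<bar> powr \<beta> + \<bar>x\<bar> powr \<beta>" for x :: real
    using abs_powr_subadditive[of "l - x" x] by (simp add: abs_minus_commute)
  have [simp]: "\<bar>- x\<bar> powr \<beta> = \<bar>x\<bar> powr \<beta>" for x by simp
  have pos: "0 \<le> \<bar>x\<bar> powr \<beta>" for x by simp
  consider "h = Gen_a" "g = Gen_x" | "h = Gen_a" "g = Gen_y" | "h = Gen_x" "g = Gen_a"
    | "h = Gen_x" "g = Gen_y" | "h = Gen_y" "g = Gen_a" | "h = Gen_y" "g = Gen_x"
    using assms by (auto simp: plane_gens_def)
  then show ?thesis
  proof cases
    case 1
    then have "pnorm (vmul k g - vmul l h) = \<bar>k - l / L\<bar> powr \<beta> + \<bar>real_of_int l / L\<bar> powr \<beta>"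
      by (simp add: pnorm_def)
    then show ?thesis using half pos[of "k - l / L"] by linarith
  next
    case 2
    then have "pnorm (vmul k g - vmul l h) = \<bar>- (l / L)\<bar> powr \<beta> + \<bar>k - l / L\<bar> powr \<beta>"
      using L2 by (simp add: pnorm_def diff_divide_distrib)
    then show ?thesis using half pos[of "k - l / L"] by simp
  next
    case 3
    then have "pnorm (vmul k g - vmul l h) = \<bar>k / L - l\<bar> powr \<beta> + \<bar>k / L\<bar> powr \<beta>"
      by (simp add: pnorm_def)
    then show ?thesis using diff[of "k / L"] pos[of "k / L"] pos[of "k / L - l"] by linarith
  next
    case 4
    then have "pnorm (vmul k g - vmul l h) = \<bar>- real_of_int l\<bar> powr \<beta> + snow k"
      using L2 by (simp add: pnorm_def)
    then show ?thesis using pos[of k] pos[of l] by simp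
  next
    case 5
    then have "pnorm (vmul k g - vmul l h) = \<bar>k / L\<bar> powr \<beta> + \<bar>k / L - l\<bar> powr \<beta>"
      using L2 by (simp add: pnorm_def diff_divide_distrib)
    then show ?thesis using diff[of "k / L"] pos[of "k / L"] pos[of "k / L - l"] by linarith
  next
    case 6
    then have "pnorm (vmul k g - vmul l h) = snow k + \<bar>- real_of_int l\<bar> powr \<beta>"
      using L2 by (simp add: pnorm_def)
    then show ?thesis using pos[of k] pos[of l] by simp
  qed
qed


subsection \<open>Short words for powers\<close>

text \<open>Division truncated towards zero. With rounding down, negative \<open>k\<close> would
  give multiples of \<open>L\<close> larger than \<open>k\<close> in absolute value: the norm would
  not be halved, and the recursion of \<open>apow\<close> would not end at -1.\<close>

definition quo :: "int \<Rightarrow> int" where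
  "quo k = sgn k * (\<bar>k\<bar> div int L)"

definition rmd :: "int \<Rightarrow> int" where
  "rmd k = k - int L * quo k"

lemma rmd_eq: "rmd k = sgn k * (\<bar>k\<bar> mod int L)"
proof -
  have "rmd k = sgn k * \<bar>k\<bar> - sgn k * (int L * (\<bar>k\<bar> div int L))"
    by (simp add: rmd_def quo_def mult.left_commute sgn_mult_abs)
  also have "\<dots> = sgn k * (\<bar>k\<bar> - int L * (\<bar>k\<bar> div int L))"
    by (simp only: right_diff_distrib)
  finally show ?thesis
    by (simp only: minus_mult_div_eq_mod)
qed

lemma abs_rmd_less: "\<bar>rmd k\<bar> < int L"
  using L2 by (simp add: rmd_eq abs_mult abs_sgn_eq)

lemma abs_quo: "\<bar>quo k\<bar> = \<bar>k\<bar> div int L"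
  using L2 by (auto simp: quo_def abs_mult abs_sgn_eq pos_imp_zdiv_nonneg_iff)

lemma abs_quo_mult_le: "\<bar>int L * quo k\<bar> \<le> \<bar>k\<bar>"
proof -
  have "0 \<le> \<bar>k\<bar> mod int L" using L2 by simp
  then show ?thesis
    using mult_div_mod_eq[of "int L" "\<bar>k\<bar>"] unfolding abs_mult abs_quo abs_of_nat by linarith
qed

lemma abs_quo_less: "k \<noteq> 0 \<Longrightarrow> \<bar>quo k\<bar> < \<bar>k\<bar>"
  using L2 by (simp add: abs_quo int_div_less_self)

lemma quo_mult_L: "quo (k * int L) = k" and rmd_mult_L: "rmd (k * int L) = 0"
  using L2 by (simp_all add: rmd_def quo_def abs_mult sgn_mult sgn_mult_abs)

definition aletters :: "int \<Rightarrow> GL_gen gword" where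
  "aletters k = replicate (nat \<bar>k\<bar>) (Gen_a, 0 \<le> k)"

lemma length_aletters: "length (aletters k) = nat \<bar>k\<bar>"
  by (simp add: aletters_def)

lemma aletters_0 [simp]: "aletters 0 = []"
  by (simp add: aletters_def)

lemma parses_aletters: "parses (aletters k) (k, 0)"
proof -
  have "parses (replicate n (Gen_a, b)) (bsign b * int n, 0)" for n b
  proof (induction n)
    case 0
    show ?case by (simp add: parses.Nil flip: zero_prod_def)
  next
    case (Suc n)
    then show ?case
      using parses.letter[OF Suc, of Gen_a b] by (simp add: replicate_append_same algebra_simps)
  qed
  from this[of "nat \<bar>k\<bar>" "0 \<le> k"] show ?thesis
    by (auto simp: aletters_def bsign_def split: if_splits)
qed

text \<open>Applying \<open>a\<^sup>L = x y\<close> with \<open>x\<close> and \<open>y\<close> conjugate to \<open>a\<close> recursively gives a word of length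
  of order \<open>snow k\<close> for \<open>a\<^sup>k\<close>.\<close>

function apow :: "int \<Rightarrow> GL_gen gword" where
  "apow k = (if k = 0 then [] else
     [(Gen_s, True)] @ apow (quo k) @ [(Gen_s, False)] @ [(Gen_t, True)] @ apow (quo k) @ [(Gen_t, False)] @ aletters (rmd k))"
  by pat_completeness auto
termination
  by (relation "Wellfounded.measure (\<lambda>k. nat \<bar>k\<bar>)") (use abs_quo_less in auto)

declare apow.simps [simp del]

lemma apow_0 [simp]: "apow 0 = []"
  by (simp add: apow.simps)

definition line :: "GL_gen \<Rightarrow> int \<Rightarrow> GL_gen gword" where
  "line g k = (case g of
     Gen_x \<Rightarrow> [(Gen_s, True)] @ apow k @ [(Gen_s, False)]
   | Gen_y \<Rightarrow> [(Gen_t, True)] @ apow k @ [(Gen_t, False)]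
   | _ \<Rightarrow> apow k)"

lemma line_a [simp]: "line Gen_a k = apow k"
  by (simp add: line_def)

lemma apow_rec: "k \<noteq> 0 \<Longrightarrow> apow k = line Gen_x (quo k) @ line Gen_y (quo k) @ aletters (rmd k)"
  by (subst apow.simps) (simp add: line_def)

lemma parses_apow: "parses (apow k) (k, 0)"
proof (induction k rule: apow.induct)
  case (1 k)
  show ?case
  proof (cases "k = 0")
    case True
    then show ?thesis by (simp add: parses.Nil flip: zero_prod_def)
  next
    case False
    then have q: "parses (apow (quo k)) (quo k, 0)" using 1 by blast
    have "parses (line Gen_x (quo k)) (vmul (quo k) Gen_x)" "parses (line Gen_y (quo k)) (vmul (quo k) Gen_y)"
      using parses_pinch[of "apow (quo k)" "quo k" "(Gen_s, True)"]
        parses_pinch[of "apow (quo k)" "quo k" "(Gen_t, True)"] q by (simp_all add: line_def lft_def linv_def)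
    from parses_append[OF parses_append[OF parses_aletters this(2)] this(1), of "rmd k"] show ?thesis
      using False by (simp add: apow_rec rmd_def algebra_simps)
  qed
qed

lemma parses_line: "g \<in> plane_gens \<Longrightarrow> parses (line g k) (vmul k g)"
  using parses_apow[of k] parses_pinch[of "apow k" k "(Gen_s, True)"] parses_pinch[of "apow k" k "(Gen_t, True)"]
  by (auto simp: plane_gens_def line_def lft_def linv_def)

text \<open>Twice \<open>4 + L\<close>, where each step of \<open>apow\<close> adds four stable
  letters and fewer than \<open>L\<close> letters for the remainder.\<close>

definition lconst :: nat where "lconst = 8 + 2 * L"

lemma snow_quo_le: "2 * snow (quo k) \<le> snow k"
  using snow_mult_L[of "quo k"] snow_mono[OF abs_quo_mult_le[of k]] by simp

lemma length_apow: "length (apow k) \<le> lconst * snow k"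
proof -
  \<comment> \<open>The subtracted \<open>4 + L\<close> closes the induction: twice the hypothesis
    plus \<open>4 + L\<close> new letters leaves \<open>4 + L\<close> subtracted once. For
    \<open>quo k = 0\<close> the bound is exact because \<open>lconst = 2 * (4 + L)\<close>.\<close>
  have "length (apow k) \<le> lconst * snow k - (4 + L)" if "k \<noteq> 0" for k
    using that
  proof (induction k rule: apow.induct)
    case (1 k)
    have len: "length (apow k) \<le> 2 * real (length (apow (quo k))) + 4 + L"
    proof -
      have "real (length (aletters (rmd k))) \<le> L"
        using abs_rmd_less[of k] by (simp add: length_aletters)
      then show ?thesis
        by (subst apow.simps) simp
    qed
    show ?case
    proof (cases "quo k = 0")
      case True
      have "real lconst * 1 \<le> lconst * snow k"
        using one_le_snow[OF 1(3)] by (intro mult_left_mono) auto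
      moreover have "real lconst = 8 + 2 * real L" by (simp add: lconst_def)
      ultimately show ?thesis using len unfolding True apow_0 list.size of_nat_0 by linarith
    next
      case False
      then have "length (apow (quo k)) \<le> lconst * snow (quo k) - (4 + L)"
        using 1 by simp
      moreover have "real lconst * (2 * snow (quo k)) \<le> lconst * snow k"
        by (intro mult_left_mono snow_quo_le) auto
      ultimately show ?thesis
        using len by (simp add: algebra_simps)
    qed
  qed
  from this[of k] show ?thesis
    by (cases "k = 0") auto
qed

lemma length_line: "length (line g k) \<le> lconst * snow k + 2"
  using length_apow[of k] by (cases g) (auto simp: line_def)

lemma snow_le_abs: "snow k \<le> \<bar>k\<bar>"
proof (cases "k = 0")
  case False
  then show ?thesis
    using \<beta> powr_mono[of \<beta> 1 "\<bar>real_of_int k\<bar>"] by simp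
qed simp

subsection \<open>Bounded sequences of small moves\<close>

text \<open>The size of a move is the boundary length of the cell that it sweeps across. Empty
  replacements count as well, so \<open>move m\<close> is reflexive and numbers of moves are upper
  bounds.\<close>

definition move :: "nat \<Rightarrow> GL_gen gword \<Rightarrow> GL_gen gword \<Rightarrow> bool" where
  "move m u v \<longleftrightarrow> (\<exists>p q u' v'. u = p @ u' @ q \<and> v = p @ v' @ q \<and> length u' + length v' \<le> m \<and> u' \<simeq> v')"

definition reach :: "nat \<Rightarrow> nat \<Rightarrow> GL_gen gword \<Rightarrow> GL_gen gword \<Rightarrow> bool" where
  "reach m K = move m ^^ K"

lemma reach_0 [simp]: "reach m 0 u v \<longleftrightarrow> u = v"
  by (simp add: reach_def)

lemma reach_Suc: "reach m (Suc K) u v \<longleftrightarrow> (\<exists>w. reach m K u w \<and> move m w v)"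
  by (auto simp: reach_def)

lemma reach_1: "reach m 1 u v \<longleftrightarrow> move m u v"
  by (simp add: reach_Suc)

lemma move_refl: "move m u u"
  unfolding move_def
  by (rule exI[of _ u], rule exI[of _ "[]"], rule exI[of _ "[]"], rule exI[of _ "[]"]) (simp add: pres_eq.refl)

lemma move_sym: "move m u v \<Longrightarrow> move m v u"
  unfolding move_def by (metis add.commute pres_eq.sym)

lemma move_context: "move m u v \<Longrightarrow> move m (p @ u @ q) (p @ v @ q)"
  unfolding move_def by (metis append.assoc)

lemma move_imp_eq: "move m u v \<Longrightarrow> u \<simeq> v"
  unfolding move_def by (metis pres_eq_append_left pres_eq_append_right)

lemma move_length: "move m u v \<Longrightarrow> length v \<le> length u + m"
  unfolding move_def by auto

lemma move_small: "u \<simeq> v \<Longrightarrow> length u + length v \<le> m \<Longrightarrow> move m u v"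
  unfolding move_def by (rule exI[of _ "[]"], rule exI[of _ "[]"]) auto

lemma reach_refl: "reach m K u u"
  by (induction K) (auto simp: reach_Suc intro: move_refl)

lemma reach_trans [trans]: "reach m K u v \<Longrightarrow> reach m K' v w \<Longrightarrow> reach m (K + K') u w"
  by (auto simp: reach_def relpowp_add)

lemma reach_mono: "reach m K u v \<Longrightarrow> K \<le> K' \<Longrightarrow> reach m K' u v"
  using reach_trans[of m K u v "K' - K" v] reach_refl[of m "K' - K" v] by simp

lemma reach_sym: "reach m K u v \<Longrightarrow> reach m K v u"
proof (induction K arbitrary: v)
  case (Suc K)
  then obtain w where "reach m K u w" "move m w v" by (auto simp: reach_Suc)
  then show ?case
    using reach_trans[of m 1 v w K u] Suc.IH[of w] move_sym[of m w v] unfolding reach_1 by simp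
qed simp

lemma reach_context: "reach m K u v \<Longrightarrow> reach m K (p @ u @ q) (p @ v @ q)"
proof (induction K arbitrary: v)
  case (Suc K)
  then obtain w where "reach m K u w" "move m w v" by (auto simp: reach_Suc)
  then show ?case
    using Suc.IH[of w] move_context[of m w v p q] by (auto simp: reach_Suc)
qed simp

lemma reach_left: "reach m K u v \<Longrightarrow> reach m K (p @ u) (p @ v)"
  using reach_context[of m K u v p "[]"] by simp

lemma reach_append: "reach m K u u' \<Longrightarrow> reach m K' v v' \<Longrightarrow> reach m (K + K') (u @ v) (u' @ v')"
  using reach_trans[of m K "u @ v" "u' @ v" K' "u' @ v'"] reach_context[of m K u u' "[]" v]
    reach_left[of m K' v v' u'] by simp

lemma reach_imp_eq: "reach m K u v \<Longrightarrow> u \<simeq> v"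
proof (induction K arbitrary: v)
  case (Suc K)
  then show ?case
    using move_imp_eq pres_eq.trans by (fastforce simp: reach_Suc)
qed (simp add: pres_eq.refl)

lemma reach_small: "u \<simeq> v \<Longrightarrow> length u + length v \<le> m \<Longrightarrow> reach m 1 u v"
  unfolding reach_1 by (rule move_small)

lemma reach_parses:
  "parses u z \<Longrightarrow> parses v z \<Longrightarrow> length u + length v \<le> m \<Longrightarrow> reach m 1 u v"
  by (rule reach_small[OF parses_imp_eq])

lemma reach_commute_lists:
  assumes "\<And>u v. u \<in> set us \<Longrightarrow> v \<in> set vs \<Longrightarrow> reach m K (u @ v) (v @ u)"
  shows "reach m (length us * length vs * K) (concat us @ concat vs) (concat vs @ concat us)"
  using assms
proof (induction us)
  case (Cons u us)
  have one: "reach m (length vs * K) (u @ concat vs) (concat vs @ u)"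
    using Cons.prems
  proof (induction vs)
    case (Cons v vs)
    have "reach m K ((u @ v) @ concat vs) ((v @ u) @ concat vs)"
      using reach_context[of m K "u @ v" "v @ u" "[]" "concat vs"] Cons.prems by simp
    also have "reach m (length vs * K) ((v @ u) @ concat vs) (v @ concat vs @ u)"
      using reach_left[OF Cons.IH, of v] Cons.prems by simp
    finally show ?case by simp
  qed simp
  have "reach m (length us * length vs * K) (u @ concat us @ concat vs) (u @ concat vs @ concat us)"
    using Cons by (intro reach_left) auto
  also have "reach m (length vs * K) (u @ concat vs @ concat us) (concat vs @ u @ concat us)"
    using reach_context[OF one, of "[]" "concat us"] by simp
  finally show ?case by (simp add: algebra_simps)
qed simp

subsection \<open>Filling in the vertex group\<close>

text \<open>Above this size, words of length of order \<open>lconst * L\<close> are negligible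
  against \<open>m\<close>, and \<open>unit_len m\<close> is at least \<open>L\<close>.\<close>

definition min_size :: nat where "min_size = 100 * lconst * lconst * L"

text \<open>A line of norm \<open>level 0 m\<close> has length at most \<open>m / 8 + 2\<close>, so
  that relations between few of them are single moves. Each further level doubles the norm, which
  corresponds to one step of \<open>apow\<close>.\<close>

definition level :: "nat \<Rightarrow> nat \<Rightarrow> real" where
  "level d m = 2 ^ d * (real m / (8 * lconst))"

lemma lconst_ge: "12 \<le> lconst"
  using L2 by (simp add: lconst_def)

lemma level_0: "lconst * level 0 m = m / 8"
  using lconst_ge by (simp add: level_def)

lemma level_Suc: "level (Suc d) m = 2 * level d m"
  by (simp add: level_def)

lemma level_mono: "level 0 m \<le> level d m"
  by (simp add: level_def divide_right_mono mult_le_cancel_right1)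

lemma min_size_bound:
  assumes "min_size \<le> m"
  shows "100 * lconst * L \<le> m"
proof -
  have "100 * lconst * L * 1 \<le> 100 * lconst * L * lconst"
    using lconst_ge by (intro mult_le_mono) auto
  also have "100 * lconst * L * lconst = min_size"
    by (simp add: min_size_def mult_ac)
  finally show ?thesis
    using assms by simp
qed

lemma snow_small_le_level:
  assumes "min_size \<le> m" "\<bar>k\<bar> \<le> 4 * int L"
  shows "snow k \<le> level d m"
proof -
  have "real (100 * lconst * L) \<le> m" using min_size_bound[OF assms(1)] by linarith
  then have "32 * lconst * L \<le> (m::real)"
    by simp
  then have "4 * L \<le> level 0 m"
    using lconst_ge by (simp add: level_def field_simps)
  moreover have "snow k \<le> 4 * L"
    using snow_le_abs[of k] assms(2) by linarith
  ultimately show ?thesis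
    using level_mono[of m d] by linarith
qed

lemma length_line_small:
  assumes "\<bar>k\<bar> \<le> 4 * int L"
  shows "length (line g k) \<le> 4 * lconst * L + 2"
proof -
  have "lconst * snow k \<le> lconst * (4 * L)"
    using snow_le_abs[of k] assms by (simp only: of_nat_mult) (intro mult_left_mono; linarith)
  then have "real (length (line g k)) \<le> real (4 * lconst * L + 2)"
    using length_line[of g k] by simp
  then show ?thesis by (simp only: of_nat_le_iff)
qed

text \<open>Addition and commutation are bundled because addition at one level uses both of them one
  level lower. The small third summand is there to absorb the carry.\<close>

definition mergeable :: "nat \<Rightarrow> nat \<Rightarrow> real \<Rightarrow> bool" where
  "mergeable m K R \<longleftrightarrow> (\<forall>k l. snow k \<le> R \<longrightarrow> snow l \<le> R \<longrightarrow>
     (\<forall>c g. \<bar>c\<bar> \<le> 4 \<longrightarrow> g \<in> plane_gens \<longrightarrow> reach m K (line g k @ line g l @ line g c) (line g (k + l + c))) \<and>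
     (\<forall>g h. g \<in> plane_gens \<longrightarrow> h \<in> plane_gens \<longrightarrow> reach m K (line g k @ line h l) (line h l @ line g k)))"

text \<open>Lines of \<open>x\<close> and \<open>y\<close> are conjugates of \<open>apow\<close>;
  the stable letters between the three factors cancel in two moves.\<close>

lemma line_add_from_apow:
  assumes "reach m K (apow k @ apow l @ apow c) (apow (k + l + c))" "2 \<le> m"
  shows "reach m (K + 2) (line g k @ line g l @ line g c) (line g (k + l + c))"
proof -
  have *: "reach m (K + 2) ([c0] @ apow k @ [linv c0] @ [c0] @ apow l @ [linv c0] @ [c0] @ apow c @ [linv c0])
      ([c0] @ apow (k + l + c) @ [linv c0])" for c0
  proof -
    have can: "reach m 1 (p @ [linv c0, c0] @ q) (p @ q)" for p q
      using reach_context[OF reach_small[of "[linv c0, c0]" "[]"], of m p q]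
        pres_eq_cancel_linv[of "GL_relations L" "[]" "linv c0" "[]"] assms(2) by simp
    have "reach m 1 (([c0] @ apow k) @ [linv c0, c0] @ (apow l @ [linv c0] @ [c0] @ apow c @ [linv c0]))
        (([c0] @ apow k) @ (apow l @ [linv c0] @ [c0] @ apow c @ [linv c0]))"
      by (rule can)
    also have "reach m 1 (([c0] @ apow k) @ (apow l @ [linv c0] @ [c0] @ apow c @ [linv c0]))
        (([c0] @ apow k @ apow l) @ (apow c @ [linv c0]))"
      using can[of "[c0] @ apow k @ apow l" "apow c @ [linv c0]"] by simp
    also have "reach m K (([c0] @ apow k @ apow l) @ (apow c @ [linv c0])) ([c0] @ apow (k + l + c) @ [linv c0])"
      using reach_context[OF assms(1), of "[c0]" "[linv c0]"] by simp
    finally show ?thesis by (simp add: numeral_2_eq_2)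
  qed
  show ?thesis
  proof (cases g)
    case Gen_x
    then show ?thesis using *[of "(Gen_s, True)"] by (simp add: line_def linv_def)
  next
    case Gen_y
    then show ?thesis using *[of "(Gen_t, True)"] by (simp add: line_def linv_def)
  qed (use assms(1) reach_mono[OF assms(1), of "K + 2"] in \<open>simp_all add: line_def\<close>)
qed

lemma lconst_L_ge: "24 \<le> lconst * L" "L \<le> lconst * L"
  using mult_le_mono[OF lconst_ge L2] lconst_ge by auto

lemma mergeable_0:
  assumes m: "min_size \<le> m"
  shows "mergeable m 1 (level 0 m)"
proof -
  have small: "200 * lconst \<le> m"
    using min_size_bound[OF m] mult_le_mono2[OF L2, of lconst] by linarith
  have len: "length (line g k) \<le> real m / 8 + 2" if "snow k \<le> level 0 m" for g k
  proof -
    have "lconst * snow k \<le> lconst * level 0 m"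
      using that by (intro mult_left_mono) auto
    then show ?thesis using length_line[of g k] level_0[of m] by linarith
  qed
  have m192: "192 \<le> m" using small lconst_ge by linarith
  have add: "reach m 1 (line g k @ line g l @ line g c) (line g (k + l + c))"
    if k: "snow k \<le> level 0 m" and l: "snow l \<le> level 0 m" and c: "\<bar>c\<bar> \<le> 4" and g: "g \<in> plane_gens"
    for k l c g
  proof (rule reach_parses)
    show "parses (line g k @ line g l @ line g c) (vmul k g + (vmul l g + vmul c g))"
      using g by (intro parses_append parses_line)
    show "parses (line g (k + l + c)) (vmul k g + (vmul l g + vmul c g))"
      using parses_line[OF g, of "k + l + c"] by (simp add: vmul_add add.assoc)
    have c4: "snow c \<le> 4" using snow_le_abs[of c] c by linarith
    then have lc: "length (line g c) \<le> lconst * 4 + (2::real)"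
      using length_line[of g c] mult_left_mono[of "snow c" 4 "real lconst"] by simp
    have "snow (k + l + c) \<le> level 0 m + level 0 m + 4"
      using snow_add[of "k + l" c] snow_add[of k l] k l c4 by linarith
    then have "lconst * snow (k + l + c) \<le> lconst * (level 0 m + level 0 m + 4)"
      by (intro mult_left_mono) auto
    then have "length (line g (k + l + c)) \<le> real m / 4 + 4 * lconst + 2"
      using length_line[of g "k + l + c"] level_0[of m] by (simp add: algebra_simps)
    then have "real (length (line g k @ line g l @ line g c) + length (line g (k + l + c))) \<le> m / 2 + 8 * lconst + 8"
      using len[OF k, of g] len[OF l, of g] lc by simp
    also have "\<dots> \<le> m"
      using small lconst_ge by linarith
    finally show "length (line g k @ line g l @ line g c) + length (line g (k + l + c)) \<le> m"
      by (simp only: of_nat_le_iff)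
  qed
  have comm: "reach m 1 (line g k @ line h l) (line h l @ line g k)"
    if k: "snow k \<le> level 0 m" and l: "snow l \<le> level 0 m" and g: "g \<in> plane_gens" and h: "h \<in> plane_gens"
    for k l g h
  proof (rule reach_parses)
    show "parses (line g k @ line h l) (vmul k g + vmul l h)"
      using g h by (intro parses_append parses_line)
    show "parses (line h l @ line g k) (vmul k g + vmul l h)"
      using parses_append[OF parses_line[OF g, of k] parses_line[OF h, of l]] by (simp add: add.commute)
    have "real (length (line g k @ line h l) + length (line h l @ line g k)) \<le> m"
      using len[OF k, of g] len[OF l, of h] m192 by simp
    then show "length (line g k @ line h l) + length (line h l @ line g k) \<le> m"
      by (simp only: of_nat_le_iff)
  qed
  show ?thesis
    unfolding mergeable_def using add comm by blast
qed



lemma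
  assumes "mergeable m K R" "snow k \<le> R" "snow l \<le> R"
  shows mergeable_add: "\<bar>c\<bar> \<le> 4 \<Longrightarrow> g \<in> plane_gens \<Longrightarrow> reach m K (line g k @ line g l @ line g c) (line g (k + l + c))"
    and mergeable_comm: "g \<in> plane_gens \<Longrightarrow> h \<in> plane_gens \<Longrightarrow> reach m K (line g k @ line h l) (line h l @ line g k)"
  using assms unfolding mergeable_def by blast+

lemma apow_unfold:
  assumes m: "min_size \<le> m"
  shows "reach m 1 (apow k) (line Gen_x (quo k) @ line Gen_y (quo k) @ line Gen_a (rmd k))"
proof (cases "k = 0")
  case True
  then have "reach m 1 [] (line Gen_x 0 @ line Gen_y 0 @ line Gen_a 0)"
  proof (intro reach_parses)
    show "parses (line Gen_x 0 @ line Gen_y 0 @ line Gen_a 0) 0"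
      using parses_append[OF parses_append[OF parses_line[of Gen_a 0] parses_line[of Gen_y 0]] parses_line[of Gen_x 0]]
      by (simp flip: zero_prod_def)
    show "length [] + length (line Gen_x 0 @ line Gen_y 0 @ line Gen_a 0) \<le> m"
      using min_size_bound[OF m] lconst_L_ge by (simp add: line_def)
  qed (rule parses.Nil)
  then show ?thesis using True by (simp add: quo_def rmd_def)
next
  case False
  have "reach m 1 (aletters (rmd k)) (line Gen_a (rmd k))"
  proof (rule reach_parses)
    show "length (aletters (rmd k)) + length (line Gen_a (rmd k)) \<le> m"
      using length_line_small[of "rmd k" Gen_a] abs_rmd_less[of k] min_size_bound[OF m] lconst_L_ge
      unfolding length_aletters by (simp only: mult.assoc) linarith
  qed (use parses_aletters[of "rmd k"] parses_line[of Gen_a "rmd k"] in simp_all)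
  then show ?thesis
    using reach_left[of m 1 "aletters (rmd k)" "line Gen_a (rmd k)" "line Gen_x (quo k) @ line Gen_y (quo k)"] False
    by (simp add: apow_rec)
qed

lemma line_0_reach:
  assumes m: "min_size \<le> m"
  shows "reach m 1 [] (line g 0)"
proof (cases "g = Gen_x \<or> g = Gen_y")
  case True
  then have "g \<in> plane_gens" by auto
  then show ?thesis
    using True min_size_bound[OF m] lconst_L_ge parses_line[of g 0]
    by (intro reach_parses[of _ 0]) (auto simp: parses.Nil line_def)
next
  case False
  then show ?thesis using reach_refl by (cases g) (simp_all add: line_def)
qed

text \<open>The carries: \<open>k + l + c\<close> has quotient \<open>quo k + quo l + c'\<close> with \<open>c'\<close> again bounded by 4.\<close>

lemma mergeable_Suc_add:
  assumes m: "min_size \<le> m" and IH: "mergeable m K (level d m)"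
    and k: "snow k \<le> level (Suc d) m" and l: "snow l \<le> level (Suc d) m" and c: "\<bar>c\<bar> \<le> 4"
  shows "reach m (7 * K + 4) (apow k @ apow l @ apow c) (apow (k + l + c))"
proof -
  define p w where "p = quo (k + l + c)" and "w = rmd (k + l + c)"
  define q q' c' where "q = quo k" and "q' = quo l" and "c' = p - q - q'"
  define r r' where "r = rmd k" and "r' = rmd l"
  have sq: "snow q \<le> level d m" "snow q' \<le> level d m"
    using k l snow_quo_le[of k] snow_quo_le[of l] by (simp_all add: level_Suc q_def q'_def)
  have rw: "\<bar>r\<bar> < int L" "\<bar>r'\<bar> < int L" "\<bar>w\<bar> < int L"
    using abs_rmd_less by (auto simp: r_def r'_def w_def)
  have carry: "int L * c' + w = r + r' + c"
    by (simp add: c'_def w_def p_def q_def q'_def r_def r'_def rmd_def algebra_simps)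
  have c'4: "\<bar>c'\<bar> \<le> 4"
  proof (rule ccontr)
    assume "\<not> \<bar>c'\<bar> \<le> 4"
    \<comment> \<open>Three remainders below \<open>L\<close> and the old carry, which is at most 4,
      cannot add up to \<open>5 * L\<close>.\<close>
    then have "int L * 5 \<le> int L * \<bar>c'\<bar>" by (intro mult_left_mono) auto
    also have "int L * \<bar>c'\<bar> = \<bar>int L * c'\<bar>" by (simp add: abs_mult)
    finally show False using carry rw c L2 by linarith
  qed
  have small: "snow r \<le> level d m" "snow r' \<le> level d m" "snow c' \<le> level d m"
    using rw c'4 L2 by (intro snow_small_le_level[OF m]; linarith)+
  let ?X = "line Gen_x" and ?Y = "line Gen_y" and ?A = "line Gen_a"
  note swap = reach_context[OF mergeable_comm[OF IH]]
  note add = reach_context[OF mergeable_add[OF IH]]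
  have "reach m (1 + 1) (apow k @ apow l @ apow c)
      ((?X q @ ?Y q @ ?A r) @ (?X q' @ ?Y q' @ ?A r') @ apow c)"
    using reach_append[OF apow_unfold[OF m, of k] reach_append[OF apow_unfold[OF m, of l] reach_refl[of m 0 "apow c"]]]
    by (simp add: q_def q'_def r_def r'_def)
  also have "reach m K ((?X q @ ?Y q @ ?A r) @ (?X q' @ ?Y q' @ ?A r') @ apow c)
      ((?X q @ ?Y q) @ ?X q' @ ?A r @ ?Y q' @ ?A r' @ apow c)"
    using swap[OF small(1) sq(2), of Gen_a Gen_x "?X q @ ?Y q" "?Y q' @ ?A r' @ apow c"] by simp
  also have "reach m K \<dots> (?X q @ ?X q' @ ?Y q @ ?A r @ ?Y q' @ ?A r' @ apow c)"
    using swap[OF sq, of Gen_y Gen_x "?X q" "?A r @ ?Y q' @ ?A r' @ apow c"] by simp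
  also have "reach m K \<dots> (?X q @ ?X q' @ ?Y q @ ?Y q' @ ?A r @ ?A r' @ apow c)"
    using swap[OF small(1) sq(2), of Gen_a Gen_y "?X q @ ?X q' @ ?Y q" "?A r' @ apow c"] by simp
  also have "reach m 1 \<dots> (?X q @ ?X q' @ ?Y q @ ?Y q' @ ?X c' @ ?Y c' @ ?A w)"
  proof -
    \<comment> \<open>All six exponents are at most \<open>4 * L\<close> in absolute value, so
      creating the carry is one move.\<close>
    have "reach m 1 (?A r @ ?A r' @ ?A c) (?X c' @ ?Y c' @ ?A w)"
    proof (rule reach_parses)
      show "parses (?A r @ ?A r' @ ?A c) (vmul r Gen_a + (vmul r' Gen_a + vmul c Gen_a))"
        by (intro parses_append parses_line) simp_all
      have "parses (?X c' @ ?Y c' @ ?A w) (vmul c' Gen_x + (vmul c' Gen_y + vmul w Gen_a))"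
        by (intro parses_append parses_line) simp_all
      then show "parses (?X c' @ ?Y c' @ ?A w) (vmul r Gen_a + (vmul r' Gen_a + vmul c Gen_a))"
        using carry by (simp add: algebra_simps)
      have "length (line g i) \<le> 4 * (lconst * L) + 2" if "\<bar>i\<bar> \<le> 4 * int L" for g i
        using length_line_small[OF that, of g] by (simp add: mult.assoc)
      from this[of r Gen_a] this[of r' Gen_a] this[of c Gen_a] this[of c' Gen_x] this[of c' Gen_y] this[of w Gen_a]
      show "length (?A r @ ?A r' @ ?A c) + length (?X c' @ ?Y c' @ ?A w) \<le> m"
        using rw c c'4 L2 min_size_bound[OF m] lconst_L_ge unfolding length_append mult.assoc by linarith
    qed
    from reach_left[OF this, of "?X q @ ?X q' @ ?Y q @ ?Y q'"] show ?thesis by simp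
  qed
  also have "reach m K \<dots> (?X q @ ?X q' @ ?Y q @ ?X c' @ ?Y q' @ ?Y c' @ ?A w)"
    using swap[OF sq(2) small(3), of Gen_y Gen_x "?X q @ ?X q' @ ?Y q" "?Y c' @ ?A w"] by simp
  also have "reach m K \<dots> (?X q @ ?X q' @ ?X c' @ ?Y q @ ?Y q' @ ?Y c' @ ?A w)"
    using swap[OF sq(1) small(3), of Gen_y Gen_x "?X q @ ?X q'" "?Y q' @ ?Y c' @ ?A w"] by simp
  also have "reach m K \<dots> (?X p @ ?Y q @ ?Y q' @ ?Y c' @ ?A w)"
    using add[OF sq c'4, of Gen_x "[]" "?Y q @ ?Y q' @ ?Y c' @ ?A w"] by (simp add: c'_def)
  also have "reach m K \<dots> (?X p @ ?Y p @ ?A w)"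
    using add[OF sq c'4, of Gen_y "?X p" "?A w"] by (simp add: c'_def)
  also have "reach m 1 \<dots> (apow (k + l + c))"
    using reach_sym[OF apow_unfold[OF m, of "k + l + c"]] by (simp add: p_def w_def)
  finally show ?thesis
    by (rule reach_mono) simp
qed

text \<open>Additions suffice: the partial sums \<open>i * quo k\<close> never exceed
  \<open>k\<close> in absolute value, because \<open>quo\<close> truncates towards zero.\<close>

lemma line_split:
  assumes m: "min_size \<le> m" and k: "snow k \<le> R" and g: "g \<in> plane_gens"
    and add: "\<And>i j. snow i \<le> R \<Longrightarrow> snow j \<le> R \<Longrightarrow> reach m K (line g i @ line g j) (line g (i + j))"
    and small: "\<And>r. \<bar>r\<bar> \<le> 4 * int L \<Longrightarrow> snow r \<le> R"
  shows "reach m (L * K + K + 1) (line g k) (concat (replicate L (line g (quo k)) @ [line g (rmd k)]))"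
proof -
  have le: "snow (int i * quo k) \<le> R" if "i \<le> L" for i
  proof -
    have "\<bar>int i * quo k\<bar> \<le> \<bar>int L * quo k\<bar>"
      using that by (simp add: abs_mult mult_right_mono)
    then have "snow (int i * quo k) \<le> snow k"
      using abs_quo_mult_le[of k] by (intro snow_mono) linarith
    then show ?thesis using k by linarith
  qed
  have "i \<le> L \<Longrightarrow> reach m (i * K + 1) (concat (replicate i (line g (quo k)))) (line g (int i * quo k))" for i
  proof (induction i)
    case 0
    then show ?case using line_0_reach[OF m, of g] by simp
  next
    case (Suc i)
    have eq: "concat (replicate (Suc i) (line g (quo k))) = concat (replicate i (line g (quo k))) @ line g (quo k)"
      unfolding replicate_Suc replicate_append_same[symmetric] by simp
    have "reach m (i * K + 1) (concat (replicate (Suc i) (line g (quo k)))) (line g (int i * quo k) @ line g (quo k))"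
      using reach_context[OF Suc.IH, of "[]" "line g (quo k)"] Suc.prems unfolding eq by simp
    also have "reach m K (line g (int i * quo k) @ line g (quo k)) (line g (int i * quo k + quo k))"
      using le[of i] le[of 1] Suc.prems by (intro add) auto
    also have "int i * quo k + quo k = int (Suc i) * quo k"
      by (simp add: algebra_simps)
    finally show ?case
      by (rule reach_mono) simp
  qed
  from reach_context[OF this[of L], of "[]" "line g (rmd k)"]
  have "reach m (L * K + 1) (concat (replicate L (line g (quo k)) @ [line g (rmd k)])) (line g (int L * quo k) @ line g (rmd k))"
    by simp
  also have "reach m K \<dots> (line g (int L * quo k + rmd k))"
    using le[of L] small[of "rmd k"] abs_rmd_less[of k] by (intro add) auto
  finally have "reach m (L * K + 1 + K) (concat (replicate L (line g (quo k)) @ [line g (rmd k)])) (line g k)"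
    by (simp add: rmd_def)
  from reach_sym[OF this] show ?thesis
    by (rule reach_mono) simp
qed

text \<open>Addition on the upper level is obtained through \<open>apow\<close>. It then permits
  cutting a line of the upper level into \<open>L + 1\<close> lines of the lower one, and two lines
  commute piece by piece.\<close>

lemma mergeable_Suc:
  "\<exists>K'. \<forall>m\<ge>min_size. mergeable m K (level d m) \<longrightarrow> mergeable m K' (level (Suc d) m)"
proof -
  define Ka where "Ka = 7 * K + 4 + 2 + 1"
  define Ks where "Ks = L * Ka + Ka + 1"
  \<comment> \<open>Four splittings, since both lines are cut and reassembled, and one swap for each
    pair of pieces.\<close>
  define K' where "K' = Ka + 4 * Ks + (L + 1) * (L + 1) * K"
  have "mergeable m K' (level (Suc d) m)" if m: "min_size \<le> m" and IH: "mergeable m K (level d m)" for m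
  proof -
    have m2: "2 \<le> m" using min_size_bound[OF m] lconst_L_ge by linarith
    have add3: "reach m (7 * K + 4 + 2) (line g k @ line g l @ line g c) (line g (k + l + c))"
      if "snow k \<le> level (Suc d) m" "snow l \<le> level (Suc d) m" "\<bar>c\<bar> \<le> 4" for g k l c
      using line_add_from_apow[OF mergeable_Suc_add[OF m IH that] m2] .
    have add2: "reach m Ka (line g k @ line g l) (line g (k + l))"
      if "snow k \<le> level (Suc d) m" "snow l \<le> level (Suc d) m" for g k l
    proof -
      have "reach m 1 (line g k @ line g l) (line g k @ line g l @ line g 0)"
        using reach_left[OF line_0_reach[OF m, of g], of "line g k @ line g l"] by simp
      from reach_trans[OF this add3[OF that, of 0 g]] show ?thesis
        by (simp add: Ka_def)
    qed
    have split: "reach m Ks (line g k) (concat (replicate L (line g (quo k)) @ [line g (rmd k)]))"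
      if "snow k \<le> level (Suc d) m" "g \<in> plane_gens" for g k
      unfolding Ks_def by (rule line_split[OF m that add2 snow_small_le_level[OF m]])
    have comm: "reach m K' (line g k @ line h l) (line h l @ line g k)"
      if k: "snow k \<le> level (Suc d) m" and l: "snow l \<le> level (Suc d) m"
        and g: "g \<in> plane_gens" and h: "h \<in> plane_gens" for g h k l
    proof -
      let ?us = "replicate L (line g (quo k)) @ [line g (rmd k)]"
      let ?vs = "replicate L (line h (quo l)) @ [line h (rmd l)]"
      have s: "snow (quo k) \<le> level d m" "snow (rmd k) \<le> level d m" "snow (quo l) \<le> level d m" "snow (rmd l) \<le> level d m"
        using snow_quo_le[of k] snow_quo_le[of l] k l abs_rmd_less[of k] abs_rmd_less[of l]
        by (auto simp: level_Suc intro!: snow_small_le_level[OF m])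
      have "reach m (Ks + Ks) (line g k @ line h l) (concat ?us @ concat ?vs)"
        by (intro reach_append split k l g h)
      also have "reach m (length ?us * length ?vs * K) (concat ?us @ concat ?vs) (concat ?vs @ concat ?us)"
      proof (rule reach_commute_lists)
        fix u v assume "u \<in> set ?us" "v \<in> set ?vs"
        then have "u = line g (quo k) \<or> u = line g (rmd k)" "v = line h (quo l) \<or> v = line h (rmd l)"
          by auto
        then show "reach m K (u @ v) (v @ u)"
          using s g h by (auto intro!: mergeable_comm[OF IH])
      qed
      also have "reach m (Ks + Ks) (concat ?vs @ concat ?us) (line h l @ line g k)"
        by (intro reach_append reach_sym[OF split] k l g h)
      finally show ?thesis
        by (rule reach_mono) (simp add: K'_def)
    qed
    have "reach m K' (line g k @ line g l @ line g c) (line g (k + l + c))"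
      if "snow k \<le> level (Suc d) m" "snow l \<le> level (Suc d) m" "\<bar>c\<bar> \<le> 4" for g k l c
      using add3[OF that, of g] by (rule reach_mono) (simp add: K'_def Ka_def)
    then show ?thesis
      unfolding mergeable_def using comm by blast
  qed
  then show ?thesis by blast
qed

text \<open>The level that exceeds \<open>R * m\<close> depends on \<open>R\<close> alone, hence so
  does the number of moves.\<close>

lemma mergeable_ratio: "\<exists>K. \<forall>m\<ge>min_size. mergeable m K (R * real m)"
proof -
  have all: "\<exists>K. \<forall>m\<ge>min_size. mergeable m K (level d m)" for d
  proof (induction d)
    case 0
    then show ?case using mergeable_0 by blast
  next
    case (Suc d)
    then show ?case using mergeable_Suc by blast
  qed
  obtain d where "R * (8 * lconst) < 2 ^ d"
    using real_arch_pow[of 2 "R * (8 * lconst)"] by auto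
  then have "R * m \<le> level d m" for m :: nat
    using lconst_ge mult_right_mono[of R "2 ^ d / (8 * lconst)" "real m"] by (simp add: level_def field_simps)
  moreover have "mergeable m K R'" if "mergeable m K R''" "R' \<le> R''" for m K R' R''
    using that unfolding mergeable_def by (meson order_trans)
  ultimately show ?thesis
    using all[of d] by meson
qed


section \<open>Normal forms of elements of the vertex group\<close>

definition plane :: "int \<times> int \<Rightarrow> GL_gen gword" where
  "plane z = line Gen_a (fst z) @ line Gen_x (snd z)"

lemma parses_plane: "parses (plane z) z"
  using parses_append[OF parses_line[of Gen_x "snd z"] parses_line[of Gen_a "fst z"]]
  by (simp add: plane_def)

lemma length_plane: "length (plane z) \<le> 3 * lconst * pnorm z + 2"
proof -
  have "lconst * snow (fst z) \<le> lconst * (2 * pnorm z)" "lconst * snow (snd z) \<le> lconst * pnorm z"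
    by (intro mult_left_mono snow_fst_le snow_snd_le; simp)+
  then show ?thesis
    using length_apow[of "fst z"] length_line[of Gen_x "snd z"] by (simp add: plane_def)
qed

lemma mergeable_add2:
  assumes "min_size \<le> m" "mergeable m K R" "snow k \<le> R" "snow l \<le> R" "g \<in> plane_gens"
  shows "reach m (K + 1) (line g k @ line g l) (line g (k + l))"
proof -
  have "reach m 1 (line g k @ line g l) (line g k @ line g l @ line g 0)"
    using reach_left[OF line_0_reach[OF assms(1), of g], of "line g k @ line g l"] by simp
  from reach_trans[OF this mergeable_add[OF assms(2-4), of 0 g]] assms(5) show ?thesis
    by (simp add: add.commute)
qed

lemma plane_add_reach:
  "\<exists>K. \<forall>m\<ge>min_size. \<forall>z z'. pnorm z \<le> R * m \<longrightarrow> pnorm z' \<le> R * m \<longrightarrow>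
    reach m K (plane z @ plane z') (plane (z + z'))" for R :: real
proof -
  \<comment> \<open>The exponent of \<open>a\<close> may have up to twice the norm of the pair, see
    \<open>snow_fst_le\<close>.\<close>
  obtain K where K: "\<And>m. min_size \<le> m \<Longrightarrow> mergeable m K (2 * R * real m)"
    using mergeable_ratio[of "2 * R"] by blast
  have "reach m (K + (K + 1) + (K + 1)) (plane z @ plane z') (plane (z + z'))"
    if m: "min_size \<le> m" and z: "pnorm z \<le> R * m" "pnorm z' \<le> R * m" for m z z'
  proof -
    let ?A = "line Gen_a" and ?X = "line Gen_x"
    have s: "snow (fst z) \<le> 2 * R * m" "snow (snd z) \<le> 2 * R * m"
        "snow (fst z') \<le> 2 * R * m" "snow (snd z') \<le> 2 * R * m"
      using z snow_fst_le[of z] snow_fst_le[of z'] snow_snd_le[of z] snow_snd_le[of z']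
        pnorm_nonneg[of z] pnorm_nonneg[of z'] by linarith+
    have "reach m K (plane z @ plane z')
        ((?A (fst z) @ ?A (fst z')) @ (?X (snd z) @ ?X (snd z')))"
      using reach_context[OF mergeable_comm[OF K[OF m] s(2,3), of Gen_x Gen_a], of "?A (fst z)" "?X (snd z')"]
      by (simp add: plane_def)
    also have "reach m ((K + 1) + (K + 1)) \<dots> (?A (fst z + fst z') @ ?X (snd z + snd z'))"
      using s by (intro reach_append mergeable_add2[OF m K[OF m]]) auto
    finally show ?thesis
      by (simp add: plane_def add.assoc)
  qed
  then show ?thesis by blast
qed

lemma line_plane_reach:
  "\<exists>K. \<forall>m\<ge>min_size. \<forall>g\<in>plane_gens. \<forall>k. snow k \<le> R * m \<longrightarrow> reach m K (line g k) (plane (vmul k g))" for R :: real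
proof -
  obtain K where K: "\<And>m. min_size \<le> m \<Longrightarrow> mergeable m K (R * real m)"
    using mergeable_ratio[of R] by blast
  have "reach m (3 * K + 8) (line g k) (plane (vmul k g))"
    if m: "min_size \<le> m" and g: "g \<in> plane_gens" and k: "snow k \<le> R * m" for m g k
  proof -
    let ?X = "line Gen_x" and ?Y = "line Gen_y"
    consider "g = Gen_a" | "g = Gen_x" | "g = Gen_y"
      using g by (auto simp: plane_gens_def)
    then show ?thesis
    proof cases
      case 1
      then show ?thesis
        using reach_left[OF line_0_reach[OF m, of Gen_x], of "apow k"]
        by (auto simp: plane_def intro: reach_mono)
    next
      case 2
      then show ?thesis
        by (simp add: plane_def reach_refl)
    next
      case 3
      have k': "snow (- k) \<le> R * m" using k by simp
      \<comment> \<open>One step of \<open>apow\<close> expands the power of \<open>a\<close> into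
        \<open>x^k y^k\<close>; its factor \<open>x^k\<close> then cancels against the trailing
        \<open>x^-k\<close>.\<close>
      have "reach m 1 (plane (vmul k Gen_y)) ((?X k @ ?Y k @ apow 0) @ ?X (- k))"
        using reach_context[OF apow_unfold[OF m, of "k * int L"], of "[]" "?X (- k)"]
        by (simp add: plane_def quo_mult_L rmd_mult_L)
      also have "reach m K \<dots> ((?Y k @ ?X k) @ ?X (- k))"
        using reach_context[OF mergeable_comm[OF K[OF m] k k, of Gen_x Gen_y], of "[]" "?X (- k)"] by simp
      also have "reach m (K + 1) \<dots> (?Y k @ ?X 0)"
        using reach_left[OF mergeable_add2[OF m K[OF m] k k', of Gen_x], of "?Y k"] by simp
      also have "reach m 1 \<dots> (?Y k)"
        using reach_left[OF reach_sym[OF line_0_reach[OF m, of Gen_x]], of "?Y k"] by simp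
      finally have "reach m (1 + K + (K + 1) + 1) (plane (vmul k Gen_y)) (?Y k)" .
      from reach_sym[OF this] show ?thesis
        unfolding 3 by (rule reach_mono) simp
    qed
  qed
  then show ?thesis by blast
qed

text \<open>At this scale a word and its normal form fit into one move. The factor
  \<open>lconst\<close> enters twice: a line of small norm is longer than its norm by
  \<open>lconst\<close>, and passing from such a word to its normal form costs \<open>lconst\<close>
  again.\<close>

definition unit_len :: "nat \<Rightarrow> real" where
  "unit_len m = m / (100 * lconst * lconst)"

lemma unit_len_nonneg: "0 \<le> unit_len m"
  by (simp add: unit_len_def)

lemma lconst_unit_len: "100 * (real lconst * (real lconst * unit_len m)) = m"
  using lconst_ge by (simp add: unit_len_def)

lemma lconst_mult_le: "0 \<le> x \<Longrightarrow> 12 * x \<le> real lconst * x"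
  using lconst_ge by (intro mult_right_mono) auto

lemma small_constants:
  assumes m: "min_size \<le> m"
  shows "L \<le> unit_len m" "200 * real lconst \<le> m" "12 * (real lconst * unit_len m) \<le> m / 100" "144 * unit_len m \<le> m / 100"
proof -
  have "real (100 * lconst * lconst * L) \<le> m" using m unfolding min_size_def by linarith
  then show "L \<le> unit_len m"
    using lconst_ge by (simp add: unit_len_def field_simps)
  have "100 * lconst * 2 \<le> 100 * lconst * L" using L2 by (intro mult_le_mono) auto
  then have "real (200 * lconst) \<le> m" using min_size_bound[OF m] by linarith
  then show "200 * real lconst \<le> m" by simp
  show "12 * (real lconst * unit_len m) \<le> m / 100"
    using lconst_mult_le[of "real lconst * unit_len m"] unit_len_nonneg[of m] lconst_unit_len[of m] by simp
  then show "144 * unit_len m \<le> m / 100"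
    using lconst_mult_le[of "unit_len m"] unit_len_nonneg[of m] by linarith
qed

text \<open>The bound leaves room for a line of norm \<open>2 * unit_len m\<close> between a prefix
  and a suffix of total length \<open>unit_len m\<close>, as needed in \<open>fills_Suc\<close> when
  the core has small value.\<close>

lemma reach_plane_small:
  assumes m: "min_size \<le> m" and u: "parses u z" and len: "length u \<le> unit_len m + 2 * real lconst * unit_len m + 2"
  shows "reach m 1 u (plane z)"
proof (rule reach_parses[OF u parses_plane])
  have "pnorm z \<le> unit_len m + 2 * real lconst * unit_len m + 2"
    using pnorm_le_length[OF u] len by linarith
  then have "3 * real lconst * pnorm z \<le> 3 * real lconst * (unit_len m + 2 * real lconst * unit_len m + 2)"
    by (intro mult_left_mono) auto
  then have "length u + real (length (plane z)) \<le> m"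
    using len length_plane[of z] small_constants[OF m] lconst_unit_len[of m] lconst_ge
    by (simp add: algebra_simps)
  then show "length u + length (plane z) \<le> m"
    by (simp only: of_nat_add[symmetric] of_nat_le_iff)
qed

lemma reach_plane_light:
  assumes m: "min_size \<le> m" and u: "parses u z" and len: "length u \<le> unit_len m"
  shows "reach m 1 u (plane z)"
  using len unit_len_nonneg[of m] by (intro reach_plane_small[OF m u]) (simp add: add_increasing2)

text \<open>For a positive letter the conjugate of \<open>apow\<close> is the line by definition;
  for a negative letter the line already contains the letters to cancel.\<close>

lemma conj_line_reach:
  assumes c: "stable c" and m: "2 \<le> m"
  shows "reach m 2 ([c] @ line (rgt c) k @ [linv c]) (line (lft c) k)"
proof -
  have pos: "reach m 2 ([d] @ apow k @ [linv d]) (line (lft d) k)" if "stable d" "snd d" for d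
    using that by (cases d) (auto simp: stable_def lft_def line_def linv_def intro: reach_refl)
  have neg: "reach m 2 ([linv d] @ ([d] @ apow k @ [linv d]) @ [d]) (apow k)" for d
  proof -
    have can: "reach m 1 (p @ [linv e, e] @ q) (p @ q)" for p q e
      using reach_context[OF reach_small[of "[linv e, e]" "[]"], of m p q]
        pres_eq_cancel_linv[of "GL_relations L" "[]" "linv e" "[]"] m by simp
    have "reach m 1 ([linv d] @ ([d] @ apow k @ [linv d]) @ [d]) (apow k @ [linv d] @ [d])"
      using can[of "[]" d "apow k @ [linv d] @ [d]"] by simp
    also have "reach m 1 \<dots> (apow k)"
      using can[of "apow k" d "[]"] by simp
    finally show ?thesis by (simp add: numeral_2_eq_2)
  qed
  show ?thesis
  proof (cases "snd c")
    case True
    then show ?thesis using pos[OF c] by (simp add: lft_def linv_def)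
  next
    case False
    have "line (rgt c) k = [linv c] @ apow k @ [c]"
      using c False by (cases c) (auto simp: stable_def lft_def line_def linv_def)
    then show ?thesis
      using neg[of "linv c"] False by (simp add: lft_def)
  qed
qed

section \<open>Words whose outermost pinches are short\<close>

definition block :: "real \<Rightarrow> GL_gen gword \<Rightarrow> int \<times> int \<Rightarrow> bool" where
  "block H b z \<longleftrightarrow> (\<exists>g e. g \<in> plane_gens \<and> b = [(g, e)] \<and> z = vmul (bsign e) g) \<or>
     (\<exists>c w k. stable c \<and> b = [c] @ w @ [linv c] \<and> parses w (vmul k (rgt c)) \<and> real (length w) \<le> H \<and> z = vmul k (lft c))"

text \<open>A parse in which \<open>H\<close> limits the interiors of the outermost pinches; deeper
  pinches are shorter still.\<close>

inductive light :: "real \<Rightarrow> GL_gen gword \<Rightarrow> int \<times> int \<Rightarrow> bool" for H where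
  Nil: "light H [] 0"
| snoc: "light H u z \<Longrightarrow> block H b z' \<Longrightarrow> light H (u @ b) (z + z')"

lemma block_parses: "block H b z \<Longrightarrow> parses b z"
  unfolding block_def using parses_letter parses_pinch by blast

lemma light_parses: "light H u z \<Longrightarrow> parses u z"
  by (induction rule: light.induct) (auto intro: parses.Nil parses_append block_parses)

lemma light_or_heavy:
  "parses u z \<Longrightarrow> light H u z \<or>
    (\<exists>u1 c w u2 z1 k z2. u = u1 @ [c] @ w @ [linv c] @ u2 \<and> parses u1 z1 \<and> parses u2 z2 \<and>
      parses w (vmul k (rgt c)) \<and> stable c \<and> H < real (length w))"
proof (induction rule: parses.induct)
  case (letter u z g b)
  from letter.IH show ?case
  proof (elim disjE exE conjE)
    assume "light H u z"
    moreover have "block H [(g, b)] (vmul (bsign b) g)"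
      using letter.hyps(2) by (auto simp: block_def)
    ultimately show ?thesis by (blast intro: light.snoc)
  next
    fix u1 c w u2 z1 k z2
    assume *: "u = u1 @ [c] @ w @ [linv c] @ u2" "parses u1 z1" "parses u2 z2"
      "parses w (vmul k (rgt c))" "stable c" "H < length w"
    show ?thesis
      using * parses.letter[OF *(3) letter.hyps(2), of b]
      by (intro disjI2 exI[of _ u1] exI[of _ c] exI[of _ w] exI[of _ "u2 @ [(g, b)]"] exI) auto
  qed
next
  case (pinch u z v k c)
  show ?case
  proof (cases "length v \<le> H")
    case False
    then show ?thesis
      using pinch.hyps
      by (intro disjI2 exI[of _ u] exI[of _ c] exI[of _ v] exI[of _ "[]"] exI[of _ z] exI[of _ k] exI[of _ 0])
        (auto intro: parses.Nil)
  next
    case True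
    from pinch.IH(1) show ?thesis
    proof (elim disjE exE conjE)
      assume "light H u z"
      moreover have "block H ([c] @ v @ [linv c]) (vmul k (lft c))"
        unfolding block_def using pinch.hyps True by blast
      ultimately show ?thesis by (blast intro: light.snoc)
    next
      fix u1 d w u2 z1 l z2
      assume *: "u = u1 @ [d] @ w @ [linv d] @ u2" "parses u1 z1" "parses u2 z2"
        "parses w (vmul l (rgt d))" "stable d" "H < length w"
      show ?thesis
        using * parses.pinch[OF *(3) pinch.hyps(2,3)]
        by (intro disjI2 exI[of _ u1] exI[of _ d] exI[of _ w] exI[of _ "u2 @ [c] @ v @ [linv c]"] exI) auto
    qed
  qed
qed (simp add: light.Nil)

text \<open>Blocks are peeled off from the right until they exceed \<open>T\<close>. The block that
  crosses the threshold may be long, but it is only one, and each cut consumes more than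
  \<open>T\<close>.\<close>

lemma light_decompose:
  fixes T :: real
  assumes "light H v z" "0 \<le> T"
  shows "length v \<le> T \<or> (\<exists>v1 b v2 z1 zb z2. v = v1 @ b @ v2 \<and> light H v1 z1 \<and> block H b zb \<and> parses v2 z2 \<and>
    length v2 \<le> T \<and> T < length b + length v2 \<and> z = z1 + zb + z2)"
  using assms
proof (induction arbitrary: T rule: light.induct)
  case (snoc u z b z')
  show ?case
  proof (cases "length b > T")
    case True
    then show ?thesis
      using snoc parses.Nil
      by (intro disjI2 exI[of _ u] exI[of _ b] exI[of _ "[]"] exI[of _ z] exI[of _ z'] exI[of _ 0]) auto
  next
    case False
    then have "0 \<le> T - length b" by simp
    from snoc.IH[OF this] show ?thesis
    proof (elim disjE exE conjE)
      assume "length u \<le> T - length b"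
      then show ?thesis by simp
    next
      fix v1 b1 v2 z1 zb z2
      assume *: "u = v1 @ b1 @ v2" "light H v1 z1" "block H b1 zb" "parses v2 z2"
        "length v2 \<le> T - length b" "T - length b < length b1 + length v2" "z = z1 + zb + z2"
      then show ?thesis
        using parses_append[OF block_parses[OF snoc.hyps(2)] *(4)]
        by (intro disjI2 exI[of _ v1] exI[of _ b1] exI[of _ "v2 @ b"] exI[of _ z1] exI[of _ zb]
            exI[of _ "z2 + z'"]) (auto simp: add.assoc)
    qed
  qed
qed simp

definition fills :: "nat \<Rightarrow> nat \<Rightarrow> real \<Rightarrow> bool" where
  "fills m K H \<longleftrightarrow> (\<forall>u z. parses u z \<longrightarrow> real (length u) \<le> H \<longrightarrow> reach m K u (plane z))"

text \<open>Fill the interior, rewrite its normal form as a line, let the stable letters conjugate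
  that line, and return to normal form.\<close>

lemma block_fill:
  "\<exists>K'. \<forall>m\<ge>min_size. \<forall>H b z. fills m K H \<longrightarrow> H \<le> R * m \<longrightarrow> block H b z \<longrightarrow> reach m K' b (plane z)" for R :: real
proof -
  obtain K1 where K1: "\<And>m g k. min_size \<le> m \<Longrightarrow> g \<in> plane_gens \<Longrightarrow> snow k \<le> R * m \<Longrightarrow>
      reach m K1 (line g k) (plane (vmul k g))"
    using line_plane_reach[of R] by blast
  define K' where "K' = K + K1 + 2 + K1 + 1"
  have "reach m K' b (plane z)"
    if m: "min_size \<le> m" and fill: "fills m K H" and H: "H \<le> R * m" and b: "block H b z" for m H b z
  proof -
    from b consider (letter) g e where "g \<in> plane_gens" "b = [(g, e)]" "z = vmul (bsign e) g"
      | (pinch) c w k where "stable c" "b = [c] @ w @ [linv c]" "parses w (vmul k (rgt c))"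
          "length w \<le> H" "z = vmul k (lft c)"
      unfolding block_def by blast
    then show ?thesis
    proof cases
      case letter
      have "reach m 1 b (plane z)"
        using unit_len_nonneg[of m] letter block_parses[OF b] by (intro reach_plane_small[OF m]) auto
      then show ?thesis by (rule reach_mono) (simp add: K'_def)
    next
      case pinch
      have k: "snow k \<le> R * m"
        using pnorm_le_length[OF pinch(3)] pinch(4) H by (simp add: pnorm_vmul)
      have "2 \<le> real m" using small_constants(2)[OF m] lconst_ge by linarith
      then have m2: "2 \<le> m" by simp
      have "reach m K w (plane (vmul k (rgt c)))"
        using fill pinch(3,4) unfolding fills_def by blast
      then have "reach m K b ([c] @ plane (vmul k (rgt c)) @ [linv c])"
        unfolding pinch(2) by (rule reach_context)
      also have "reach m K1 \<dots> ([c] @ line (rgt c) k @ [linv c])"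
        by (rule reach_context[OF reach_sym[OF K1[OF m lft_plane k]]])
      also have "reach m 2 \<dots> (line (lft c) k)"
        by (rule conj_line_reach[OF pinch(1) m2])
      also have "reach m K1 \<dots> (plane z)"
        using K1[OF m lft_plane k] pinch(5) by simp
      finally show ?thesis
        by (rule reach_mono) (simp add: K'_def)
    qed
  qed
  then show ?thesis by blast
qed

text \<open>Cutting off chunks of length about \<open>unit_len m / 2\<close> keeps the number of moves bounded.\<close>

lemma light_fill:
  "\<exists>K'. \<forall>m\<ge>min_size. \<forall>H v z. fills m K H \<longrightarrow> H \<le> R * m \<longrightarrow> light H v z \<longrightarrow> length v \<le> i * (unit_len m / 2) \<longrightarrow>
    reach m K' v (plane z)" for i :: nat and R :: real
proof (induction i)
  case 0
  have "reach m 1 v (plane z)" if "min_size \<le> m" "light H v z" "length v \<le> 0 * (unit_len m / 2)" for m H v z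
    using that unit_len_nonneg[of m] by (intro reach_plane_light light_parses[of H]) auto
  then show ?case by force
next
  case (Suc i)
  then obtain Ki where Ki: "\<And>m H v z. min_size \<le> m \<Longrightarrow> fills m K H \<Longrightarrow> H \<le> R * m \<Longrightarrow> light H v z \<Longrightarrow>
      length v \<le> i * (unit_len m / 2) \<Longrightarrow> reach m Ki v (plane z)"
    by blast
  obtain Kb where Kb: "\<And>m H b z. min_size \<le> m \<Longrightarrow> fills m K H \<Longrightarrow> H \<le> R * m \<Longrightarrow> block H b z \<Longrightarrow> reach m Kb b (plane z)"
    using block_fill[of K R] by blast
  obtain Ka where Ka: "\<And>m z z'. min_size \<le> m \<Longrightarrow> pnorm z \<le> real (Suc i) * m \<Longrightarrow> pnorm z' \<le> real (Suc i) * m \<Longrightarrow>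
      reach m Ka (plane z @ plane z') (plane (z + z'))"
    using plane_add_reach[of "Suc i"] by blast
  define K' where "K' = Ki + (Kb + 1) + Ka + Ka + 1"
  have "reach m K' v (plane z)"
    if m: "min_size \<le> m" and fill: "fills m K H" and H: "H \<le> R * m" and v: "light H v z"
      and len: "length v \<le> Suc i * (unit_len m / 2)" for m H v z
  proof -
    have "0 \<le> unit_len m / 2" using unit_len_nonneg by simp
    from light_decompose[OF v this] show ?thesis
    proof (elim disjE exE conjE)
      assume "length v \<le> unit_len m / 2"
      then have "reach m 1 v (plane z)"
        using unit_len_nonneg[of m] by (intro reach_plane_light m light_parses[OF v]) simp
      then show ?thesis by (rule reach_mono) (simp add: K'_def)
    next
      fix v1 b v2 z1 zb z2
      assume *: "v = v1 @ b @ v2" "light H v1 z1" "block H b zb" "parses v2 z2"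
        "length v2 \<le> unit_len m / 2" "unit_len m / 2 < length b + length v2" "z = z1 + zb + z2"
      have "unit_len m / 2 \<le> m"
        using small_constants(4)[OF m] unit_len_nonneg[of m] by simp
      then have "Suc i * (unit_len m / 2) \<le> real (Suc i) * m"
        by (intro mult_left_mono) auto
      moreover have "length v = length v1 + length b + length v2"
        using *(1) by simp
      ultimately have le: "length v1 + length b + length v2 \<le> real (Suc i) * m"
        using len by linarith
      have n: "pnorm z1 \<le> length v1" "pnorm zb \<le> length b" "pnorm z2 \<le> length v2"
        using pnorm_le_length[OF light_parses[OF *(2)]] pnorm_le_length[OF block_parses[OF *(3)]]
          pnorm_le_length[OF *(4)] by simp_all
      have "length v1 \<le> i * (unit_len m / 2)"
        using len *(1,6) by (simp add: field_simps)
      then have "reach m Ki v1 (plane z1)"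
        using Ki[OF m fill H *(2)] by blast
      moreover have "reach m Kb b (plane zb)"
        by (rule Kb[OF m fill H *(3)])
      moreover have "reach m 1 v2 (plane z2)"
        using *(5) unit_len_nonneg[of m] by (intro reach_plane_light m *(4)) simp
      ultimately have "reach m (Ki + (Kb + 1)) v (plane z1 @ plane zb @ plane z2)"
        unfolding *(1) by (intro reach_append)
      also have "reach m Ka \<dots> (plane (z1 + zb) @ plane z2)"
        using reach_context[OF Ka[OF m, of z1 zb], of "[]" "plane z2"] n le by simp
      also have "reach m Ka \<dots> (plane (z1 + zb + z2))"
        using n le pnorm_add[of z1 zb] by (intro Ka m) auto
      finally show ?thesis
        unfolding *(7) by (rule reach_mono) (simp add: K'_def)
    qed
  qed
  then show ?case by blast
qed

section \<open>Nests of long pinches and their core\<close>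

lemma line_pass_stable:
  assumes "stable c" "parses u z"
  shows "(u @ [c]) @ line (rgt c) q \<simeq> line (lft c) q @ (u @ [c])"
proof -
  have "[c] @ line (rgt c) q \<simeq> ([c] @ line (rgt c) q) @ [linv c, c]"
    using pres_eq.sym[OF pres_eq_cancel_linv[of "GL_relations L" "[c] @ line (rgt c) q" "linv c" "[]"]] by simp
  moreover have "([c] @ line (rgt c) q @ [linv c]) @ [c] \<simeq> line (lft c) q @ [c]"
    using assms(1) by (intro pres_eq_append_right parses_imp_eq[OF parses_pinch parses_line]) (auto intro: parses_line)
  ultimately have "[c] @ line (rgt c) q \<simeq> line (lft c) q @ [c]"
    using pres_eq.trans by fastforce
  then have "u @ [c] @ line (rgt c) q \<simeq> (u @ line (lft c) q) @ [c]"
    using pres_eq_append_left by fastforce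
  \<comment> \<open>Both words have values in the vertex group, which is abelian.\<close>
  moreover have "u @ line (lft c) q \<simeq> line (lft c) q @ u"
    using parses_append[OF parses_line[OF lft_plane] assms(2), of c q]
      parses_append[OF assms(2) parses_line[OF lft_plane], of c q]
    by (intro parses_imp_eq[of _ "z + vmul q (lft c)"]) (simp_all add: add.commute)
  ultimately show ?thesis
    using pres_eq.trans pres_eq_append_right by fastforce
qed

lemma parses_strip:
  assumes "parses (line l k @ w) z" "l \<in> plane_gens"
  shows "parses w (z - vmul k l)"
proof -
  have "parses (word_inv (line l k) @ line l k @ w) (- vmul k l + z)"
    by (intro parses_append parses_word_inv parses_line assms)
  then show ?thesis
    using parses_delete[of "[]" "word_inv (line l k)" w] by simp
qed

text \<open>Pinches with interior longer than \<open>H\<close> are opened until the core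
  \<open>v\<close> is light. On the way back, \<open>P\<close> carries the line of the core to a
  line of \<open>l\<close>. If the next pinch takes powers of \<open>l\<close>, the line is carried
  on through it; if it takes another direction, the value of the core is bounded by the lengths of
  \<open>P\<close> and \<open>Q\<close>, and this bound persists as they grow.\<close>

lemma heavy_core:
  assumes "parses u z"
  shows "\<exists>P v Q zv. u = P @ v @ Q \<and> light H v zv \<and>
    (P = [] \<and> Q = [] \<and> zv = z \<or>
     H < length v \<and> (\<exists>h k. h \<in> plane_gens \<and> zv = vmul k h \<and>
       (snow k \<le> 2 * (length P + length Q) \<or> (\<exists>l\<in>plane_gens. \<forall>q. P @ line h q \<simeq> line l q @ P))))"
  using assms
proof (induction "length u" arbitrary: u z rule: less_induct)
  case less
  from light_or_heavy[OF less.prems, of H] show ?case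
  proof (elim disjE exE conjE)
    assume "light H u z"
    then show ?thesis
      by (intro exI[of _ "[]"] exI[of _ u] exI[of _ z]) auto
  next
    fix u1 c w u2 z1 k z2
    assume *: "u = u1 @ [c] @ w @ [linv c] @ u2" "parses u1 z1" "parses u2 z2"
      "parses w (vmul k (rgt c))" "stable c" "H < length w"
    have "length w < length u" using *(1) by simp
    from less.hyps[OF this *(4)] obtain P v Q zv where IH: "w = P @ v @ Q" "light H v zv"
      "P = [] \<and> Q = [] \<and> zv = vmul k (rgt c) \<or>
       H < length v \<and> (\<exists>h k. h \<in> plane_gens \<and> zv = vmul k h \<and>
       (snow k \<le> 2 * (length P + length Q) \<or> (\<exists>l\<in>plane_gens. \<forall>q. P @ line h q \<simeq> line l q @ P)))"
      by blast
    define P' Q' where "P' = u1 @ [c] @ P" and "Q' = Q @ [linv c] @ u2"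
    have u: "u = P' @ v @ Q'" using *(1) IH(1) by (simp add: P'_def Q'_def)
    have "H < length v \<and> (\<exists>h k. h \<in> plane_gens \<and> zv = vmul k h \<and>
       (snow k \<le> 2 * (length P' + length Q') \<or> (\<exists>l\<in>plane_gens. \<forall>q. P' @ line h q \<simeq> line l q @ P')))"
      using IH(3)
    proof (elim disjE exE conjE bexE)
      assume triv: "P = []" "Q = []" "zv = vmul k (rgt c)"
      then have "\<forall>q. P' @ line (rgt c) q \<simeq> line (lft c) q @ P'"
        using line_pass_stable[OF *(5,2)] by (simp add: P'_def)
      then show ?thesis
        using triv *(6) IH(1) by (auto intro!: exI[of _ "rgt c"] exI[of _ k])
    next
      fix h k' assume "H < length v" "h \<in> plane_gens" "zv = vmul k' h" "snow k' \<le> 2 * (length P + length Q)"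
      then show ?thesis
        by (intro conjI exI[of _ h] exI[of _ k']) (auto simp: P'_def Q'_def)
    next
      fix h k' l assume a: "H < length v" "h \<in> plane_gens" "zv = vmul k' h" "l \<in> plane_gens"
        and pass: "\<forall>q. P @ line h q \<simeq> line l q @ P"
      show ?thesis
      proof (cases "l = rgt c")
        case True
        have "P' @ line h q \<simeq> line (lft c) q @ P'" for q
        proof -
          have "(u1 @ [c]) @ P @ line h q \<simeq> (u1 @ [c]) @ line l q @ P"
            by (rule pres_eq_append_left) (use pass in blast)
          moreover have "((u1 @ [c]) @ line l q) @ P \<simeq> (line (lft c) q @ (u1 @ [c])) @ P"
            using line_pass_stable[OF *(5,2)] True by (intro pres_eq_append_right) simp
          ultimately show ?thesis
            unfolding P'_def using pres_eq.trans by fastforce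
        qed
        then show ?thesis
          using a by (intro conjI exI[of _ h] exI[of _ k']) (auto intro: bexI[of _ "lft c"])
      next
        case False
        have "P @ v @ Q \<simeq> P @ line h k' @ Q"
          using light_parses[OF IH(2)] a(2,3) parses_line
          by (intro pres_eq_append_left pres_eq_append_right parses_imp_eq) auto
        moreover have "(P @ line h k') @ Q \<simeq> (line l k' @ P) @ Q"
          using pass by (intro pres_eq_append_right) blast
        ultimately have "w \<simeq> line l k' @ P @ Q"
          using IH(1) pres_eq.trans by fastforce
        then have "parses (line l k' @ P @ Q) (vmul k (rgt c))"
          using *(4) parses_cong by blast
        \<comment> \<open>With the line moved to the front, \<open>P @ Q\<close> alone accounts for
          the difference of two powers in different directions.\<close>
        then have "pnorm (vmul k (rgt c) - vmul k' l) \<le> length (P @ Q)"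
          using a(4) by (intro pnorm_le_length parses_strip)
        then have "snow k' \<le> 2 * (length P + length Q)"
          using snow_le_pnorm_diff[OF lft_plane a(4), of "linv c" k' k] False by simp
        then show ?thesis
          using a by (intro conjI exI[of _ h] exI[of _ k']) (auto simp: P'_def Q'_def)
      qed
    qed
    then show ?thesis using u IH(2) by blast
  qed
qed

section \<open>Sweeping a line across a thin strip\<close>

lemma reach_concat_replicate:
  "reach m K u u' \<Longrightarrow> reach m (n * K) (concat (replicate n u)) (concat (replicate n u'))"
proof (induction n)
  case (Suc n)
  then show ?case using reach_append[of m K u u' "n * K"] by simp
qed simp

text \<open>One list \<open>ks\<close> serves all plane generators, so that both sides of a strip
  are cut into matching pieces. Each halving of the norm multiplies the number of pieces by
  \<open>L\<close>, up to a remainder.\<close>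

lemma line_pieces:
  "\<exists>K D. \<forall>m\<ge>min_size. \<forall>k. snow k \<le> 2 ^ d * unit_len m \<longrightarrow> (\<exists>ks. length ks \<le> D \<and> (\<forall>i\<in>set ks. snow i \<le> unit_len m) \<and>
    (\<forall>g\<in>plane_gens. reach m K (line g k) (concat (map (line g) ks))))"
proof (induction d)
  case 0
  have "\<exists>ks. length ks \<le> 1 \<and> (\<forall>i\<in>set ks. snow i \<le> unit_len m) \<and>
    (\<forall>g\<in>plane_gens. reach m 0 (line g k) (concat (map (line g) ks)))" if "snow k \<le> 2 ^ 0 * unit_len m" for k m
    using that by (intro exI[of _ "[k]"]) auto
  then show ?case by blast
next
  case (Suc d)
  then obtain K D where KD: "\<And>m k. min_size \<le> m \<Longrightarrow> snow k \<le> 2 ^ d * unit_len m \<Longrightarrow> \<exists>ks. length ks \<le> D \<and>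
    (\<forall>i\<in>set ks. snow i \<le> unit_len m) \<and> (\<forall>g\<in>plane_gens. reach m K (line g k) (concat (map (line g) ks)))"
    by blast
  obtain Km where Km: "\<And>m. min_size \<le> m \<Longrightarrow> mergeable m Km (2 ^ Suc d * real m)"
    using mergeable_ratio[of "2 ^ Suc d"] by blast
  define K' where "K' = (L * (Km + 1) + (Km + 1) + 1) + L * K"
  have "\<exists>ks. length ks \<le> L * D + 1 \<and> (\<forall>i\<in>set ks. snow i \<le> unit_len m) \<and>
    (\<forall>g\<in>plane_gens. reach m K' (line g k) (concat (map (line g) ks)))"
    if m: "min_size \<le> m" and k: "snow k \<le> 2 ^ Suc d * unit_len m" for m k
  proof -
    have "snow (quo k) \<le> 2 ^ d * unit_len m"
      using snow_quo_le[of k] k by simp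
    from KD[OF m this] obtain ks where ks: "length ks \<le> D" "\<forall>i\<in>set ks. snow i \<le> unit_len m"
      "\<And>g. g \<in> plane_gens \<Longrightarrow> reach m K (line g (quo k)) (concat (map (line g) ks))"
      by blast
    define ks' where "ks' = concat (replicate L ks) @ [rmd k]"
    have "sum_list (replicate L (length ks)) \<le> L * D"
      using ks(1) by (simp add: sum_list_replicate)
    then have "length ks' \<le> L * D + 1"
      by (simp add: ks'_def length_concat)
    moreover have "\<forall>i\<in>set ks'. snow i \<le> unit_len m"
    proof -
      have "snow (rmd k) \<le> unit_len m"
        using snow_le_abs[of "rmd k"] abs_rmd_less[of k] small_constants(1)[OF m] by linarith
      then show ?thesis using ks(2) by (auto simp: ks'_def)
    qed
    moreover have "reach m K' (line g k) (concat (map (line g) ks'))" if g: "g \<in> plane_gens" for g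
    proof -
      have thle: "2 ^ Suc d * unit_len m \<le> 2 ^ Suc d * real m"
        using small_constants(4)[OF m] unit_len_nonneg[of m] by (intro mult_left_mono) auto
      have "reach m (L * (Km + 1) + (Km + 1) + 1) (line g k) (concat (replicate L (line g (quo k)) @ [line g (rmd k)]))"
      proof (rule line_split[OF m _ g])
        show "snow k \<le> 2 ^ Suc d * real m" using k thle by linarith
        show "reach m (Km + 1) (line g i @ line g j) (line g (i + j))"
          if "snow i \<le> 2 ^ Suc d * real m" "snow j \<le> 2 ^ Suc d * real m" for i j
          by (rule mergeable_add2[OF m Km[OF m] that g])
        have "12 * level 0 m \<le> real m / 8"
          using lconst_mult_le[of "level 0 m"] level_0[of m] by (simp add: level_def)
        then have "level 0 m \<le> 1 * real m" by simp
        also have "\<dots> \<le> 2 ^ Suc d * real m"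
          by (intro mult_right_mono one_le_power) auto
        finally show "snow r \<le> 2 ^ Suc d * real m" if "\<bar>r\<bar> \<le> 4 * int L" for r
          using snow_small_le_level[OF m that, of 0] by linarith
      qed
      also have "reach m (L * K) (concat (replicate L (line g (quo k)) @ [line g (rmd k)]))
          (concat (replicate L (concat (map (line g) ks))) @ line g (rmd k))"
        using reach_context[OF reach_concat_replicate[OF ks(3)[OF g], of L], of "[]" "line g (rmd k)"] by simp
      also have "concat (replicate L (concat (map (line g) ks))) @ line g (rmd k) = concat (map (line g) ks')"
      proof -
        have "concat (replicate n (concat (map (line g) ks))) = concat (map (line g) (concat (replicate n ks)))" for n
          by (induction n) auto
        then show ?thesis by (simp add: ks'_def)
      qed
      finally show ?thesis by (simp add: K'_def)
    qed
    ultimately show ?thesis by blast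
  qed
  then show ?case by blast
qed

text \<open>The prefix and the pieces are short, so each rectangle of the strip is a single
  move.\<close>

lemma pass_pieces:
  assumes m: "min_size \<le> m" and ks: "\<forall>i\<in>set ks. snow i \<le> unit_len m" and P: "length P \<le> unit_len m"
    and pass: "\<And>q. P @ line h q \<simeq> line l q @ P"
  shows "reach m (length ks) (P @ concat (map (line h) ks)) (concat (map (line l) ks) @ P)"
  using ks
proof (induction ks)
  case (Cons i ks)
  have "lconst * snow i \<le> lconst * unit_len m"
    using Cons.prems by (intro mult_left_mono) auto
  then have "length (line g i) \<le> lconst * unit_len m + 2" for g
    using length_line[of g i] by linarith
  from this[of h] this[of l]
  have "real (length (P @ line h i) + length (line l i @ P)) \<le> m"
    using P small_constants[OF m] lconst_ge by simp
  then have "length (P @ line h i) + length (line l i @ P) \<le> m"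
    by (simp only: of_nat_le_iff)
  then have "reach m 1 (P @ line h i) (line l i @ P)"
    using reach_small[OF pass[of i]] by blast
  from reach_context[OF this, of "[]" "concat (map (line h) ks)"]
  have "reach m 1 (P @ concat (map (line h) (i # ks))) (line l i @ P @ concat (map (line h) ks))"
    by simp
  also have "reach m (length ks) \<dots> (line l i @ concat (map (line l) ks) @ P)"
    using Cons by (intro reach_left) auto
  finally show ?case by simp
qed simp

text \<open>The word is short apart from a heavy core \<open>v\<close>. If the value of \<open>v\<close> is large, the short prefix
  carries it to a parallel line, and the strip in between is cut into boundedly many short rectangles.\<close>

lemma fills_Suc:
  fixes j :: nat
  assumes IH: "\<forall>m\<ge>min_size. fills m K (j * unit_len m)"
  shows "\<exists>K'. \<forall>m\<ge>min_size. fills m K' (Suc j * unit_len m)"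
proof -
  let ?R = "real (Suc j)"
  obtain Kl where Kl: "\<And>m H v z. min_size \<le> m \<Longrightarrow> fills m K H \<Longrightarrow> H \<le> ?R * m \<Longrightarrow> light H v z \<Longrightarrow>
      length v \<le> (2 * Suc j) * (unit_len m / 2) \<Longrightarrow> reach m Kl v (plane z)"
    using light_fill[of K ?R "2 * Suc j"] by blast
  obtain K1 where K1: "\<And>m g k. min_size \<le> m \<Longrightarrow> g \<in> plane_gens \<Longrightarrow> snow k \<le> ?R * m \<Longrightarrow>
      reach m K1 (line g k) (plane (vmul k g))"
    using line_plane_reach[of ?R] by blast
  obtain Ka where Ka: "\<And>m z z'. min_size \<le> m \<Longrightarrow> pnorm z \<le> ?R * m \<Longrightarrow> pnorm z' \<le> ?R * m \<Longrightarrow>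
      reach m Ka (plane z @ plane z') (plane (z + z'))"
    using plane_add_reach[of ?R] by blast
  have "?R \<le> 2 ^ j"
    using Suc_le_eq less_exp[of j] by (metis of_nat_le_iff of_nat_numeral of_nat_power)
  obtain Kp D where KD: "\<And>m k. min_size \<le> m \<Longrightarrow> snow k \<le> 2 ^ j * unit_len m \<Longrightarrow> \<exists>ks. length ks \<le> D \<and>
    (\<forall>i\<in>set ks. snow i \<le> unit_len m) \<and> (\<forall>g\<in>plane_gens. reach m Kp (line g k) (concat (map (line g) ks)))"
    using line_pieces[of j] by blast
  define K' where "K' = Kl + K1 + Kp + D + Kp + (K1 + 1) + Ka"
  have "reach m K' u (plane z)"
    if m: "min_size \<le> m" and u: "parses u z" and len: "length u \<le> Suc j * unit_len m" for m u z
  proof -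
    have th1: "unit_len m \<le> m" using small_constants(4)[OF m] unit_len_nonneg[of m] by simp
    have Rm: "?R * unit_len m \<le> ?R * m" using th1 by (intro mult_left_mono) auto
    have jth: "j * unit_len m \<le> ?R * m"
      using Rm unit_len_nonneg[of m] by (simp add: algebra_simps)
    have fill: "fills m K (j * unit_len m)" using IH m by blast
    obtain P v Q zv where c: "u = P @ v @ Q" "light (j * unit_len m) v zv"
      "P = [] \<and> Q = [] \<and> zv = z \<or>
       j * unit_len m < length v \<and> (\<exists>h k. h \<in> plane_gens \<and> zv = vmul k h \<and>
       (snow k \<le> 2 * (length P + length Q) \<or> (\<exists>l\<in>plane_gens. \<forall>q. P @ line h q \<simeq> line l q @ P)))"
      using heavy_core[OF u, of "j * unit_len m"] by blast
    \<comment> \<open>The pinches of \<open>v\<close> have interiors of length at most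
      \<open>j * unit_len m\<close>; the induction hypothesis fills them, and
      \<open>light_fill\<close> puts \<open>v\<close> together.\<close>
    have v: "reach m Kl v (plane zv)"
      using len c(1) by (intro Kl[OF m fill jth c(2)]) (auto simp: algebra_simps)
    show ?thesis
    proof (cases "P = [] \<and> Q = [] \<and> zv = z")
      case True
      then show ?thesis using v c(1) by (auto simp: K'_def intro: reach_mono)
    next
      case False
      then obtain h k where h: "j * unit_len m < length v" "h \<in> plane_gens" "zv = vmul k h"
        and alt: "snow k \<le> 2 * (length P + length Q) \<or> (\<exists>l\<in>plane_gens. \<forall>q. P @ line h q \<simeq> line l q @ P)"
        using c(3) by blast
      \<comment> \<open>A core longer than \<open>j * unit_len m\<close> leaves at most one unit of
        length for the rest.\<close>
      have PQ: "length P + length Q \<le> unit_len m"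
        using len h(1) c(1) by (simp add: algebra_simps)
      have k: "snow k \<le> ?R * unit_len m"
        using pnorm_le_length[OF light_parses[OF c(2)]] len c(1) h by (simp add: pnorm_vmul)
      then have kR: "snow k \<le> ?R * m" using Rm by linarith
      have "reach m Kl u (P @ plane (vmul k h) @ Q)"
        using reach_context[OF v] c(1) h(3) by simp
      also have "reach m K1 \<dots> (P @ line h k @ Q)"
        by (rule reach_context[OF reach_sym[OF K1[OF m h(2) kR]]])
      finally have start: "reach m (Kl + K1) u (P @ line h k @ Q)" .
      then have par: "parses (P @ line h k @ Q) z"
        using u parses_cong reach_imp_eq by blast
      from alt show ?thesis
      proof (elim disjE bexE)
        assume small: "snow k \<le> 2 * (length P + length Q)"
        have "lconst * snow k \<le> lconst * (2 * unit_len m)"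
          using small PQ by (intro mult_left_mono) auto
        then have "real (length (P @ line h k @ Q)) \<le> unit_len m + 2 * real lconst * unit_len m + 2"
          using PQ length_line[of h k] by simp
        from reach_trans[OF start reach_plane_small[OF m par this]] show ?thesis
          by (rule reach_mono) (simp add: K'_def)
      next
        fix l assume l: "l \<in> plane_gens" and pass: "\<forall>q. P @ line h q \<simeq> line l q @ P"
        have "?R * unit_len m \<le> 2 ^ j * unit_len m"
          using \<open>?R \<le> 2 ^ j\<close> unit_len_nonneg by (intro mult_right_mono)
        then have "snow k \<le> 2 ^ j * unit_len m" using k by linarith
        from KD[OF m this] obtain ks where ks: "length ks \<le> D" "\<forall>i\<in>set ks. snow i \<le> unit_len m"
          "\<And>g. g \<in> plane_gens \<Longrightarrow> reach m Kp (line g k) (concat (map (line g) ks))"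
          by blast
        have "P @ line h k @ Q \<simeq> line l k @ P @ Q"
          using pres_eq_append_right[of "GL_relations L" "P @ line h k" "line l k @ P" Q] pass by simp
        then have "parses (line l k @ P @ Q) z"
          using par parses_cong by blast
        then have rest: "parses (P @ Q) (z - vmul k l)"
          using l by (rule parses_strip)
        note start
        also have "reach m Kp (P @ line h k @ Q) (P @ concat (map (line h) ks) @ Q)"
          by (rule reach_context[OF ks(3)[OF h(2)]])
        also have "reach m D \<dots> (concat (map (line l) ks) @ P @ Q)"
        proof -
          have "reach m (length ks) (P @ concat (map (line h) ks)) (concat (map (line l) ks) @ P)"
            using PQ pass by (intro pass_pieces[OF m ks(2)]) auto
          from reach_context[OF this, of "[]" Q] show ?thesis
            using ks(1) by (auto intro: reach_mono)
        qed
        also have "reach m Kp \<dots> (line l k @ P @ Q)"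
          using reach_context[OF reach_sym[OF ks(3)[OF l]], of "[]" "P @ Q"] by simp
        also have "reach m (K1 + 1) \<dots> (plane (vmul k l) @ plane (z - vmul k l))"
          using PQ by (intro reach_append K1[OF m l kR] reach_plane_light[OF m rest]) simp
        also have "reach m Ka \<dots> (plane (vmul k l + (z - vmul k l)))"
        proof (intro Ka m)
          show "pnorm (vmul k l) \<le> ?R * m" using kR l by (simp add: pnorm_vmul)
          have "1 * unit_len m \<le> ?R * unit_len m" using unit_len_nonneg by (intro mult_right_mono) auto
          then show "pnorm (z - vmul k l) \<le> ?R * m"
            using pnorm_le_length[OF rest] PQ Rm unfolding length_append of_nat_add by linarith
        qed
        finally show ?thesis
          by (simp add: K'_def)
      qed
    qed
  qed
  then show ?thesis unfolding fills_def by blast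
qed

lemma fills_all: "\<exists>K. \<forall>m\<ge>min_size. fills m K (j * unit_len m)" for j :: nat
proof (induction j)
  case 0
  have "fills m 1 (real 0 * unit_len m)" if "min_size \<le> m" for m
    using that unit_len_nonneg[of m] unfolding fills_def by (auto intro!: reach_plane_light[unfolded One_nat_def])
  then show ?case by blast
next
  case (Suc j)
  then show ?case using fills_Suc by blast
qed

text \<open>Inside \<open>u @ word_inv v @ v\<close> both the first two factors and the last two
  form a trivial word, and contracting either of them leads to \<open>v\<close> or to
  \<open>u\<close>.\<close>

theorem bounded_moves: "\<exists>K. \<forall>m\<ge>min_size. \<forall>u v. u \<simeq> v \<longrightarrow> length u + length v \<le> N * m \<longrightarrow> reach m K u v" for N :: nat
proof -
  \<comment> \<open>Chosen such that \<open>j * unit_len m\<close> equals \<open>2 * N * m\<close>;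
    the 2 is for \<open>word_inv v @ v\<close>, which contains \<open>v\<close> twice.\<close>
  define j where "j = 2 * N * (100 * lconst * lconst)"
  obtain K where K: "\<And>m. min_size \<le> m \<Longrightarrow> fills m K (j * unit_len m)"
    using fills_all[of j] by blast
  have "reach m (K + 1 + (K + 1)) u v"
    if m: "min_size \<le> m" and uv: "u \<simeq> v" and len: "length u + length v \<le> N * m" for m u v
  proof -
    have jth: "j * unit_len m = 2 * N * m"
      using lconst_ge by (simp add: j_def unit_len_def)
    have fill: "reach m (K + 1) w []" if "parses w 0" "length w \<le> 2 * N * m" for w
    proof -
      have "real (length w) \<le> j * unit_len m"
        using that(2) unfolding jth by (metis of_nat_le_iff of_nat_mult of_nat_numeral)
      then have "reach m K w (plane 0)"
        using K[OF m] that(1) unfolding fills_def by blast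
      moreover have "reach m 1 (plane 0) []"
        using reach_sym[OF reach_plane_light[OF m parses.Nil]] unit_len_nonneg[of m] by simp
      ultimately show ?thesis by (rule reach_trans)
    qed
    have "parses (word_inv v @ v) 0"
      using parses_cong[OF pres_eq_word_inv[of "GL_relations L" v]] parses.Nil by blast
    then have "reach m (K + 1) (u @ word_inv v @ v) (u @ [])"
      using len by (intro reach_left fill) auto
    from reach_sym[OF this] have "reach m (K + 1) u (u @ word_inv v @ v)" by simp
    also have "reach m (K + 1) (u @ word_inv v @ v) v"
    proof -
      have "u @ word_inv v \<simeq> []"
        using pres_eq.trans[OF pres_eq_append_right[OF uv] pres_eq_word_inv_right] .
      then have "parses (u @ word_inv v) 0"
        using parses_cong parses.Nil by blast
      from reach_context[OF fill[OF this], of "[]" v] len show ?thesis by simp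
    qed
    finally show ?thesis .
  qed
  then show ?thesis by blast
qed

end

section \<open>Loops joined by chains of nearby loops\<close>

text \<open>Number of the interval of \<open>t\<close> when the unit interval is cut into
  \<open>k\<close> equal ones; the cap \<open>k - 1\<close> assigns \<open>t = 1\<close> to the last
  of them.\<close>

definition slot :: "nat \<Rightarrow> real \<Rightarrow> nat" where
  "slot k t = min (nat \<lfloor>t * k\<rfloor>) (k - 1)"

lemma slot:
  assumes "0 < k" "t \<in> {0..1}"
  shows "slot k t < k" "real (slot k t) \<le> t * k" "t * k \<le> real (slot k t) + 1"
proof -
  have tk: "0 \<le> t * k" "t * k \<le> k"
    using assms by (auto simp: mult_le_cancel_right1)
  show "slot k t < k" using assms(1) by (simp add: slot_def)
  show "real (slot k t) \<le> t * k"
    using of_nat_floor[OF tk(1)] by (simp add: slot_def min_def)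
  show "t * k \<le> real (slot k t) + 1"
    using tk assms(1) by (simp add: slot_def min_def of_nat_diff)
qed

context Metric_space
begin

text \<open>The explicit rate does not depend on the sequence; it makes the limit of chains of loops
  uniform.\<close>

lemma geometric_limit:
  assumes "mcomplete" and x: "\<And>i. x i \<in> M" and step: "\<And>i. d (x i) (x (Suc i)) \<le> A / 2 ^ i"
  shows "\<exists>l\<in>M. \<forall>i. d (x i) l \<le> 2 * A / 2 ^ i"
proof -
  have A: "0 \<le> A" using order_trans[OF nonneg step[of 0]] by simp
  have bound: "d (x i) (x (i + k)) \<le> 2 * A / 2 ^ i - 2 * A / 2 ^ (i + k)" for i k
  proof (induction k)
    case 0
    then show ?case using x by simp
  next
    case (Suc k)
    have "d (x i) (x (i + Suc k)) \<le> d (x i) (x (i + k)) + d (x (i + k)) (x (Suc (i + k)))"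
      using x by (simp add: triangle)
    also have "\<dots> \<le> 2 * A / 2 ^ i - 2 * A / 2 ^ (i + k) + A / 2 ^ (i + k)"
      using Suc step[of "i + k"] by linarith
    also have "\<dots> = 2 * A / 2 ^ i - 2 * A / 2 ^ (i + Suc k)"
      by (simp add: field_simps)
    finally show ?case .
  qed
  have bound': "d (x i) (x j) \<le> 2 * A / 2 ^ i" if "i \<le> j" for i j
  proof -
    have "0 \<le> 2 * A / 2 ^ j" using A by simp
    then show ?thesis using bound[of i "j - i"] that by simp
  qed
  have null: "(\<lambda>i. 2 * A / 2 ^ i) \<longlonglongrightarrow> 0"
    using LIMSEQ_divide_realpow_zero[of 2 "2 * A"] by simp
  have "MCauchy x"
    unfolding MCauchy_def
  proof (intro conjI allI impI)
    show "range x \<subseteq> M" using x by auto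
    fix e :: real assume "0 < e"
    then obtain N where N: "2 * A / 2 ^ i < e / 2" if "N \<le> i" for i
      using order_tendstoD(2)[OF null, of "e / 2"] by (auto simp: eventually_sequentially)
    have "d (x n) (x n') < e" if "N \<le> n" "N \<le> n'" for n n'
    proof -
      have "d (x n) (x n') \<le> d (x N) (x n) + d (x N) (x n')"
        using triangle[OF x[of n] x[of N] x[of n']] commute[of "x n" "x N"] by simp
      then show ?thesis
        using bound'[OF that(1)] bound'[OF that(2)] N[of N] by simp
    qed
    then show "\<exists>N. \<forall>n n'. N \<le> n \<longrightarrow> N \<le> n' \<longrightarrow> d (x n) (x n') < e" by blast
  qed
  then obtain l where l: "limitin mtopology x l sequentially"
    using assms(1) by (auto simp: mcomplete_def)
  have lM: "l \<in> M" using l limitin_mspace by blast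
  have "d (x i) l \<le> 2 * A / 2 ^ i" for i
  proof (rule field_le_epsilon)
    fix e :: real assume "0 < e"
    then obtain N where "\<And>n. N \<le> n \<Longrightarrow> d (x n) l < e"
      using l unfolding limitin_metric eventually_sequentially by blast
    then have "d (x (max N i)) l < e" by simp
    moreover have "d (x i) (x (max N i)) \<le> 2 * A / 2 ^ i"
      by (rule bound') simp
    ultimately show "d (x i) l \<le> 2 * A / 2 ^ i + e"
      using triangle[OF x[of i] x[of "max N i"] lM] by linarith
  qed
  then show ?thesis using lM by blast
qed

section \<open>Chains of loops and their refinement\<close>

definition loops :: "'a \<Rightarrow> (real \<Rightarrow> 'a) set" where
  "loops c = {p. continuous_map (top_of_set {0..1}) mtopology p \<and> p 0 = c \<and> p 1 = c}"

lemma loops_in: "p \<in> loops c \<Longrightarrow> t \<in> {0..1} \<Longrightarrow> p t \<in> M"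
  by (force simp: loops_def continuous_map_def)

text \<open>A chain is an infinite sequence that becomes constant, so chains of different lengths
  have one type. The constant \<open>C\<close> is the same for all \<open>e\<close>: under repeated
  halving of \<open>e\<close> the displacements then form a geometric series.\<close>

definition refinable :: "'a \<Rightarrow> real \<Rightarrow> bool" where
  "refinable c C \<longleftrightarrow> (\<forall>e>0. \<forall>p\<in>loops c. \<forall>q\<in>loops c. (\<forall>t\<in>{0..1}. d (p t) (q t) \<le> e) \<longrightarrow>
     (\<exists>K R. R 0 = p \<and> (\<forall>j\<ge>K. R j = q) \<and> (\<forall>j. R j \<in> loops c) \<and>
       (\<forall>j. \<forall>t\<in>{0..1}. d (R j t) (R (Suc j) t) \<le> e / 2 \<and> d (p t) (R j t) \<le> C * e)))"

definition chain :: "'a \<Rightarrow> (real \<Rightarrow> 'a) \<Rightarrow> (real \<Rightarrow> 'a) \<Rightarrow> real \<Rightarrow> nat \<Rightarrow> (nat \<Rightarrow> real \<Rightarrow> 'a) \<Rightarrow> bool" where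
  "chain c p q e n Q \<longleftrightarrow> 0 < n \<and> Q 0 = p \<and> (\<forall>j\<ge>n. Q j = q) \<and> (\<forall>j. Q j \<in> loops c) \<and>
     (\<forall>j. \<forall>t\<in>{0..1}. d (Q j t) (Q (Suc j) t) \<le> e)"

text \<open>All steps are refined into the same number \<open>K\<close> of substeps, the shorter
  refinements waiting at their end. Hence index \<open>m\<close> of the new chain lies over
  \<open>m div K\<close> of the old one, and both chains can be read as functions of one real
  parameter.\<close>

lemma chain_refine:
  assumes ref: "refinable c C" and C: "0 \<le> C" and e: "0 < e" and ch: "chain c p q e n Q"
  shows "\<exists>K Q'. 0 < K \<and> chain c p q (e / 2) (n * K) Q' \<and>
    (\<forall>m. \<forall>t\<in>{0..1}. d (Q (m div K) t) (Q' m t) \<le> C * e)"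
proof -
  have Q: "0 < n" "Q 0 = p" "\<And>j. n \<le> j \<Longrightarrow> Q j = q" "\<And>j. Q j \<in> loops c"
    "\<And>j t. t \<in> {0..1} \<Longrightarrow> d (Q j t) (Q (Suc j) t) \<le> e"
    using ch by (auto simp: chain_def)
  have "\<forall>j. \<exists>K R. R 0 = Q j \<and> (\<forall>i\<ge>K. R i = Q (Suc j)) \<and> (\<forall>i. R i \<in> loops c) \<and>
       (\<forall>i. \<forall>t\<in>{0..1}. d (R i t) (R (Suc i) t) \<le> e / 2 \<and> d (Q j t) (R i t) \<le> C * e)"
    using ref e Q(4,5) unfolding refinable_def by blast
  then obtain K R where R: "\<And>j. R j 0 = Q j" "\<And>j i. K j \<le> i \<Longrightarrow> R j i = Q (Suc j)"
      "\<And>j i. R j i \<in> loops c" "\<And>j i t. t \<in> {0..1} \<Longrightarrow> d (R j i t) (R j (Suc i) t) \<le> e / 2"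
      "\<And>j i t. t \<in> {0..1} \<Longrightarrow> d (Q j t) (R j i t) \<le> C * e"
    by metis
  define k where "k = Suc (Max (K ` {..<n}))"
  have k: "K j \<le> k" if "j < n" for j
    using that by (auto simp: k_def intro!: le_SucI Max_ge)
  define Q' where "Q' m = (if m div k < n then R (m div k) (m mod k) else q)" for m
  have k0: "0 < k" by (simp add: k_def)
  have zero: "d (u t) (u t) = 0" if "u \<in> loops c" "t \<in> {0..1}" for u t
    using loops_in[OF that] by simp
  have ql: "q \<in> loops c" using Q(3,4)[of n] by simp
  have "chain c p q (e / 2) (n * k) Q'"
    unfolding chain_def
  proof (intro conjI allI impI ballI)
    show "0 < n * k" using Q(1) k0 by simp
    show "Q' 0 = p" using Q(1,2) R(1) by (simp add: Q'_def)
    show "Q' j = q" if "n * k \<le> j" for j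
    proof -
      have "n \<le> j div k" using that k0 by (simp add: less_eq_div_iff_mult_less_eq)
      then show ?thesis by (simp add: Q'_def)
    qed
    show "Q' j \<in> loops c" for j using ql R(3) by (simp add: Q'_def)
    show "d (Q' m t) (Q' (Suc m) t) \<le> e / 2" if t: "t \<in> {0..1}" for m t
    proof (cases "m div k < n")
      case False
      then have "\<not> Suc m div k < n" using div_le_mono[of m "Suc m" k] by linarith
      then show ?thesis using False zero[OF ql t] e by (simp add: Q'_def)
    next
      case True
      show ?thesis
      proof (cases "Suc (m mod k) = k")
        case False
        then have "Suc m div k = m div k" "Suc m mod k = Suc (m mod k)"
          by (simp_all add: div_Suc mod_Suc)
        then show ?thesis using True R(4)[OF t] by (simp add: Q'_def)
      next
        case eq: True
        then have S: "Suc m div k = Suc (m div k)" "Suc m mod k = 0"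
          by (simp_all add: div_Suc mod_Suc)
        \<comment> \<open>The last substep of a block arrives at the loop where the next block
          starts, because \<open>K j \<le> k\<close>.\<close>
        have "R (m div k) (Suc (m mod k)) = Q (Suc (m div k))"
          using R(2)[of "m div k" k] k[OF True] eq by simp
        moreover have "Q' (Suc m) = Q (Suc (m div k))"
          using S Q(3)[of "Suc (m div k)"] R(1) by (auto simp: Q'_def)
        ultimately show ?thesis
          using True R(4)[OF t, of "m div k" "m mod k"] by (simp add: Q'_def)
      qed
    qed
  qed
  moreover have "d (Q (m div k) t) (Q' m t) \<le> C * e" if "t \<in> {0..1}" for m t
    using R(5)[OF that] Q(3)[of "m div k"] zero[OF ql that] C e by (simp add: Q'_def)
  ultimately show ?thesis using k0 by blast
qed

text \<open>The loop space with the supremum metric is complete, so refining a chain geometrically often gives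
  a path of loops.\<close>

theorem refinable_imp_null_homotopic:
  assumes complete: "mcomplete" and ref: "refinable c C" and C: "0 \<le> C"
    and p: "p \<in> loops c" and q: "q \<in> loops c"
  shows "homotopic_with (\<lambda>r. r 0 = c \<and> r 1 = c) (top_of_set {0..1}) mtopology p q"
proof -
  have "\<exists>E. \<forall>t\<in>{0..1}. d (p t) (q t) \<le> E"
  proof -
    have "compactin (top_of_set {0..1}) {0..1 :: real}"
      by (simp add: compactin_subtopology)
    then have "mbounded (p ` {0..1})" "mbounded (q ` {0..1})"
      using p q by (auto simp: loops_def intro!: compactin_imp_mbounded image_compactin)
    then have "mbounded (p ` {0..1} \<union> q ` {0..1})" by (simp add: mbounded_Un)
    then obtain B where "\<forall>x\<in>p ` {0..1} \<union> q ` {0..1}. \<forall>y\<in>p ` {0..1} \<union> q ` {0..1}. d x y \<le> B"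
      unfolding mbounded_alt by blast
    then show ?thesis by blast
  qed
  then obtain E0 where E0: "\<forall>t\<in>{0..1}. d (p t) (q t) \<le> E0" by blast
  \<comment> \<open>The maximum with 1 keeps the initial step positive even if the loops
    coincide.\<close>
  define E where "E = max E0 1"
  have E: "0 < E" "\<And>t. t \<in> {0..1} \<Longrightarrow> d (p t) (q t) \<le> E"
    using E0 by (auto simp: E_def le_max_iff_disj)
  define P where "P i s = chain c p q (E / 2 ^ i) (fst s) (snd s)" for i :: nat and s :: "nat \<times> (nat \<Rightarrow> real \<Rightarrow> 'a)"
  define r where "r i s s' \<longleftrightarrow> (\<exists>K>0. fst s' = fst s * K \<and>
      (\<forall>m. \<forall>t\<in>{0..1}. d (snd s (m div K) t) (snd s' m t) \<le> C * (E / 2 ^ i)))"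
    for i :: nat and s s' :: "nat \<times> (nat \<Rightarrow> real \<Rightarrow> 'a)"
  have "P 0 (1, \<lambda>j. if j = 0 then p else q)"
    using E p q loops_in by (auto simp: P_def chain_def)
  moreover have "\<exists>s'. P (Suc i) s' \<and> r i s s'" if ch: "P i s" for i s
  proof -
    have pos: "0 < E / 2 ^ i" using E(1) by simp
    obtain K Q' where "0 < K" "chain c p q (E / 2 ^ i / 2) (fst s * K) Q'"
        "\<forall>m. \<forall>t\<in>{0..1}. d (snd s (m div K) t) (Q' m t) \<le> C * (E / 2 ^ i)"
      using chain_refine[OF ref C pos ch[unfolded P_def]] by blast
    then show ?thesis
      by (intro exI[of _ "(fst s * K, Q')"]) (auto simp: P_def r_def mult.commute)
  qed
  ultimately obtain f where f: "\<And>i. P i (f i)" "\<And>i. r i (f i) (f (Suc i))"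
    using dependent_nat_choice[of P r] by blast
  define n Q where "n i = fst (f i)" and "Q i = snd (f i)" for i
  have Q: "0 < n i" "Q i 0 = p" "n i \<le> j \<Longrightarrow> Q i j = q" "Q i j \<in> loops c" for i j
    using f(1)[of i] by (auto simp: P_def chain_def n_def Q_def)
  have Qstep: "d (Q i j t) (Q i (Suc j) t) \<le> E / 2 ^ i" if "t \<in> {0..1}" for i j t
    using f(1)[of i] that by (auto simp: P_def chain_def n_def Q_def)
  \<comment> \<open>A step function of \<open>s\<close>: the chain of stage \<open>i\<close> spread
    evenly over the time interval. At \<open>s = 1\<close> the index is \<open>n i\<close>, where
    the chain has become \<open>q\<close>.\<close>
  define H where "H i s t = Q i (nat \<lfloor>s * n i\<rfloor>) t" for i and s t :: real
  have HM: "H i s t \<in> M" if "t \<in> {0..1}" for i s t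
    using loops_in[OF Q(4) that] by (simp add: H_def)
  have Hstep: "d (H i s t) (H (Suc i) s t) \<le> (C * E) / 2 ^ i" if s: "0 \<le> s" and t: "t \<in> {0..1}" for i s t
  proof -
    obtain K where K: "0 < K" "n (Suc i) = n i * K"
        "\<And>m. d (Q i (m div K) t) (Q (Suc i) m t) \<le> C * (E / 2 ^ i)"
      using f(2)[of i] t by (auto simp: r_def n_def Q_def)
    \<comment> \<open>The index at stage \<open>Suc i\<close> lies over the index at stage
      \<open>i\<close>, as \<open>n (Suc i) = n i * K\<close>.\<close>
    have "\<lfloor>s * n i\<rfloor> = \<lfloor>s * n (Suc i) / real_of_int (int K)\<rfloor>"
      using K(1,2) by simp
    also have "\<dots> = \<lfloor>s * n (Suc i)\<rfloor> div int K"
      by (rule floor_divide_real_eq_div) simp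
    finally have "nat \<lfloor>s * n i\<rfloor> = nat \<lfloor>s * n (Suc i)\<rfloor> div K"
      using s by (simp add: nat_div_distrib)
    then show ?thesis
      using K(3)[of "nat \<lfloor>s * n (Suc i)\<rfloor>"] by (simp add: H_def)
  qed
  define h where "h z = (SOME l. l \<in> M \<and> (\<forall>i. d (H i (fst z) (snd z)) l \<le> 2 * (C * E) / 2 ^ i))" for z
  have "h z \<in> M \<and> (\<forall>i. d (H i (fst z) (snd z)) (h z) \<le> 2 * (C * E) / 2 ^ i)"
    if "z \<in> {0..1} \<times> {0..1}" for z
    unfolding h_def
  proof (rule someI_ex)
    show "\<exists>l. l \<in> M \<and> (\<forall>i. d (H i (fst z) (snd z)) l \<le> 2 * (C * E) / 2 ^ i)"
      using geometric_limit[OF complete, of "\<lambda>i. H i (fst z) (snd z)" "C * E"] HM Hstep that by auto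
  qed
  then have h: "h (s, t) \<in> M" "d (H i s t) (h (s, t)) \<le> 2 * (C * E) / 2 ^ i"
    if "s \<in> {0..1}" "t \<in> {0..1}" for s t i
    using that by fastforce+
  have null: "(\<lambda>i. (4 * (C * E) + E) / 2 ^ i) \<longlonglongrightarrow> 0"
    using LIMSEQ_divide_realpow_zero[of 2 "4 * (C * E) + E"] by simp
  have cont: "continuous_map (prod_topology (top_of_set {0..1}) (top_of_set {0..1})) mtopology h"
    unfolding continuous_map_to_metric
  proof (intro ballI allI impI)
    fix z :: "real \<times> real" and \<epsilon> :: real
    assume z: "z \<in> topspace (prod_topology (top_of_set {0..1}) (top_of_set {0..1}))" and \<epsilon>: "0 < \<epsilon>"
    obtain s t where st: "z = (s, t)" "s \<in> {0..1}" "t \<in> {0..1}" using z by auto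
    \<comment> \<open>Two distances to the limit, each at most \<open>2 * (C * E) / 2 ^ i\<close>,
      and one step of the chain; the other half of \<epsilon> is left for the continuity of a single
      loop.\<close>
    obtain i where i: "(4 * (C * E) + E) / 2 ^ i < \<epsilon> / 2"
      using order_tendstoD(2)[OF null, of "\<epsilon> / 2"] \<epsilon> by (auto simp: eventually_sequentially)
    define j where "j = nat \<lfloor>s * n i\<rfloor>"
    have "continuous_map (top_of_set {0..1}) mtopology (Q i j)"
      using Q(4) by (simp add: loops_def)
    then obtain W where W: "openin (top_of_set {0..1}) W" "t \<in> W" "\<And>t'. t' \<in> W \<Longrightarrow> Q i j t' \<in> mball (Q i j t) (\<epsilon> / 2)"
      unfolding continuous_map_to_metric using st(3) \<epsilon> by (metis half_gt_zero topspace_euclidean_subtopology)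
    \<comment> \<open>Times closer than \<open>1 / n i\<close> have indices that differ by at most
      one.\<close>
    define V where "V = {0..1} \<inter> {s - 1 / n i <..< s + 1 / n i}"
    have V: "openin (top_of_set {0..1}) V" "s \<in> V"
      using st(2) Q(1)[of i] by (auto simp: V_def openin_open_Int)
    have W01: "W \<subseteq> {0..1}" using openin_imp_subset[OF W(1)] .
    have close: "h (s', t') \<in> mball (h (s, t)) \<epsilon>" if s': "s' \<in> V" and t': "t' \<in> W" for s' t'
    proof -
      have s'1: "s' \<in> {0..1}" "\<bar>s' - s\<bar> < 1 / n i" using s' by (auto simp: V_def)
      have t'1: "t' \<in> {0..1}" using t' W01 by auto
      define j' where "j' = nat \<lfloor>s' * n i\<rfloor>"
      have "\<bar>s' * n i - s * n i\<bar> = \<bar>s' - s\<bar> * n i"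
        by (simp add: abs_mult flip: left_diff_distrib)
      also have "\<dots> < 1" using s'1(2) Q(1)[of i] by (simp add: field_simps)
      finally have "j' = j \<or> j' = Suc j \<or> j = Suc j'"
        unfolding j_def j'_def using s'1(1) st(2) by (simp add: nat_eq_iff) linarith
      then have "d (Q i j t') (Q i j' t') \<le> E / 2 ^ i"
        using Qstep[OF t'1, of i j] Qstep[OF t'1, of i j'] loops_in[OF Q(4) t'1, of i j] E(1)
          commute[of "Q i j t'" "Q i j' t'"] by auto
      moreover have "d (Q i j t) (Q i j t') < \<epsilon> / 2"
        using W(3)[OF t'] by simp
      moreover have "d (Q i j t) (h (s, t)) \<le> 2 * (C * E / 2 ^ i)" "d (Q i j' t') (h (s', t')) \<le> 2 * (C * E / 2 ^ i)"
        using h(2)[OF st(2,3), of i] h(2)[OF s'1(1) t'1, of i] by (simp_all add: H_def j_def j'_def)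
      moreover have "d (h (s, t)) (h (s', t')) \<le>
          d (Q i j t) (h (s, t)) + d (Q i j t) (Q i j t') + d (Q i j t') (Q i j' t') + d (Q i j' t') (h (s', t'))"
      proof -
        have m: "h (s, t) \<in> M" "h (s', t') \<in> M" "Q i j t \<in> M" "Q i j t' \<in> M" "Q i j' t' \<in> M"
          using h(1) st s'1 t'1 loops_in[OF Q(4)] by auto
        show ?thesis
          using triangle[OF m(1,3,2)] triangle[OF m(3,4,2)] triangle[OF m(4,5,2)] commute[of "Q i j t" "h (s, t)"]
          by linarith
      qed
      ultimately have "d (h (s, t)) (h (s', t')) < \<epsilon>"
        using i unfolding add_divide_distrib times_divide_eq_right[symmetric] by linarith
      then show ?thesis using h(1) st s'1 t'1 by simp
    qed
    show "\<exists>U. openin (prod_topology (top_of_set {0..1}) (top_of_set {0..1})) U \<and> z \<in> U \<and> (\<forall>y\<in>U. h y \<in> mball (h z) \<epsilon>)"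
      using V W close st(1) by (intro exI[of _ "V \<times> W"]) (auto simp: openin_Times)
  qed
  have eq: "h (s, t) = l"
    if st: "s \<in> {0..1}" "t \<in> {0..1}" and l: "\<And>i. H i s t = l" for s t l
  proof -
    have lM: "l \<in> M" using HM[OF st(2)] l by metis
    have "d l (h (s, t)) \<le> 0"
    proof (rule LIMSEQ_le_const)
      show "(\<lambda>i. 2 * (C * E) / 2 ^ i) \<longlonglongrightarrow> 0"
        using LIMSEQ_divide_realpow_zero[of 2 "2 * (C * E)"] by simp
      show "\<exists>N. \<forall>i\<ge>N. d l (h (s, t)) \<le> 2 * (C * E) / 2 ^ i"
        using h(2)[OF st] l by auto
    qed
    then show ?thesis
      using h(1)[OF st] lM nonneg[of l "h (s, t)"] zero[of l "h (s, t)"] by simp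
  qed
  show ?thesis
  proof (subst homotopic_with)
    show "(u 0 = c \<and> u 1 = c) = (v 0 = c \<and> v 1 = c)"
      if "\<And>x. x \<in> topspace (top_of_set {0..1}) \<Longrightarrow> u x = v x" for u v :: "real \<Rightarrow> 'a"
      using that[of 0] that[of 1] by simp
    have "h (0, t) = p t" if "t \<in> {0..1}" for t
      using that Q(2) by (intro eq) (auto simp: H_def)
    moreover have "h (1, t) = q t" if "t \<in> {0..1}" for t
      using that Q(3) by (intro eq) (auto simp: H_def)
    moreover have "h (s, 0) = c" "h (s, 1) = c" if "s \<in> {0..1}" for s
      using that Q(4) by (auto intro!: eq simp: H_def loops_def)
    ultimately show "\<exists>h. continuous_map (prod_topology (top_of_set {0..1 :: real}) (top_of_set {0..1})) mtopology h \<and>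
        (\<forall>x\<in>topspace (top_of_set {0..1}). h (0, x) = p x) \<and> (\<forall>x\<in>topspace (top_of_set {0..1}). h (1, x) = q x) \<and>
        (\<forall>t\<in>{0..1}. h (t, 0) = c \<and> h (t, 1) = c)"
      using cont by (intro exI[of _ h]) auto
  qed
qed

lemma loops_modulus:
  assumes p: "p \<in> loops c" and e: "0 < e"
  shows "\<exists>\<delta>>0. \<forall>s\<in>{0..1}. \<forall>t\<in>{0..1}. \<bar>s - t\<bar> < \<delta> \<longrightarrow> d (p s) (p t) < e"
proof -
  let ?m1 = "submetric (euclidean_metric :: real metric) {0..1}" and ?m2 = "metric (M, d)"
  have "continuous_map (mtopology_of ?m1) (mtopology_of ?m2) p"
    using p by (simp add: loops_def mtopology_of_submetric)
  moreover have "compact_space (mtopology_of ?m1)"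
    by (simp add: mtopology_of_submetric compact_space_subtopology)
  ultimately have "uniformly_continuous_map ?m1 ?m2 p"
    using continuous_eq_uniformly_continuous_map by blast
  then obtain \<delta> where "\<delta> > 0" "\<forall>x\<in>{0..1}. \<forall>y\<in>{0..1}. dist y x < \<delta> \<longrightarrow> d (p y) (p x) < e"
    using e unfolding uniformly_continuous_map_def by auto
  then show ?thesis
    by (intro exI[of _ \<delta>]) (auto simp: dist_real_def)
qed

section \<open>Concatenation of Lipschitz paths\<close>

definition cat :: "nat \<Rightarrow> (nat \<Rightarrow> real \<Rightarrow> 'a) \<Rightarrow> real \<Rightarrow> 'a" where
  "cat k \<rho> t = \<rho> (slot k t) (t * k - slot k t)"

text \<open>Times closer than \<open>1 / k\<close> lie in the same piece or in adjacent ones, and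
  the Lipschitz estimates add up across a junction. So \<open>cat\<close> has Lipschitz constant
  \<open>A * k\<close> at small distances.\<close>

lemma cat_continuous:
  assumes k: "0 < k"
    and \<rho>M: "\<And>i t. i < k \<Longrightarrow> t \<in> {0..1} \<Longrightarrow> \<rho> i t \<in> M"
    and lip: "\<And>i s t. i < k \<Longrightarrow> s \<in> {0..1} \<Longrightarrow> t \<in> {0..1} \<Longrightarrow> d (\<rho> i s) (\<rho> i t) \<le> A * \<bar>s - t\<bar>"
    and match: "\<And>i. Suc i < k \<Longrightarrow> \<rho> i 1 = \<rho> (Suc i) 0"
  shows "continuous_map (top_of_set {0..1}) mtopology (cat k \<rho>)"
proof -
  have A: "0 \<le> A" using order_trans[OF nonneg lip[of 0 0 1]] k by simp
  have local: "t * k - slot k t \<in> {0..1}" if "t \<in> {0..1}" for t :: real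
    using slot[OF k that] by simp
  have inM: "cat k \<rho> t \<in> M" if "t \<in> {0..1}" for t
    using \<rho>M[OF slot(1)[OF k that] local[OF that]] by (simp add: cat_def)
  have mono: "d (cat k \<rho> s) (cat k \<rho> t) \<le> A * k * (t - s)"
    if s: "s \<in> {0..1}" and t: "t \<in> {0..1}" and st: "s \<le> t" "t - s < 1 / k" for s t
  proof -
    define i j where "i = slot k s" and "j = slot k t"
    have ij: "i < k" "j < k" using slot(1)[OF k] s t by (auto simp: i_def j_def)
    have sk: "s * k \<le> t * k" "t * k - s * k < 1"
      using st k by (auto simp: field_simps intro: mult_right_mono)
    have "i \<le> j"
      unfolding i_def j_def slot_def using sk by (intro min.mono nat_mono floor_mono) auto
    moreover have "\<lfloor>t * k\<rfloor> \<le> \<lfloor>s * k\<rfloor> + 1" using sk by linarith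
    then have "j \<le> Suc i"
      unfolding i_def j_def slot_def using s by (auto simp: min_def nat_le_iff)
    ultimately consider "j = i" | "j = Suc i" by linarith
    then show ?thesis
    proof cases
      case 1
      then show ?thesis
        using lip[OF ij(1) local[OF s] local[OF t, folded j_def, unfolded 1 i_def]] sk
        by (simp add: cat_def i_def j_def algebra_simps)
    next
      case 2
      have l: "d (\<rho> i (s * k - i)) (\<rho> i 1) \<le> A * (1 - (s * k - i))"
          "d (\<rho> j 0) (\<rho> j (t * k - j)) \<le> A * (t * k - j)"
        using lip[OF ij(1) local[OF s, folded i_def], of 1] lip[OF ij(2) _ local[OF t, folded j_def], of 0]
          local[OF s] local[OF t] by (auto simp: i_def j_def)
      have "d (cat k \<rho> s) (cat k \<rho> t) \<le> d (\<rho> i (s * k - i)) (\<rho> i 1) + d (\<rho> j 0) (\<rho> j (t * k - j))"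
        using triangle[OF inM[OF s] \<rho>M[OF ij(1), of 1] inM[OF t]] match[of i] 2 ij
        by (simp add: cat_def i_def j_def)
      also have "\<dots> \<le> A * (1 - (s * k - i)) + A * (t * k - j)" using l by linarith
      also have "\<dots> = A * k * (t - s)" using 2 by (simp add: algebra_simps)
      finally show ?thesis .
    qed
  qed
  have near: "d (cat k \<rho> s) (cat k \<rho> t) \<le> A * k * \<bar>t - s\<bar>"
    if "s \<in> {0..1}" "t \<in> {0..1}" "\<bar>t - s\<bar> < 1 / k" for s t
  proof (cases "s \<le> t")
    case True
    then show ?thesis using mono[of s t] that by simp
  next
    case False
    then show ?thesis
      using mono[of t s] that commute[of "cat k \<rho> s" "cat k \<rho> t"] by (simp add: abs_minus_commute)
  qed
  show ?thesis
    unfolding continuous_map_to_metric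
  proof (intro ballI allI impI)
    fix s \<epsilon> :: real assume s: "s \<in> topspace (top_of_set {0..1})" and \<epsilon>: "0 < \<epsilon>"
    define \<delta> where "\<delta> = min (1 / k) (\<epsilon> / (A * k + 1))"
    have \<delta>: "0 < \<delta>" using \<epsilon> k A by (auto simp: \<delta>_def intro!: divide_pos_pos add_nonneg_pos)
    have "cat k \<rho> t \<in> mball (cat k \<rho> s) \<epsilon>" if t: "t \<in> {0..1} \<inter> {s - \<delta> <..< s + \<delta>}" for t
    proof -
      have ts: "\<bar>t - s\<bar> < \<delta>" using t by auto
      have "A * k * \<bar>t - s\<bar> \<le> (A * k + 1) * \<bar>t - s\<bar>" by (simp add: algebra_simps)
      also have "\<dots> < (A * k + 1) * (\<epsilon> / (A * k + 1))"
        using ts A by (intro mult_strict_left_mono) (auto simp: \<delta>_def add_nonneg_pos)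
      also have "\<dots> = \<epsilon>" using A by (simp add: add_nonneg_eq_0_iff)
      finally have "d (cat k \<rho> s) (cat k \<rho> t) < \<epsilon>"
        using near[of s t] s t ts by (auto simp: \<delta>_def)
      then show ?thesis using inM s t by simp
    qed
    then show "\<exists>U. openin (top_of_set {0..1}) U \<and> s \<in> U \<and> (\<forall>y\<in>U. cat k \<rho> y \<in> mball (cat k \<rho> s) \<epsilon>)"
      using \<delta> s by (intro exI[of _ "{0..1} \<inter> {s - \<delta> <..< s + \<delta>}"]) (auto simp: openin_open_Int)
  qed
qed

lemma cat_0: "0 < k \<Longrightarrow> cat k \<rho> 0 = \<rho> 0 0"
  by (simp add: cat_def slot_def)

lemma cat_1: "0 < k \<Longrightarrow> cat k \<rho> 1 = \<rho> (k - 1) 1"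
  by (simp add: cat_def slot_def of_nat_diff)

lemma lipschitz_continuous:
  assumes "\<And>t. t \<in> {0..1} \<Longrightarrow> \<rho> t \<in> M"
    and "\<And>s t. s \<in> {0..1} \<Longrightarrow> t \<in> {0..1} \<Longrightarrow> d (\<rho> s) (\<rho> t) \<le> A * \<bar>s - t\<bar>"
  shows "continuous_map (top_of_set {0..1}) mtopology \<rho>"
proof (rule continuous_map_eq)
  show "continuous_map (top_of_set {0..1}) mtopology (cat 1 (\<lambda>_. \<rho>))"
    using assms by (intro cat_continuous[where A = A]) auto
qed (simp add: cat_def slot_def)

end

section \<open>Asymptotic cones by representatives\<close>

locale cone_setting = Metric_space X d for X and d :: "'a \<Rightarrow> 'a \<Rightarrow> real" +
  fixes \<omega> :: "nat filter" and \<sigma> :: "nat \<Rightarrow> real" and obs :: "nat \<Rightarrow> 'a"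
  assumes ultrafilter: "nonprincipal_ultrafilter \<omega>"
    and scale_pos: "\<And>n. 0 < \<sigma> n" and scale_top: "filterlim \<sigma> at_top sequentially"
    and obs: "\<And>n. obs n \<in> X"
begin

abbreviation Q where "Q \<equiv> cone_seqs X d \<omega> obs \<sigma>"
abbreviation Y where "Y \<equiv> cone_points X d \<omega> obs \<sigma>"
abbreviation dY where "dY \<equiv> cone_dist d \<omega> \<sigma>"
abbreviation D where "D \<equiv> ultra_dist d \<omega> \<sigma>"

sublocale Y: Metric_space Y dY
  by (rule Metric_space_cone[OF Metric_space_axioms ultrafilter scale_pos obs])

lemma not_bot: "\<omega> \<noteq> bot"
  using ultrafilter by (simp add: nonprincipal_ultrafilter_def)

lemma not_eventually_iff: "\<not> eventually P \<omega> \<longleftrightarrow> eventually (\<lambda>n. \<not> P n) \<omega>"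
proof
  show "\<not> eventually P \<omega> \<Longrightarrow> eventually (\<lambda>n. \<not> P n) \<omega>"
    using ultrafilter unfolding nonprincipal_ultrafilter_def by blast
  show "eventually (\<lambda>n. \<not> P n) \<omega> \<Longrightarrow> \<not> eventually P \<omega>"
    using not_bot eventually_conj[of P \<omega> "\<lambda>n. \<not> P n"] by (auto simp: trivial_limit_def)
qed

lemma eventually_neq: "eventually (\<lambda>n. n \<noteq> k) \<omega>"
proof (rule ccontr)
  assume "\<not> eventually (\<lambda>n. n \<noteq> k) \<omega>"
  then have ev: "eventually (\<lambda>n. n = k) \<omega>" by (simp add: not_eventually_iff)
  have "\<omega> = principal {k}"
  proof (rule filter_eqI)
    fix P
    have "eventually P \<omega>" if "P k" using ev by eventually_elim (use that in simp)
    moreover have "P k" if "eventually P \<omega>"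
    proof (rule ccontr)
      assume "\<not> P k"
      have "eventually (\<lambda>n. False) \<omega>"
        using ev that by eventually_elim (use \<open>\<not> P k\<close> in auto)
      then show False using not_bot by (simp add: trivial_limit_def)
    qed
    ultimately show "eventually P \<omega> \<longleftrightarrow> eventually P (principal {k})"
      by (auto simp: eventually_principal)
  qed
  then show False using ultrafilter by (auto simp: nonprincipal_ultrafilter_def)
qed

text \<open>A non-principal ultrafilter contains the complement of each point, hence of each finite
  set.\<close>

lemma eventually_ultra: "eventually P sequentially \<Longrightarrow> eventually P \<omega>"
proof -
  assume "eventually P sequentially"
  then obtain N where N: "\<And>n. N \<le> n \<Longrightarrow> P n" by (auto simp: eventually_sequentially)
  have "eventually (\<lambda>n. \<forall>k\<in>{..<N}. n \<noteq> k) \<omega>"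
    by (intro eventually_ball_finite) (auto intro: eventually_neq)
  then show "eventually P \<omega>"
  proof eventually_elim
    case (elim n)
    then have "N \<le> n" using not_le_imp_less[of N n] by auto
    then show ?case by (rule N)
  qed
qed

lemma eventually_scale_ge: "eventually (\<lambda>n. B \<le> \<sigma> n) \<omega>"
  using scale_top by (intro eventually_ultra) (simp add: filterlim_at_top)

lemma D_tendsto: "((\<lambda>n. ennreal (d (x n) (y n) / \<sigma> n)) \<longlongrightarrow> D x y) \<omega>"
  unfolding ultra_dist_def by (rule ultrafilter_tendsto_ennreal[OF ultrafilter])

lemma D_le:
  assumes "eventually (\<lambda>n. d (x n) (y n) \<le> r * \<sigma> n) \<omega>"
  shows "D x y \<le> ennreal r"
proof (rule tendsto_upperbound[OF D_tendsto _ not_bot])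
  show "\<forall>\<^sub>F n in \<omega>. ennreal (d (x n) (y n) / \<sigma> n) \<le> ennreal r"
    using assms
  proof eventually_elim
    case (elim n)
    then have "d (x n) (y n) / \<sigma> n \<le> r"
      using scale_pos[of n] by (simp add: pos_divide_le_eq)
    then show ?case by (rule ennreal_leI)
  qed
qed

lemma D_less:
  assumes "D x y < ennreal r" "0 \<le> r"
  shows "eventually (\<lambda>n. d (x n) (y n) < r * \<sigma> n) \<omega>"
  using order_tendstoD(2)[OF D_tendsto assms(1)]
proof eventually_elim
  case (elim n)
  have "0 \<le> d (x n) (y n) / \<sigma> n" using scale_pos[of n] by simp
  then have "d (x n) (y n) / \<sigma> n < r"
    using elim assms(2) by (simp add: ennreal_less_iff)
  then show ?case using scale_pos[of n] by (simp add: pos_divide_less_eq)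
qed

lemma Q_in: "x \<in> Q \<Longrightarrow> x n \<in> X"
  by (simp add: cone_seqs_def)

lemma Q_iff: "x \<in> Q \<longleftrightarrow> (\<forall>n. x n \<in> X) \<and> (\<exists>r. eventually (\<lambda>n. d (x n) (obs n) \<le> r * \<sigma> n) \<omega>)"
proof (intro iffI conjI)
  assume x: "x \<in> Q"
  then have "D x obs < \<infinity>" by (simp add: cone_seqs_def)
  then obtain r where "0 \<le> r" "D x obs = ennreal r"
    by (cases "D x obs") auto
  then have "D x obs < ennreal (r + 1)" by (simp add: ennreal_less_iff)
  then have "eventually (\<lambda>n. d (x n) (obs n) < (r + 1) * \<sigma> n) \<omega>"
    using \<open>0 \<le> r\<close> by (intro D_less) auto
  then have "eventually (\<lambda>n. d (x n) (obs n) \<le> (r + 1) * \<sigma> n) \<omega>"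
    by eventually_elim simp
  then show "\<exists>r. eventually (\<lambda>n. d (x n) (obs n) \<le> r * \<sigma> n) \<omega>" by blast
next
  assume "(\<forall>n. x n \<in> X) \<and> (\<exists>r. eventually (\<lambda>n. d (x n) (obs n) \<le> r * \<sigma> n) \<omega>)"
  then obtain r where "\<forall>n. x n \<in> X" "eventually (\<lambda>n. d (x n) (obs n) \<le> r * \<sigma> n) \<omega>" by blast
  then show "x \<in> Q"
    using D_le[of x obs r] by (auto simp: cone_seqs_def intro: le_less_trans)
qed (simp add: cone_seqs_def)

lemma obs_Q: "obs \<in> Q"
  using obs scale_pos by (auto simp: Q_iff intro!: exI[of _ 0])

lemma Q_near:
  assumes x: "x \<in> Q" and y: "\<And>n. y n \<in> X" and near: "eventually (\<lambda>n. d (x n) (y n) \<le> r * \<sigma> n) \<omega>"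
  shows "y \<in> Q"
proof -
  obtain r' where "eventually (\<lambda>n. d (x n) (obs n) \<le> r' * \<sigma> n) \<omega>"
    using x by (auto simp: Q_iff)
  with near have "eventually (\<lambda>n. d (y n) (obs n) \<le> (r + r') * \<sigma> n) \<omega>"
  proof eventually_elim
    case (elim n)
    then show ?case
      using triangle[OF y[of n] Q_in[OF x, of n] obs[of n]] commute[of "x n" "y n"]
      by (simp add: algebra_simps)
  qed
  then show ?thesis using y by (auto simp: Q_iff)
qed

lemma D_finite:
  assumes "x \<in> Q" "y \<in> Q"
  shows "D x y < \<infinity>"
proof -
  obtain r where r: "eventually (\<lambda>n. d (x n) (obs n) \<le> r * \<sigma> n) \<omega>" using assms by (auto simp: Q_iff)
  obtain r' where r': "eventually (\<lambda>n. d (y n) (obs n) \<le> r' * \<sigma> n) \<omega>" using assms by (auto simp: Q_iff)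
  from r r' have "eventually (\<lambda>n. d (x n) (y n) \<le> (r + r') * \<sigma> n) \<omega>"
  proof eventually_elim
    case (elim n)
    then show ?case
      using triangle[OF Q_in[OF assms(1), of n] obs[of n] Q_in[OF assms(2), of n]] commute[of "y n" "obs n"]
      by (simp add: algebra_simps)
  qed
  then show ?thesis
    using le_less_trans[OF D_le, of x y "r + r'" \<infinity>] by simp
qed

text \<open>Real-valued, since the limit is finite on \<open>Q\<close>; the cone is then handled by
  inequalities between representatives.\<close>

definition rdist :: "(nat \<Rightarrow> 'a) \<Rightarrow> (nat \<Rightarrow> 'a) \<Rightarrow> real" where
  "rdist x y = enn2real (D x y)"

lemma rdist_le:
  assumes "eventually (\<lambda>n. d (x n) (y n) \<le> r * \<sigma> n) \<omega>" "0 \<le> r"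
  shows "rdist x y \<le> r"
  using enn2real_mono[OF D_le[OF assms(1)]] assms(2) by (simp add: rdist_def)

lemma rdist_less:
  assumes "x \<in> Q" "y \<in> Q" "rdist x y < r"
  shows "eventually (\<lambda>n. d (x n) (y n) < r * \<sigma> n) \<omega>"
proof (rule D_less)
  have fin: "D x y < \<infinity>" using D_finite[OF assms(1,2)] by simp
  show "0 \<le> r" using assms(3) order_trans[OF enn2real_nonneg[of "D x y"]] by (simp add: rdist_def)
  have "ennreal (enn2real (D x y)) < ennreal r"
    using assms(3) by (simp add: rdist_def ennreal_less_iff)
  then show "D x y < ennreal r"
    using fin by (simp add: ennreal_enn2real)
qed

lemma rdist_nonneg: "0 \<le> rdist x y"
  by (simp add: rdist_def)

lemma rdist_commute: "rdist x y = rdist y x"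
  by (simp add: rdist_def ultra_dist_def commute)

lemma rdist_triangle:
  assumes "x \<in> Q" "y \<in> Q" "z \<in> Q"
  shows "rdist x z \<le> rdist x y + rdist y z"
proof (rule field_le_epsilon)
  fix e :: real assume e: "0 < e"
  have "eventually (\<lambda>n. d (x n) (y n) < (rdist x y + e / 2) * \<sigma> n) \<omega>"
    "eventually (\<lambda>n. d (y n) (z n) < (rdist y z + e / 2) * \<sigma> n) \<omega>"
    using assms e by (auto intro!: rdist_less)
  then have "eventually (\<lambda>n. d (x n) (z n) \<le> (rdist x y + rdist y z + e) * \<sigma> n) \<omega>"
  proof eventually_elim
    case (elim n)
    then show ?case
      using triangle[OF Q_in[OF assms(1), of n] Q_in[OF assms(2), of n] Q_in[OF assms(3), of n]]
      by (simp add: algebra_simps)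
  qed
  then show "rdist x z \<le> rdist x y + rdist y z + e"
    using rdist_nonneg[of x y] rdist_nonneg[of y z] e by (intro rdist_le) auto
qed

lemma rdist_refl: "x \<in> Q \<Longrightarrow> rdist x x = 0"
  using rdist_le[of x x 0] rdist_nonneg[of x x] Q_in[of x] by simp

definition cls :: "(nat \<Rightarrow> 'a) \<Rightarrow> (nat \<Rightarrow> 'a) set" where
  "cls x = {y \<in> Q. rdist x y = 0}"

lemma D_eq_0_iff: "x \<in> Q \<Longrightarrow> y \<in> Q \<Longrightarrow> D x y = 0 \<longleftrightarrow> rdist x y = 0"
  using D_finite[of x y] by (auto simp: rdist_def enn2real_eq_0_iff)

lemma cone_points_eq: "Y = cls ` Q"
  unfolding cone_points_def quotient_def cls_def
  by (auto simp: D_eq_0_iff)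

lemma cls_in [simp]: "x \<in> Q \<Longrightarrow> cls x \<in> Y"
  by (simp add: cone_points_eq)

text \<open>\<open>cone_dist\<close> evaluates at chosen representatives; the triangle inequality
  removes the choice.\<close>

lemma dist_cls:
  assumes "x \<in> Q" "y \<in> Q"
  shows "dY (cls x) (cls y) = rdist x y"
proof -
  have rep: "(SOME z. z \<in> cls x) \<in> cls x" if "x \<in> Q" for x
  proof -
    have "x \<in> cls x" using that rdist_refl[OF that] by (simp add: cls_def)
    then show ?thesis by (rule someI[of "\<lambda>z. z \<in> cls x"])
  qed
  define x' y' where "x' = (SOME z. z \<in> cls x)" and "y' = (SOME z. z \<in> cls y)"
  have *: "x' \<in> Q" "rdist x x' = 0" "y' \<in> Q" "rdist y y' = 0"
    using rep[OF assms(1)] rep[OF assms(2)] by (auto simp: x'_def y'_def cls_def)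
  have "rdist x' y' \<le> rdist x' x + (rdist x y + rdist y y')" "rdist x y \<le> rdist x x' + (rdist x' y' + rdist y' y)"
    using rdist_triangle[OF *(1) assms(1) *(3)] rdist_triangle[OF assms *(3)]
      rdist_triangle[OF assms(1) *(1) assms(2)] rdist_triangle[OF *(1,3) assms(2)] by linarith+
  then have "rdist x' y' = rdist x y"
    using *(2,4) rdist_commute[of x x'] rdist_commute[of y y'] by linarith
  then show ?thesis
    by (simp add: cone_dist_def rdist_def x'_def y'_def)
qed

lemma dist_cls_le:
  assumes "x \<in> Q" "y \<in> Q" "eventually (\<lambda>n. d (x n) (y n) \<le> r * \<sigma> n) \<omega>" "0 \<le> r"
  shows "dY (cls x) (cls y) \<le> r"
  using rdist_le[OF assms(3,4)] by (simp add: dist_cls assms(1,2))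

lemma dist_cls_less:
  assumes "x \<in> Q" "y \<in> Q" "dY (cls x) (cls y) < r"
  shows "eventually (\<lambda>n. d (x n) (y n) < r * \<sigma> n) \<omega>"
  using assms by (intro rdist_less) (simp_all add: dist_cls)

text \<open>Ultralimits are complete: follow the \<open>k\<close>-th representative as long as the first \<open>k\<close> steps of the
  Cauchy sequence are seen at index \<open>n\<close>.\<close>

lemma cone_complete: "Y.mcomplete"
  unfolding Y.mcomplete_def
proof (intro allI impI)
  fix A assume A: "Y.MCauchy A"
  have "\<exists>N. \<forall>n n'. N \<le> n \<longrightarrow> N \<le> n' \<longrightarrow> dY (A n) (A n') < 1 / 2 ^ k" for k
    using A unfolding Y.MCauchy_def by simp
  then obtain N where N: "\<And>k n n'. N k \<le> n \<Longrightarrow> N k \<le> n' \<Longrightarrow> dY (A n) (A n') < 1 / 2 ^ k"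
    by metis
  \<comment> \<open>The partial sums keep \<open>r k\<close> above \<open>N k\<close>, and the
    summand \<open>k\<close> makes \<open>r\<close> strictly increasing.\<close>
  define r where "r k = (\<Sum>j\<le>k. N j) + k" for k
  have r: "strict_mono r"
    by (rule strict_monoI_Suc) (simp add: r_def)
  have rN: "N k \<le> r k" for k
    unfolding r_def by (rule trans_le_add1, rule member_le_sum) auto
  have rmono: "r k \<le> r (Suc k)" for k
    using r by (simp add: strict_mono_less_eq)
  have step: "dY (A (r k)) (A (r (Suc k))) < 1 / 2 ^ k" for k
    using N[of k] rN[of k] rmono[of k] by simp
  have "A n \<in> Y" for n using A by (auto simp: Y.MCauchy_def)
  then have "\<forall>k. \<exists>x\<in>Q. A (r k) = cls x"
    by (auto simp: cone_points_eq)
  then obtain x where x: "\<And>k. x k \<in> Q" "\<And>k. A (r k) = cls (x k)" by metis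
  define good where "good k n \<longleftrightarrow> (\<forall>j<k. d (x j n) (x (Suc j) n) \<le> 1 / 2 ^ j * \<sigma> n)" for k n
  have ev_good: "eventually (good k) \<omega>" for k
  proof -
    have "eventually (\<lambda>n. d (x j n) (x (Suc j) n) \<le> 1 / 2 ^ j * \<sigma> n) \<omega>" for j
      using dist_cls_less[OF x(1) x(1) step[of j, unfolded x(2)]]
      by eventually_elim simp
    then have "eventually (\<lambda>n. \<forall>j\<in>{..<k}. d (x j n) (x (Suc j) n) \<le> 1 / 2 ^ j * \<sigma> n) \<omega>"
      by (intro eventually_ball_finite) auto
    then show ?thesis by eventually_elim (simp add: good_def)
  qed
  \<comment> \<open>The bound \<open>k \<le> n\<close> makes the set finite, and 0 always belongs to
    it. For fixed \<open>k\<close>, the value at \<open>n\<close> is at least \<open>k\<close> for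
    almost all \<open>n\<close>.\<close>
  define \<kappa> where "\<kappa> n = Max {k. k \<le> n \<and> good k n}" for n
  define y where "y n = x (\<kappa> n) n" for n
  have \<kappa>: "good (\<kappa> n) n" "k \<le> n \<Longrightarrow> good k n \<Longrightarrow> k \<le> \<kappa> n" for n k
  proof -
    have "0 \<in> {k. k \<le> n \<and> good k n}" by (simp add: good_def)
    then show "good (\<kappa> n) n"
      unfolding \<kappa>_def using Max_in[of "{k. k \<le> n \<and> good k n}"] by auto
    show "k \<le> n \<Longrightarrow> good k n \<Longrightarrow> k \<le> \<kappa> n"
      unfolding \<kappa>_def by (rule Max_ge) auto
  qed
  have tele: "d (x k n) (x (k + i) n) \<le> (2 / 2 ^ k - 2 / 2 ^ (k + i)) * \<sigma> n" if "good (k + i) n" for k i n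
    using that
  proof (induction i)
    case 0
    then show ?case using x Q_in by simp
  next
    case (Suc i)
    then have "good (k + i) n" "d (x (k + i) n) (x (Suc (k + i)) n) \<le> 1 / 2 ^ (k + i) * \<sigma> n"
      by (auto simp: good_def)
    then have "d (x k n) (x (k + Suc i) n) \<le> (2 / 2 ^ k - 2 / 2 ^ (k + i)) * \<sigma> n + 1 / 2 ^ (k + i) * \<sigma> n"
      using Suc.IH triangle[of "x k n" "x (k + i) n" "x (Suc (k + i)) n"] Q_in[OF x(1)] by fastforce
    also have "\<dots> = (2 / 2 ^ k - 2 / 2 ^ (k + Suc i)) * \<sigma> n"
      by (simp add: field_simps)
    finally show ?case .
  qed
  have close: "eventually (\<lambda>n. d (x k n) (y n) \<le> 2 / 2 ^ k * \<sigma> n) \<omega>" for k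
    using ev_good[of k] eventually_ultra[OF eventually_ge_at_top[of k]]
  proof eventually_elim
    case (elim n)
    then have "k \<le> \<kappa> n" using \<kappa> by blast
    then have "d (x k n) (y n) \<le> (2 / 2 ^ k - 2 / 2 ^ \<kappa> n) * \<sigma> n"
      using tele[of k "\<kappa> n - k" n] \<kappa>(1) by (simp add: y_def)
    also have "\<dots> \<le> 2 / 2 ^ k * \<sigma> n"
      using scale_pos[of n] by (intro mult_right_mono) auto
    finally show ?case .
  qed
  have yX: "y n \<in> X" for n using Q_in[OF x(1)] by (simp add: y_def)
  have yQ: "y \<in> Q"
    using Q_near[OF x(1) yX close[of 0]] .
  have dy: "dY (A (r k)) (cls y) \<le> 2 / 2 ^ k" for k
    unfolding x(2) using dist_cls_le[OF x(1) yQ close[of k]] by simp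
  have "limitin Y.mtopology (A \<circ> r) (cls y) sequentially"
    unfolding Y.limitin_metric
  proof (intro conjI allI impI)
    fix e :: real assume "0 < e"
    have null: "(\<lambda>k. 2 / 2 ^ k) \<longlonglongrightarrow> (0 :: real)"
      using LIMSEQ_divide_realpow_zero[of 2 2] by simp
    show "\<forall>\<^sub>F k in sequentially. (A \<circ> r) k \<in> Y \<and> dY ((A \<circ> r) k) (cls y) < e"
      using order_tendstoD(2)[OF null \<open>0 < e\<close>]
      by eventually_elim (use dy \<open>\<And>n. A n \<in> Y\<close> in \<open>auto intro: le_less_trans\<close>)
  qed (use yQ in simp)
  then have "limitin Y.mtopology A (cls y) sequentially"
    by (rule Y.MCauchy_convergent_subsequence[OF A r])
  then show "\<exists>l. limitin Y.mtopology A l sequentially" by blast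
qed

end

section \<open>Cones of the Cayley graphs\<close>

locale cayley_cone = snowflake_group L +
  cone_setting "Cay (presented_group (GL_relations L)) S" "Cay_dist (presented_group (GL_relations L)) S" \<omega> \<sigma> obs
  for L :: nat and S :: "GL_gen gword set set" and \<omega> \<sigma> obs +
  assumes finite_S: "finite S" and S_carrier: "S \<subseteq> carrier (presented_group (GL_relations L))"
    and S_gen: "generate (presented_group (GL_relations L)) S = carrier (presented_group (GL_relations L))"
begin

interpretation GL: group GG
  by (rule group_presented_group)

section \<open>Word length against distance in the Cayley graph\<close>

abbreviation vd :: "GL_gen gword set \<Rightarrow> GL_gen gword set \<Rightarrow> real" where
  "vd g h \<equiv> real (vertex_dist GG S g h)"

abbreviation dX where "dX \<equiv> Cay_dist GG S"

lemmas vd_attained = vertex_dist_attained[OF group_presented_group S_carrier S_gen]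

lemma Vertex_in: "g \<in> carrier GG \<Longrightarrow> Vertex g \<in> Cay GG S"
  by (simp add: Cay_def)

lemma Cay_dist_Vertex: "g \<in> carrier GG \<Longrightarrow> h \<in> carrier GG \<Longrightarrow> dX (Vertex g) (Vertex h) = vd g h"
  by (simp add: Cay_dist_def Cay_def dist_via_vertices_def)

lemma adj_translate:
  assumes "(h, k) \<in> cayley_adj GG S ^^ n" and g: "g \<in> carrier GG"
  shows "(g \<cdot> h, g \<cdot> k) \<in> cayley_adj GG S ^^ n"
  using assms(1)
proof (induction n arbitrary: k)
  case (Suc n)
  then obtain l where l: "(h, l) \<in> cayley_adj GG S ^^ n" "(l, k) \<in> cayley_adj GG S" by auto
  have "(g \<cdot> l, g \<cdot> k) \<in> cayley_adj GG S"
    using l(2) g S_carrier unfolding cayley_adj_def by (auto simp: GL.m_assoc subset_iff)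
  with Suc.IH[OF l(1)] show ?case by (rule relpow_Suc_I)
qed simp

lemma vd_word_bound: "\<exists>c :: real. \<forall>g\<in>carrier GG. \<forall>w. vd g (g \<cdot> ev w) \<le> c * real (length w)"
proof -
  define letters :: "(GL_gen \<times> bool) set" where "letters = {Gen_a, Gen_x, Gen_y, Gen_s, Gen_t} \<times> UNIV"
  have fin: "finite letters" by (simp add: letters_def)
  have all: "l \<in> letters" for l
    by (cases l; cases "fst l") (auto simp: letters_def)
  define c where "c = Max ((\<lambda>l. vd \<one>\<^bsub>GG\<^esub> (ev [l])) ` letters)"
  have c: "vd \<one>\<^bsub>GG\<^esub> (ev [l]) \<le> c" for l
    unfolding c_def using fin all by (intro Max_ge) auto
  have step: "vd g (g \<cdot> ev [l]) \<le> c" if g: "g \<in> carrier GG" for g l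
  proof -
    have "(g \<cdot> \<one>\<^bsub>GG\<^esub>, g \<cdot> ev [l]) \<in> cayley_adj GG S ^^ vertex_dist GG S \<one>\<^bsub>GG\<^esub> (ev [l])"
      using g by (intro adj_translate vd_attained) auto
    then have "vertex_dist GG S g (g \<cdot> ev [l]) \<le> vertex_dist GG S \<one>\<^bsub>GG\<^esub> (ev [l])"
      using g by (intro vertex_dist_le) simp
    then show ?thesis using c[of l] by linarith
  qed
  have "vd g (g \<cdot> ev w) \<le> c * length w" if g: "g \<in> carrier GG" for g w
  proof (induction w rule: rev_induct)
    case Nil
    then show ?case using g by (simp add: ev_Nil vertex_dist_refl)
  next
    case (snoc l w)
    have "vertex_dist GG S g (g \<cdot> ev (w @ [l])) \<le> vertex_dist GG S g (g \<cdot> ev w) + vertex_dist GG S (g \<cdot> ev w) (g \<cdot> ev (w @ [l]))"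
      using g by (intro vertex_dist_triangle[OF group_presented_group S_carrier S_gen]) auto
    moreover have "g \<cdot> ev (w @ [l]) = (g \<cdot> ev w) \<cdot> ev [l]"
      using g by (simp only: ev_append) (simp add: GL.m_assoc)
    then have "vd (g \<cdot> ev w) (g \<cdot> ev (w @ [l])) \<le> c"
      using step[of "g \<cdot> ev w" l] g by simp
    ultimately show ?case
      using snoc by (simp add: algebra_simps)
  qed
  then show ?thesis by blast
qed

lemma vd_word_exists: "\<exists>c :: real. \<forall>g\<in>carrier GG. \<forall>h\<in>carrier GG. \<exists>w. h = g \<cdot> ev w \<and> real (length w) \<le> c * vd g h"
proof -
  have "\<forall>s\<in>S. \<exists>w. ev w = s"
    using S_carrier by (auto simp: carrier_presented_group)
  then obtain wd where wd: "\<And>s. s \<in> S \<Longrightarrow> ev (wd s) = s" by metis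
  define c where "c = Max (insert 0 ((\<lambda>s. length (wd s)) ` S))"
  have c: "length (wd s) \<le> c" if "s \<in> S" for s
    unfolding c_def using that finite_S by (intro Max_ge) auto
  have "\<exists>w. h = g \<cdot> ev w \<and> length w \<le> c * n"
    if "(g, h) \<in> cayley_adj GG S ^^ n" "g \<in> carrier GG" for g h n
    using that
  proof (induction n arbitrary: h)
    case 0
    then show ?case by (intro exI[of _ "[]"]) (simp add: ev_Nil)
  next
    case (Suc n)
    then obtain k where k: "(g, k) \<in> cayley_adj GG S ^^ n" "(k, h) \<in> cayley_adj GG S" by auto
    then obtain w where w: "k = g \<cdot> ev w" "length w \<le> c * n" using Suc by blast
    from k(2) obtain s where s: "s \<in> S" "k \<in> carrier GG" "h \<in> carrier GG" "h = k \<cdot> s \<or> k = h \<cdot> s"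
      by (auto simp: cayley_adj_def)
    have "\<exists>u. h = k \<cdot> ev u \<and> length u \<le> c"
      using s(4)
    proof
      assume "h = k \<cdot> s"
      then show ?thesis using wd[OF s(1)] c[OF s(1)] by (intro exI[of _ "wd s"]) simp
    next
      assume "k = h \<cdot> s"
      then have "h = k \<cdot> ev (word_inv (wd s))"
        using s(3) wd[OF s(1)] S_carrier s(1) by (auto simp: ev_word_inv GL.m_assoc subset_iff)
      then show ?thesis using c[OF s(1)] by (intro exI[of _ "word_inv (wd s)"]) simp
    qed
    then obtain u where u: "h = k \<cdot> ev u" "length u \<le> c" by blast
    then have "h = g \<cdot> ev (w @ u)"
      using w(1) Suc.prems(2) by (simp add: ev_append GL.m_assoc)
    then show ?case using w(2) u(2) by (intro exI[of _ "w @ u"]) simp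
  qed
  then have "\<forall>g\<in>carrier GG. \<forall>h\<in>carrier GG. \<exists>w. h = g \<cdot> ev w \<and> length w \<le> real c * vd g h"
    using vd_attained by (metis of_nat_le_iff of_nat_mult)
  then show ?thesis by blast
qed

text \<open>Compares the metric of \<open>S\<close> with length over the five generators of the
  presentation, in which moves are measured.\<close>

definition bilip :: "real \<Rightarrow> bool" where
  "bilip c \<longleftrightarrow> 1 \<le> c \<and> (\<forall>g\<in>carrier GG. (\<forall>w. vd g (g \<cdot> ev w) \<le> c * real (length w)) \<and>
     (\<forall>h\<in>carrier GG. \<exists>w. h = g \<cdot> ev w \<and> real (length w) \<le> c * vd g h))"

lemma bilip_exists: "\<exists>c. bilip c"
proof -
  obtain c1 where c1: "\<And>g w. g \<in> carrier GG \<Longrightarrow> vd g (g \<cdot> ev w) \<le> c1 * real (length w)"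
    using vd_word_bound by blast
  obtain c2 where c2: "\<And>g h. g \<in> carrier GG \<Longrightarrow> h \<in> carrier GG \<Longrightarrow> \<exists>w. h = g \<cdot> ev w \<and> real (length w) \<le> c2 * vd g h"
    using vd_word_exists by blast
  define c where "c = max 1 (max c1 c2)"
  have "c1 * x \<le> c * x" "c2 * x \<le> c * x" if "0 \<le> x" for x
    using that by (auto simp: c_def intro!: mult_right_mono)
  note le = this
  have "bilip c"
    unfolding bilip_def
  proof (intro conjI ballI allI)
    show "1 \<le> c" by (simp add: c_def)
    show "vd g (g \<cdot> ev w) \<le> c * real (length w)" if "g \<in> carrier GG" for g w
      using c1[OF that, of w] le(1)[of "real (length w)"] by simp
    show "\<exists>w. h = g \<cdot> ev w \<and> real (length w) \<le> c * vd g h" if gh: "g \<in> carrier GG" "h \<in> carrier GG" for g h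
    proof -
      obtain w where "h = g \<cdot> ev w" "real (length w) \<le> c2 * vd g h"
        using c2[OF gh] by blast
      then show ?thesis
        using le(2)[of "vd g h"] by (intro exI[of _ w]) simp
    qed
  qed
  then show ?thesis ..
qed

definition bconst :: real where "bconst = (SOME c. bilip c)"

lemma bilip_bconst: "bilip bconst"
  unfolding bconst_def using bilip_exists by (rule someI_ex)

lemma bconst_ge: "1 \<le> bconst"
  using bilip_bconst by (simp add: bilip_def)

lemma vd_word_le: "g \<in> carrier GG \<Longrightarrow> vd g (g \<cdot> ev w) \<le> bconst * length w"
  using bilip_bconst by (simp add: bilip_def)

definition geo :: "GL_gen gword set \<Rightarrow> GL_gen gword set \<Rightarrow> GL_gen gword" where
  "geo g h = (SOME w. h = g \<cdot> ev w \<and> length w \<le> bconst * vd g h)"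

lemma geo:
  assumes "g \<in> carrier GG" "h \<in> carrier GG"
  shows "h = g \<cdot> ev (geo g h)" "length (geo g h) \<le> bconst * vd g h"
proof -
  have "\<exists>w. h = g \<cdot> ev w \<and> length w \<le> bconst * vd g h"
    using bilip_bconst assms by (simp add: bilip_def)
  from someI_ex[OF this] show "h = g \<cdot> ev (geo g h)" "length (geo g h) \<le> bconst * vd g h"
    unfolding geo_def by blast+
qed

text \<open>Later the two loops share their base point; the empty word there keeps it fixed during
  the sweep.\<close>

lemma geo_refl: "g \<in> carrier GG \<Longrightarrow> geo g g = []"
  using geo(2)[of g g] by (simp add: vertex_dist_refl)

section \<open>Paths spelled by words\<close>

definition pt :: "GL_gen gword set \<Rightarrow> GL_gen gword \<Rightarrow> nat \<Rightarrow> GL_gen gword set" where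
  "pt g w i = g \<cdot> ev (take i w)"

lemma pt_in [simp]: "g \<in> carrier GG \<Longrightarrow> pt g w i \<in> carrier GG"
  by (simp add: pt_def)

lemma pt_0 [simp]: "g \<in> carrier GG \<Longrightarrow> pt g w 0 = g"
  by (simp add: pt_def ev_Nil)

lemma pt_append:
  assumes "g \<in> carrier GG"
  shows "pt g (u @ v) i = (if i \<le> length u then pt g u i else pt (g \<cdot> ev u) v (i - length u))"
  using assms by (simp add: pt_def ev_append ev_Nil GL.m_assoc)

lemma vd_commute: "vd g h = vd h g"
  by (simp add: vertex_dist_commute)

lemma vd_triangle:
  "g \<in> carrier GG \<Longrightarrow> h \<in> carrier GG \<Longrightarrow> k \<in> carrier GG \<Longrightarrow> vd g k \<le> vd g h + vd h k"
  using vertex_dist_triangle[OF group_presented_group S_carrier S_gen, of g h k] by linarith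

lemma vd_pt:
  assumes g: "g \<in> carrier GG"
  shows "vd (pt g w i) (pt g w j) \<le> bconst * \<bar>real i - real j\<bar>"
proof -
  have *: "vd (pt g w i) (pt g w j) \<le> bconst * (real j - real i)" if "i \<le> j" for i j
  proof -
    have "take j w = take i w @ take (j - i) (drop i w)"
      using that by (metis take_add le_add_diff_inverse)
    then have "pt g w j = pt g w i \<cdot> ev (take (j - i) (drop i w))"
      using g by (simp add: pt_def ev_append GL.m_assoc)
    then have "vd (pt g w i) (pt g w j) \<le> bconst * length (take (j - i) (drop i w))"
      using vd_word_le[of "pt g w i" "take (j - i) (drop i w)"] g by simp
    also have "\<dots> \<le> bconst * (real j - real i)"
      using bconst_ge that by (intro mult_left_mono) auto
    finally show ?thesis .
  qed
  show ?thesis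
  proof (cases "i \<le> j")
    case True
    then show ?thesis using *[of i j] by simp
  next
    case False
    then show ?thesis using *[of j i] vd_commute[of "pt g w i" "pt g w j"] by simp
  qed
qed

lemma geq_ev: "u \<simeq> v \<longleftrightarrow> ev u = ev v"
  by (simp add: pres_class_eq_iff)

text \<open>A single move changes the whole path uniformly by a bounded multiple of its size, even though it
  shifts the parametrisation.\<close>

lemma move_vd:
  assumes g: "g \<in> carrier GG" and mv: "move m u v"
  shows "vd (pt g u i) (pt g v i) \<le> bconst * m"
proof -
  obtain p q u' v' where *: "u = p @ u' @ q" "v = p @ v' @ q" "length u' + length v' \<le> m" "ev u' = ev v'"
    using mv unfolding move_def geq_ev by blast
  have bconst: "bconst * x \<le> bconst * m" if "x \<le> real m" for x
    using that bconst_ge by (intro mult_left_mono) auto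
  show ?thesis
  proof (cases "i \<le> length p")
    case True
    then show ?thesis
      using g bconst_ge by (simp add: * pt_append vertex_dist_refl)
  next
    case False
    define k h where "k = i - length p" and "h = g \<cdot> ev p"
    have h: "h \<in> carrier GG" using g by (simp add: h_def)
    have e: "pt g u i = pt h (u' @ q) k" "pt g v i = pt h (v' @ q) k"
      using False g by (simp_all add: * pt_append h_def k_def)
    \<comment> \<open>Behind the replaced subword both paths visit the same vertices, with indices
      shifted by the difference of the lengths.\<close>
    have via: "pt h (u' @ q) (length u' + j) = pt h (v' @ q) (length v' + j)" for j
      using h *(4) by (simp add: pt_append) (simp add: pt_def ev_append)
    have near: "vd (pt h (u' @ q) k) (pt h (v' @ q) k) \<le>
        bconst * \<bar>real k - real i'\<bar> + bconst * \<bar>real j' - real k\<bar>"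
      if "pt h (u' @ q) i' = pt h (v' @ q) j'" for i' j'
      using vd_triangle[of "pt h (u' @ q) k" "pt h (u' @ q) i'" "pt h (v' @ q) k"]
        vd_pt[OF h, of "u' @ q" k i'] vd_pt[OF h, of "v' @ q" j' k] that h by simp
    \<comment> \<open>A common vertex near both points at time \<open>k\<close>: the start of the
      replaced part, its end, or a point of \<open>q\<close> at shifted time.\<close>
    have "\<exists>i' j'. pt h (u' @ q) i' = pt h (v' @ q) j' \<and>
        \<bar>real k - real i'\<bar> + \<bar>real j' - real k\<bar> \<le> m"
    proof (cases "k \<le> length u' \<and> k \<le> length v'")
      case True
      then show ?thesis using *(3) h by (intro exI[of _ 0]) auto
    next
      case False
      show ?thesis
      proof (cases "length u' \<le> length v'")
        case True
        show ?thesis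
        proof (cases "k \<le> length v'")
          case kv: True
          have "\<bar>real k - real (length u' + (0))\<bar> + \<bar>real (length v' + (0)) - real k\<bar> \<le> m"
            using False kv True *(3) by linarith
          then show ?thesis
            using via[of "0"] by (intro exI[of _ "length u' + (0)"] exI[of _ "length v' + (0)"] conjI)
        next
          case kv: False
          have "\<bar>real k - real (length u' + (k - length v'))\<bar> + \<bar>real (length v' + (k - length v')) - real k\<bar> \<le> m"
            using kv True *(3) by linarith
          then show ?thesis
            using via[of "k - length v'"] by (intro exI[of _ "length u' + (k - length v')"] exI[of _ "length v' + (k - length v')"] conjI)
        qed
      next
        case nle: False
        show ?thesis
        proof (cases "k \<le> length u'")
          case ku: True
          have "\<bar>real k - real (length u' + (0))\<bar> + \<bar>real (length v' + (0)) - real k\<bar> \<le> m"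
            using False ku nle *(3) by linarith
          then show ?thesis
            using via[of "0"] by (intro exI[of _ "length u' + (0)"] exI[of _ "length v' + (0)"] conjI)
        next
          case ku: False
          have "\<bar>real k - real (length u' + (k - length u'))\<bar> + \<bar>real (length v' + (k - length u')) - real k\<bar> \<le> m"
            using ku nle *(3) by linarith
          then show ?thesis
            using via[of "k - length u'"] by (intro exI[of _ "length u' + (k - length u')"] exI[of _ "length v' + (k - length u')"] conjI)
        qed
      qed
    qed
    then obtain i' j' where "pt h (u' @ q) i' = pt h (v' @ q) j'"
      "\<bar>real k - real i'\<bar> + \<bar>real j' - real k\<bar> \<le> m" by blast
    then show ?thesis
      using near[of i' j'] bconst[of "\<bar>real k - real i'\<bar> + \<bar>real j' - real k\<bar>"] e
      by (simp add: distrib_left)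
  qed
qed

subsection \<open>Filling a thin square\<close>

text \<open>Subtraction of natural numbers gives 0 for the first \<open>K\<close> rows; the next
  \<open>K2\<close> rows advance evenly along \<open>f\<close>.\<close>

definition frac_len :: "nat \<Rightarrow> nat \<Rightarrow> nat \<Rightarrow> GL_gen gword \<Rightarrow> nat" where
  "frac_len K K2 j f = nat \<lfloor>real (j - K) / real K2 * length f\<rfloor>"

lemma frac_len_le:
  assumes "j \<le> K + K2"
  shows "frac_len K K2 j f \<le> length f"
proof -
  have "real (j - K) / real K2 \<le> 1"
    using assms by (auto simp: divide_le_eq_1)
  then have "real (j - K) / real K2 * length f \<le> 1 * real (length f)"
    by (intro mult_right_mono) auto
  then show ?thesis by (simp add: frac_len_def nat_le_iff floor_le_iff)
qed

lemma frac_len_0: "j \<le> K \<Longrightarrow> frac_len K K2 j f = 0"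
  by (simp add: frac_len_def)

lemma frac_len_end: "0 < K2 \<Longrightarrow> frac_len K K2 (K + K2) f = length f"
  by (simp add: frac_len_def)

lemma frac_len_step:
  "\<bar>real (frac_len K K2 j f) - real (frac_len K K2 (Suc j) f)\<bar> \<le> length f / K2 + 1"
proof -
  let ?x = "real (j - K) / real K2 * length f" and ?y = "real (Suc j - K) / real K2 * length f"
  have "real (Suc j - K) \<le> real (j - K) + 1" "real (j - K) \<le> real (Suc j - K)" by auto
  then have "real (Suc j - K) / real K2 \<le> (real (j - K) + 1) / real K2"
      "real (j - K) / real K2 \<le> real (Suc j - K) / real K2"
    by (auto intro!: divide_right_mono)
  then have "?y \<le> (real (j - K) + 1) / real K2 * length f" "?x \<le> ?y"
    by (auto intro: mult_right_mono simp del: times_divide_eq_left)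
  then have "?y \<le> ?x + length f / K2" "?x \<le> ?y" "0 \<le> ?x"
    by (simp_all add: add_divide_distrib distrib_right)
  moreover have "real (nat \<lfloor>z\<rfloor>) \<le> z" "z < real (nat \<lfloor>z\<rfloor>) + 1" if "0 \<le> z" for z :: real
    using that by linarith+
  ultimately show ?thesis
    unfolding frac_len_def by (smt (verit))
qed

text \<open>Clamps the time \<open>i\<close> to the part of the path that row \<open>j\<close> still
  uses, between the point reached on \<open>f\<close> and the point reached on \<open>f'\<close>.
  Waiting at the two ends gives all rows a common parametrisation.\<close>

definition sq_pos :: "nat \<Rightarrow> nat \<Rightarrow> GL_gen gword \<Rightarrow> GL_gen gword \<Rightarrow> (nat \<Rightarrow> GL_gen gword) \<Rightarrow> nat \<Rightarrow> nat \<Rightarrow> nat" where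
  "sq_pos K K2 f f' W j i =
    max (frac_len K K2 j f) (min (length (W (min j K)) - frac_len K K2 j f') i)"

text \<open>\<open>a\<close>, \<open>b\<close>, \<open>a'\<close>, \<open>b'\<close> are the corners. The words \<open>W 0, \<dots>, W K\<close> sweep from the bottom side \<open>w\<close> to
  the path \<open>f v f'\<^sup>-\<^sup>1\<close> around the other sides; in the following \<open>K2\<close> rows, the ends of that path are
  pulled up along \<open>f\<close> and \<open>f'\<close>.\<close>

definition square where
  "square a b a' b' w v f f' W K m \<longleftrightarrow> a \<in> carrier GG \<and> b = a \<cdot> ev w \<and> a' = a \<cdot> ev f \<and> b' = a' \<cdot> ev v \<and>
     b' = b \<cdot> ev f' \<and> W 0 = w \<and> W K = f @ v @ word_inv f' \<and> (\<forall>j<K. move m (W j) (W (Suc j)))"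

context
  fixes a b a' b' w v f f' W K m
  assumes sq: "square a b a' b' w v f f' W K m"
begin

lemma sq_a: "a \<in> carrier GG"
  using sq by (simp add: square_def)

lemma sq_eq: "b = a \<cdot> ev w" "a' = a \<cdot> ev f" "b' = a' \<cdot> ev v" "b' = b \<cdot> ev f'" "W 0 = w"
    "W K = f @ v @ word_inv f'"
  using sq unfolding square_def by blast+

lemma sq_W_ev: "j \<le> K \<Longrightarrow> ev (W j) = ev w"
proof (induction j)
  case 0
  then show ?case by (simp add: sq_eq)
next
  case (Suc j)
  then have "move m (W j) (W (Suc j))" using sq by (simp add: square_def)
  then show ?case using Suc move_imp_eq geq_ev by fastforce
qed

lemma sq_pos_lip: "\<bar>real (sq_pos K K2 f f' W j i) - real (sq_pos K K2 f f' W j i')\<bar> \<le> \<bar>real i - real i'\<bar>"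
  by (auto simp: sq_pos_def max_def min_def)

lemma sq_pos_le: "j \<le> K + K2 \<Longrightarrow> sq_pos K K2 f f' W j i \<le> max (length f) i"
  using frac_len_le[of j K K2 f] by (auto simp: sq_pos_def max_def min_def)

lemma sq_low:
  assumes "j \<le> K"
  shows "pt a (W (min j K)) (sq_pos K K2 f f' W j i) = pt a (W j) i"
  using assms by (simp add: sq_pos_def frac_len_0 pt_def min_def)

text \<open>The first \<open>K\<close> steps are moves. Afterwards the word stays the same and only
  the clamping interval shrinks, which displaces a position by no more than the larger displacement
  of its ends.\<close>

lemma sq_step:
  assumes "j < K + K2"
  shows "vd (pt a (W (min j K)) (sq_pos K K2 f f' W j i)) (pt a (W (min (Suc j) K)) (sq_pos K K2 f f' W (Suc j) i))
     \<le> bconst * (m + (length f + length f') / K2 + 1)"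
proof (cases "j < K")
  case True
  then have "move m (W j) (W (Suc j))" using sq by (simp add: square_def)
  then have "vd (pt a (W j) i) (pt a (W (Suc j)) i) \<le> bconst * m"
    by (rule move_vd[OF sq_a])
  also have "\<dots> \<le> bconst * (m + (length f + length f') / K2 + 1)"
    using bconst_ge by (intro mult_left_mono) auto
  finally show ?thesis
    using True by (subst sq_low, simp, subst sq_low) auto
next
  case False
  then have W: "W (min j K) = W K" "W (min (Suc j) K) = W K" by (simp_all add: min_def)
  have cl: "\<bar>real (max x (min (n - y) i)) - real (max x' (min (n - y') i))\<bar>
      \<le> max \<bar>real x - real x'\<bar> \<bar>real y - real y'\<bar>" for x x' y y' n i :: nat
  proof -
    have "\<bar>max p (min q i) - max p' (min q' i)\<bar> \<le> max \<bar>p - p'\<bar> \<bar>q - q'\<bar>" for p p' q q' i :: real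
      by (auto simp: max_def min_def)
    from this[of x "real (n - y)" i x' "real (n - y')"]
    have "\<bar>real (max x (min (n - y) i)) - real (max x' (min (n - y') i))\<bar>
        \<le> max \<bar>real x - real x'\<bar> \<bar>real (n - y) - real (n - y')\<bar>"
      by (simp only: of_nat_max of_nat_min)
    also have "\<bar>real (n - y) - real (n - y')\<bar> \<le> \<bar>real y - real y'\<bar>"
      by linarith
    finally show ?thesis by simp
  qed
  have "\<bar>real (sq_pos K K2 f f' W j i) - real (sq_pos K K2 f f' W (Suc j) i)\<bar>
      \<le> max (length f / K2 + 1) (length f' / K2 + 1)"
    unfolding sq_pos_def W
    by (rule order_trans[OF cl max.mono[OF frac_len_step frac_len_step]])
  also have "\<dots> \<le> m + (length f + length f') / K2 + 1"
    by (auto simp: add_divide_distrib)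
  finally have "bconst * \<bar>real (sq_pos K K2 f f' W j i) - real (sq_pos K K2 f f' W (Suc j) i)\<bar>
      \<le> bconst * (m + (length f + length f') / K2 + 1)"
    using bconst_ge by (intro mult_left_mono) auto
  then show ?thesis
    unfolding W using vd_pt[OF sq_a, of "W K"] order_trans by blast
qed

text \<open>The left edge depends on \<open>f\<close> and the row counts alone, not on the sweep
  \<open>W\<close>, and the right edge in \<open>sq_end\<close> likewise on \<open>f'\<close>.
  Squares with a common side therefore fit together.\<close>

lemma sq_start:
  assumes "j \<le> K + K2"
  shows "pt a (W (min j K)) (sq_pos K K2 f f' W j 0) = pt a f (frac_len K K2 j f)"
proof (cases "j \<le> K")
  case True
  then show ?thesis using sq_low[OF True, of K2 0] sq_a by (simp add: frac_len_0)
next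
  case False
  then show ?thesis
    using frac_len_le[OF assms, of f] sq_a by (simp add: sq_pos_def sq_eq pt_append)
qed

lemma sq_end:
  assumes "j \<le> K + K2" "length (W (min j K)) \<le> i"
  shows "pt a (W (min j K)) (sq_pos K K2 f f' W j i) = pt b f' (frac_len K K2 j f')"
proof (cases "j \<le> K")
  case True
  then show ?thesis
    using sq_low[OF True, of K2 i] sq_a assms(2) sq_W_ev[OF True] sq_eq(1)
    by (simp add: frac_len_0 min_def) (simp add: pt_def)
next
  case False
  define r where "r = frac_len K K2 j f'"
  have r: "r \<le> length f'" unfolding r_def by (rule frac_len_le[OF assms(1)])
  have W: "W (min j K) = f @ v @ word_inv f'" using False sq_eq(6) by (simp add: min_def)
  have pos: "sq_pos K K2 f f' W j i = length f + (length v + (length f' - r))"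
    using assms(2) r frac_len_le[OF assms(1), of f] unfolding sq_pos_def W r_def[symmetric] by simp
  \<comment> \<open>The path runs back along \<open>f'\<close>: after \<open>length f' - r\<close>
    letters of the inverse it is at index \<open>r\<close> of \<open>f'\<close>.\<close>
  have "take (length f' - r) (word_inv f') = word_inv (drop r f')"
  proof -
    have "word_inv f' = word_inv (drop r f') @ word_inv (take r f')"
      by (simp flip: word_inv_append)
    then show ?thesis using r by simp
  qed
  then have "pt a (W (min j K)) (sq_pos K K2 f f' W j i) = a \<cdot> (ev f \<cdot> (ev v \<cdot> ginv (ev (drop r f'))))"
    unfolding pos W by (simp add: pt_def ev_append ev_word_inv)
  also have "\<dots> = b' \<cdot> ginv (ev (drop r f'))"
    using sq_eq(2,3) sq_a by (simp add: GL.m_assoc)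
  also have "\<dots> = b \<cdot> ev (take r f') \<cdot> ev (drop r f') \<cdot> ginv (ev (drop r f'))"
    using sq_eq(1,4) sq_a ev_append[of "take r f'" "drop r f'"] by (simp add: GL.m_assoc)
  also have "\<dots> = pt b f' r"
    using sq_eq(1) sq_a by (simp add: pt_def GL.m_assoc)
  finally show ?thesis by (simp add: r_def)
qed

lemma sq_first: "vd a (pt a (W (min 0 K)) (sq_pos K K2 f f' W 0 i)) \<le> bconst * length w"
proof -
  have "vd a (pt a w i) = vd (pt a w 0) (pt a w (min i (length w)))"
    using sq_a by (simp add: pt_def min_def ev_Nil)
  also have "\<dots> \<le> bconst * \<bar>real 0 - real (min i (length w))\<bar>"
    by (rule vd_pt[OF sq_a])
  also have "\<dots> \<le> bconst * length w"
    using bconst_ge by (intro mult_left_mono) auto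
  finally show ?thesis
    using sq_low[of 0 K2 i] sq_eq(5) by simp
qed

lemma sq_last:
  assumes "0 < K2"
  shows "vd a' (pt a (W (min (K + K2) K)) (sq_pos K K2 f f' W (K + K2) i)) \<le> bconst * length v"
proof -
  have W: "W (min (K + K2) K) = f @ v @ word_inv f'" using sq_eq(6) by simp
  have p: "\<bar>real (length f) - real (sq_pos K K2 f f' W (K + K2) i)\<bar> \<le> length v"
  proof -
    have "sq_pos K K2 f f' W (K + K2) i = max (length f) (min (length f + length v) i)"
      unfolding sq_pos_def W using assms by (simp add: frac_len_end)
    then show ?thesis by (simp add: max_def min_def)
  qed
  have "a' = pt a (f @ v @ word_inv f') (length f)"
    using sq_eq(2) by (simp add: pt_def)
  then have "vd a' (pt a (W (min (K + K2) K)) (sq_pos K K2 f f' W (K + K2) i)) \<le>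
      bconst * \<bar>real (length f) - real (sq_pos K K2 f f' W (K + K2) i)\<bar>"
    using vd_pt[OF sq_a] unfolding W by metis
  also have "\<dots> \<le> bconst * length v"
    using p bconst_ge by (intro mult_left_mono) auto
  finally show ?thesis .
qed

end

end

context cone_setting
begin

text \<open>Additive errors vanish in the cone because the scale tends to infinity along the
  ultrafilter.\<close>

lemma eventually_absorb:
  assumes "eventually (\<lambda>n. F n \<le> r * \<sigma> n + B) \<omega>" "0 < e"
  shows "eventually (\<lambda>n. F n \<le> (r + e) * \<sigma> n) \<omega>"
  using assms(1) eventually_scale_ge[of "B / e"]
proof eventually_elim
  case (elim n)
  then show ?case using assms(2) by (simp add: field_simps)
qed

lemma dist_cls_le_slack:
  assumes "x \<in> Q" "y \<in> Q" "eventually (\<lambda>n. d (x n) (y n) \<le> r * \<sigma> n + B) \<omega>" "0 \<le> r"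
  shows "dY (cls x) (cls y) \<le> r"
proof (rule field_le_epsilon)
  fix e :: real assume "0 < e"
  then show "dY (cls x) (cls y) \<le> r + e"
    using eventually_absorb[OF assms(3)] assms by (intro dist_cls_le) auto
qed

end

context cayley_cone
begin

interpretation GL: group GG
  by (rule group_presented_group)

section \<open>Cone points represented by sequences of vertices\<close>

definition vseqs :: "(nat \<Rightarrow> GL_gen gword set) set" where
  "vseqs = {g. (\<forall>n. g n \<in> carrier GG) \<and> (\<lambda>n. Vertex (g n)) \<in> Q}"

definition vcls :: "(nat \<Rightarrow> GL_gen gword set) \<Rightarrow> (nat \<Rightarrow> GL_gen gword set cayley_pt) set" where
  "vcls g = cls (\<lambda>n. Vertex (g n))"

lemma vseqs_carrier: "g \<in> vseqs \<Longrightarrow> g n \<in> carrier GG"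
  by (simp add: vseqs_def)

lemma vcls_in: "g \<in> vseqs \<Longrightarrow> vcls g \<in> Y"
  by (simp add: vseqs_def vcls_def)

lemma vseqs_near:
  assumes g: "g \<in> vseqs" and h: "\<And>n. h n \<in> carrier GG"
    and near: "eventually (\<lambda>n. vd (g n) (h n) \<le> r * \<sigma> n) \<omega>"
  shows "h \<in> vseqs"
proof -
  have "(\<lambda>n. Vertex (h n)) \<in> Q"
  proof (rule Q_near)
    show "(\<lambda>n. Vertex (g n)) \<in> Q" using g by (simp add: vseqs_def)
    show "Vertex (h n) \<in> Cay GG S" for n using h by (rule Vertex_in)
    show "eventually (\<lambda>n. dX (Vertex (g n)) (Vertex (h n)) \<le> r * \<sigma> n) \<omega>"
      using near g h by (simp add: vseqs_def Cay_dist_Vertex)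
  qed
  then show ?thesis using h by (simp add: vseqs_def)
qed

lemma vcls_dist_le:
  assumes "g \<in> vseqs" "h \<in> vseqs" "eventually (\<lambda>n. vd (g n) (h n) \<le> r * \<sigma> n + B) \<omega>" "0 \<le> r"
  shows "dY (vcls g) (vcls h) \<le> r"
  unfolding vcls_def using assms
  by (intro dist_cls_le_slack[where B = B]) (simp_all add: vseqs_def Cay_dist_Vertex)

lemma vcls_dist_less:
  assumes "g \<in> vseqs" "h \<in> vseqs" "dY (vcls g) (vcls h) < r"
  shows "eventually (\<lambda>n. vd (g n) (h n) < r * \<sigma> n) \<omega>"
  using dist_cls_less[of "\<lambda>n. Vertex (g n)" "\<lambda>n. Vertex (h n)" r] assms
  by (simp add: vseqs_def vcls_def Cay_dist_Vertex)

lemma vcls_cong: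
  assumes g: "g \<in> vseqs" and h: "\<And>n. h n \<in> carrier GG" and eq: "eventually (\<lambda>n. g n = h n) \<omega>"
  shows "h \<in> vseqs" "vcls g = vcls h"
proof -
  have ev: "eventually (\<lambda>n. vd (g n) (h n) \<le> 0 * \<sigma> n) \<omega>"
    using eq by eventually_elim (simp add: vertex_dist_refl)
  show hV: "h \<in> vseqs" by (rule vseqs_near[OF g h ev])
  have "dY (vcls g) (vcls h) \<le> 0"
    using vcls_dist_le[OF g hV, of 0 0] ev by simp
  then show "vcls g = vcls h"
    using Y.nonneg[of "vcls g" "vcls h"] Y.zero[of "vcls g" "vcls h"] vcls_in[OF g] vcls_in[OF hV] by simp
qed

lemma vertex_near:
  assumes "p \<in> Cay GG S"
  shows "\<exists>g\<in>carrier GG. dX p (Vertex g) \<le> 1"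
proof (cases p)
  case (Vertex g)
  then have g: "g \<in> carrier GG" using assms by (auto simp: Cay_def)
  then show ?thesis using Vertex by (intro bexI[of _ g]) (simp_all add: Cay_dist_Vertex vertex_dist_refl)
next
  case (Inner g s r)
  then have g: "g \<in> carrier GG" "r < 1" using assms by (auto simp: Cay_def)
  have "dX p (Vertex g) \<le> dist_via_vertices GG S p (Vertex g)"
    by (rule Cay_dist_le_via[OF group_presented_group S_carrier S_gen assms Vertex_in[OF g(1)]])
  also have "\<dots> \<le> r + vd g g + 0"
    by (rule dist_via_vertices_le[OF group_presented_group S_carrier S_gen]) (simp_all add: Inner)
  finally show ?thesis using g by (intro bexI[of _ g]) (simp_all add: vertex_dist_refl)
qed

lemma vcls_surj: "A \<in> Y \<Longrightarrow> \<exists>g\<in>vseqs. vcls g = A"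
proof -
  assume "A \<in> Y"
  then obtain x where x: "x \<in> Q" "A = cls x" by (auto simp: cone_points_eq)
  have "\<forall>n. \<exists>g\<in>carrier GG. dX (x n) (Vertex g) \<le> 1"
    using vertex_near Q_in[OF x(1)] by blast
  then obtain g where g: "\<And>n. g n \<in> carrier GG" "\<And>n. dX (x n) (Vertex (g n)) \<le> 1"
    by metis
  have ev: "eventually (\<lambda>n. dX (x n) (Vertex (g n)) \<le> 0 * \<sigma> n + 1) \<omega>"
    using g(2) by simp
  have "(\<lambda>n. Vertex (g n)) \<in> Q"
    using Q_near[OF x(1) _ eventually_absorb[OF ev, of 1]] g(1) by (simp add: Vertex_in)
  then have gV: "g \<in> vseqs" using g(1) by (simp add: vseqs_def)
  have "dY A (vcls g) \<le> 0"
    unfolding x(2) vcls_def using ev x(1) gV by (intro dist_cls_le_slack[where B = 1]) (auto simp: vseqs_def)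
  then have "vcls g = A"
    using Y.nonneg[of A "vcls g"] Y.zero[of A "vcls g"] vcls_in[OF gV] \<open>A \<in> Y\<close> by simp
  then show ?thesis using gV by blast
qed

definition vrep :: "(nat \<Rightarrow> GL_gen gword set cayley_pt) set \<Rightarrow> nat \<Rightarrow> GL_gen gword set" where
  "vrep A = (SOME g. g \<in> vseqs \<and> vcls g = A)"

lemma vrep: "A \<in> Y \<Longrightarrow> vrep A \<in> vseqs" "A \<in> Y \<Longrightarrow> vcls (vrep A) = A"
  using someI_ex[of "\<lambda>g. g \<in> vseqs \<and> vcls g = A"] vcls_surj[of A] unfolding vrep_def by blast+

lemma geo_eventually:
  assumes "g \<in> vseqs" "h \<in> vseqs" "dY (vcls g) (vcls h) < r"
  shows "eventually (\<lambda>n. length (geo (g n) (h n)) \<le> bconst * r * \<sigma> n) \<omega>"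
  using vcls_dist_less[OF assms]
proof eventually_elim
  case (elim n)
  have "bconst * vd (g n) (h n) \<le> bconst * (r * \<sigma> n)"
    using elim bconst_ge by (intro mult_left_mono) auto
  then show ?case
    using geo(2)[OF vseqs_carrier[OF assms(1)] vseqs_carrier[OF assms(2)], of n n] by (simp add: mult.assoc)
qed

lemma nat_floor_lip: "0 \<le> x \<Longrightarrow> 0 \<le> y \<Longrightarrow> \<bar>real (nat \<lfloor>x\<rfloor>) - real (nat \<lfloor>y\<rfloor>)\<bar> \<le> \<bar>x - y\<bar> + 1"
  by linarith

text \<open>A word of nearly minimal length between representatives, read at a speed proportional to
  the scale, is a Lipschitz path in the cone. Past the end of the word the path rests, so time 1 is
  at the end point.\<close>

lemma cone_path_connected:
  assumes "A \<in> Y" "B \<in> Y"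
  shows "\<exists>\<rho>. continuous_map (top_of_set {0..1 :: real}) Y.mtopology \<rho> \<and> \<rho> 0 = A \<and> \<rho> 1 = B"
proof -
  define a b where "a = vrep A" and "b = vrep B"
  have ab: "a \<in> vseqs" "b \<in> vseqs" "vcls a = A" "vcls b = B" using vrep assms by (auto simp: a_def b_def)
  define r where "r = bconst * (dY A B + 1)"
  have r: "0 \<le> r" using bconst_ge by (simp add: r_def)
  define w where "w n = geo (a n) (b n)" for n
  have w: "eventually (\<lambda>n. length (w n) \<le> r * \<sigma> n) \<omega>"
    using geo_eventually[OF ab(1,2), of "dY A B + 1"] ab(3,4) by (simp add: w_def r_def)
  define g where "g t n = pt (a n) (w n) (nat \<lfloor>t * r * \<sigma> n\<rfloor>)" for t :: real and n
  have gc: "g t n \<in> carrier GG" for t n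
    using vseqs_carrier[OF ab(1)] by (simp add: g_def)
  have pos: "0 \<le> t * r * \<sigma> n" if "0 \<le> t" for t n
    using that r less_imp_le[OF scale_pos[of n]] by simp
  have lip: "vd (g s n) (g t n) \<le> (bconst * r * \<bar>s - t\<bar>) * \<sigma> n + bconst" if "0 \<le> s" "0 \<le> t" for s t n
  proof -
    have "vd (g s n) (g t n) \<le> bconst * \<bar>real (nat \<lfloor>s * r * \<sigma> n\<rfloor>) - real (nat \<lfloor>t * r * \<sigma> n\<rfloor>)\<bar>"
      unfolding g_def by (rule vd_pt[OF vseqs_carrier[OF ab(1)]])
    also have "\<dots> \<le> bconst * (\<bar>s * r * \<sigma> n - t * r * \<sigma> n\<bar> + 1)"
      using bconst_ge nat_floor_lip[OF pos[OF that(1)] pos[OF that(2)]] by (intro mult_left_mono) auto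
    also have "\<bar>s * r * \<sigma> n - t * r * \<sigma> n\<bar> = \<bar>s - t\<bar> * r * \<sigma> n"
      using r scale_pos[of n] by (simp add: abs_mult flip: left_diff_distrib)
    finally show ?thesis by (simp add: algebra_simps)
  qed
  have g0: "g 0 n = a n" for n
    using vseqs_carrier[OF ab(1)] by (simp add: g_def)
  have gV: "g t \<in> vseqs" if "0 \<le> t" for t
  proof (rule vseqs_near[OF ab(1) gc])
    have "eventually (\<lambda>n. vd (a n) (g t n) \<le> (bconst * r * t) * \<sigma> n + bconst) \<omega>"
      using lip[of 0 t] g0 that by simp
    from eventually_absorb[OF this, of 1]
    show "eventually (\<lambda>n. vd (a n) (g t n) \<le> (bconst * r * t + 1) * \<sigma> n) \<omega>" by simp
  qed
  have "continuous_map (top_of_set {0..1}) Y.mtopology (\<lambda>t. vcls (g t))"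
  proof (rule Y.lipschitz_continuous)
    show "vcls (g t) \<in> Y" if "t \<in> {0..1}" for t using that by (intro vcls_in gV) simp
    show "dY (vcls (g s)) (vcls (g t)) \<le> bconst * r * \<bar>s - t\<bar>" if "s \<in> {0..1}" "t \<in> {0..1}" for s t
      using that lip[of s t] r bconst_ge by (intro vcls_dist_le[where B = bconst] gV) auto
  qed
  moreover have "vcls (g 0) = A"
    using g0 ab(3) by (metis ext)
  moreover have "vcls (g 1) = B"
  proof -
    have "eventually (\<lambda>n. g 1 n = b n) \<omega>"
      using w
    proof eventually_elim
      case (elim n)
      then have "length (w n) \<le> nat \<lfloor>1 * r * \<sigma> n\<rfloor>" by (simp add: le_nat_iff le_floor_iff)
      then have "g 1 n = a n \<cdot> ev (w n)" by (simp add: g_def pt_def)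
      then show ?case
        using geo(1)[OF vseqs_carrier[OF ab(1)] vseqs_carrier[OF ab(2)], of n n] by (simp add: w_def)
    qed
    then show ?thesis
      using vcls_cong(2)[OF gV[of 1], of b] vseqs_carrier[OF ab(2)] ab(4) by simp
  qed
  ultimately show ?thesis
    by (intro exI[of _ "\<lambda>t. vcls (g t)"] conjI)
qed

section \<open>Thin squares in the cone\<close>

definition edge_row :: "nat \<Rightarrow> nat \<Rightarrow> (nat \<Rightarrow> GL_gen gword set) \<Rightarrow> (nat \<Rightarrow> GL_gen gword set) \<Rightarrow> nat \<Rightarrow>
    (nat \<Rightarrow> GL_gen gword set cayley_pt) set" where
  "edge_row K K2 a a' j = vcls (\<lambda>n. pt (a n) (geo (a n) (a' n)) (frac_len K K2 j (geo (a n) (a' n))))"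

text \<open>At the common base point of two loops the side of the square is constant, so every glued
  row is again a loop there.\<close>

lemma edge_row_refl: "a \<in> vseqs \<Longrightarrow> edge_row K K2 a a j = vcls a"
  by (simp add: edge_row_def geo_refl vseqs_carrier pt_def ev_Nil)

text \<open>A side of length \<open>\<eta> * \<epsilon>\<close> gains one factor
  \<open>bconst\<close> as a word and another as a path; it then has size at most
  \<open>\<epsilon> / 8\<close>.\<close>

definition \<eta> :: real where "\<eta> = 1 / (8 * bconst * bconst)"

lemma \<eta>: "0 < \<eta>" "\<eta> \<le> 1 / 8" "bconst * \<eta> \<le> 1 / 8" "bconst * (bconst * \<eta>) = 1 / 8"
proof -
  have b1: "1 * 1 \<le> bconst * bconst" "0 < bconst" using bconst_ge mult_mono[of 1 bconst 1 bconst] by simp_all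
  show "0 < \<eta>" using b1 by (simp add: \<eta>_def)
  show "\<eta> \<le> 1 / 8" using b1 by (simp add: \<eta>_def field_simps)
  show "bconst * \<eta> \<le> 1 / 8" using bconst_ge by (simp add: \<eta>_def field_simps)
  show "bconst * (bconst * \<eta>) = 1 / 8" using b1 by (simp add: \<eta>_def)
qed

text \<open>The loops are at distance at most \<epsilon>; the bound \<open>2 * \<epsilon>\<close>
  makes this strict, so that it can be read off along the ultrafilter.\<close>

definition thin_square where
  "thin_square \<epsilon> a b a' b' \<longleftrightarrow> 0 < \<epsilon> \<and> a \<in> vseqs \<and> b \<in> vseqs \<and> a' \<in> vseqs \<and> b' \<in> vseqs \<and>
     dY (vcls a) (vcls b) < \<eta> * \<epsilon> \<and> dY (vcls a') (vcls b') < \<eta> * \<epsilon> \<and>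
     dY (vcls a) (vcls a') < 2 * \<epsilon> \<and> dY (vcls b) (vcls b') < 2 * \<epsilon>"

definition swept where
  "swept K \<epsilon> a b a' b' W m \<longleftrightarrow> eventually (\<lambda>n.
     square (a n) (b n) (a' n) (b' n) (geo (a n) (b n)) (geo (a' n) (b' n)) (geo (a n) (a' n)) (geo (b n) (b' n))
       (W n) K (m n) \<and>
     real (length (geo (a n) (b n))) \<le> bconst * \<eta> * \<epsilon> * \<sigma> n \<and> real (length (geo (a' n) (b' n))) \<le> bconst * \<eta> * \<epsilon> * \<sigma> n \<and>
     real (length (geo (a n) (a' n))) \<le> 2 * bconst * \<epsilon> * \<sigma> n \<and> real (length (geo (b n) (b' n))) \<le> 2 * bconst * \<epsilon> * \<sigma> n \<and>
     bconst * real (m n) \<le> \<epsilon> / 8 * \<sigma> n \<and>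
     (\<forall>j\<le>K. real (length (W n j)) \<le> (1 + real K) * \<epsilon> * \<sigma> n)) \<omega>"

definition filling :: "nat \<Rightarrow> nat \<Rightarrow> real \<Rightarrow> real \<Rightarrow> (nat \<Rightarrow> GL_gen gword set) \<Rightarrow> (nat \<Rightarrow> GL_gen gword set) \<Rightarrow>
    (nat \<Rightarrow> GL_gen gword set) \<Rightarrow> (nat \<Rightarrow> GL_gen gword set) \<Rightarrow>
    (nat \<Rightarrow> real \<Rightarrow> (nat \<Rightarrow> GL_gen gword set cayley_pt) set) \<Rightarrow> bool" where
  "filling K K2 \<Lambda> \<epsilon> a b a' b' R \<longleftrightarrow>
     (\<forall>j\<le>K + K2. R j 0 = edge_row K K2 a a' j \<and> R j 1 = edge_row K K2 b b' j \<and>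
       (\<forall>t\<in>{0..1}. R j t \<in> Y \<and> dY (vcls a) (R j t) \<le> \<Lambda> * \<epsilon> \<and>
         (\<forall>s\<in>{0..1}. dY (R j s) (R j t) \<le> \<Lambda> * \<epsilon> * \<bar>s - t\<bar>) \<and>
         (j < K + K2 \<longrightarrow> dY (R j t) (R (Suc j) t) \<le> \<epsilon> / 4))) \<and>
     (\<forall>t\<in>{0..1}. dY (vcls a) (R 0 t) \<le> \<epsilon> / 8 \<and> dY (vcls a') (R (K + K2) t) \<le> \<epsilon> / 8)"

text \<open>The ratio of boundary length to move size is bounded independently of \<epsilon>, the
  corners and \<open>n\<close>. Hence \<open>bounded_moves\<close> gives one \<open>K\<close> for
  all squares, and the number of rows survives in the ultralimit.\<close>

lemma square_words:
  "\<exists>K. \<forall>\<epsilon> a b a' b'. thin_square \<epsilon> a b a' b' \<longrightarrow> (\<exists>W m. swept K \<epsilon> a b a' b' W m)"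
proof -
  \<comment> \<open>A move of size \<open>\<mu> * \<epsilon> * \<sigma> n\<close> displaces a path
    by at most \<open>\<epsilon> / 8\<close> in the cone.\<close>
  define \<mu> where "\<mu> = 1 / (8 * bconst)"
  \<comment> \<open>The boundary has length at most
    \<open>6 * bconst * \<epsilon> * \<sigma> n\<close>, the move size is at least half of
    \<open>\<mu> * \<epsilon> * \<sigma> n\<close>, and the quotient of these is
    \<open>96 * bconst * bconst\<close>.\<close>
  define N where "N = nat \<lceil>96 * bconst * bconst\<rceil>"
  obtain K where K: "\<And>m u v. min_size \<le> m \<Longrightarrow> u \<simeq> v \<Longrightarrow> length u + length v \<le> N * m \<Longrightarrow> reach m K u v"
    using bounded_moves[of N] by blast
  have bl0: "0 < bconst" using bconst_ge by simp
  have \<mu>: "0 < \<mu>" "\<mu> \<le> 1" "bconst * \<mu> = 1 / 8"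
    using bconst_ge by (auto simp: \<mu>_def field_simps)
  have N: "96 * bconst * bconst \<le> N" unfolding N_def by linarith
  have "\<exists>W m. swept K \<epsilon> a b a' b' W m"
    if thin: "thin_square \<epsilon> a b a' b'" for \<epsilon> a b a' b'
  proof -
    have \<epsilon>: "0 < \<epsilon>" and V: "a \<in> vseqs" "b \<in> vseqs" "a' \<in> vseqs" "b' \<in> vseqs"
      and d: "dY (vcls a) (vcls b) < \<eta> * \<epsilon>" "dY (vcls a') (vcls b') < \<eta> * \<epsilon>"
        "dY (vcls a) (vcls a') < 2 * \<epsilon>" "dY (vcls b) (vcls b') < 2 * \<epsilon>"
      using thin by (auto simp: thin_square_def)
    define w v f f' where "w n = geo (a n) (b n)" and "v n = geo (a' n) (b' n)"
      and "f n = geo (a n) (a' n)" and "f' n = geo (b n) (b' n)" for n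
    define U where "U n = f n @ v n @ word_inv (f' n)" for n
    define m where "m n = nat \<lfloor>\<mu> * \<epsilon> * \<sigma> n\<rfloor>" for n
    define good where "good n \<longleftrightarrow> real (length (w n)) \<le> bconst * \<eta> * \<epsilon> * \<sigma> n \<and> real (length (v n)) \<le> bconst * \<eta> * \<epsilon> * \<sigma> n \<and>
        real (length (f n)) \<le> 2 * bconst * \<epsilon> * \<sigma> n \<and> real (length (f' n)) \<le> 2 * bconst * \<epsilon> * \<sigma> n \<and>
        (min_size + 2) / (\<mu> * \<epsilon>) \<le> \<sigma> n" for n
    have ev_good: "eventually good \<omega>"
      using geo_eventually[OF V(1,2) d(1)] geo_eventually[OF V(3,4) d(2)] geo_eventually[OF V(1,3) d(3)]
        geo_eventually[OF V(2,4) d(4)] eventually_scale_ge[of "(min_size + 2) / (\<mu> * \<epsilon>)"]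
      by eventually_elim (simp add: good_def w_def v_def f_def f'_def mult_ac)
    have c: "a n \<in> carrier GG" "b n \<in> carrier GG" "a' n \<in> carrier GG" "b' n \<in> carrier GG" for n
      using V vseqs_carrier by auto
    have eqs: "b n = a n \<cdot> ev (w n)" "a' n = a n \<cdot> ev (f n)" "b' n = a' n \<cdot> ev (v n)" "b' n = b n \<cdot> ev (f' n)" for n
      unfolding w_def v_def f_def f'_def by (rule geo(1)[OF c(1) c(2)] geo(1)[OF c(1) c(3)] geo(1)[OF c(3) c(4)] geo(1)[OF c(2) c(4)])+
    have wU: "w n \<simeq> U n" for n
    proof -
      have "a n \<cdot> ev (U n) = b n \<cdot> ev (f' n) \<cdot> ginv (ev (f' n))"
        using eqs[of n] c[of n] by (simp add: U_def ev_append ev_word_inv flip: GL.m_assoc)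
      also have "\<dots> = a n \<cdot> ev (w n)"
        using c[of n] eqs(1)[of n] by (simp add: GL.m_assoc)
      finally have "ev (U n) = ev (w n)" using c[of n] by simp
      then show ?thesis by (simp add: geq_ev)
    qed
    have m_le: "real (m n) \<le> \<mu> * \<epsilon> * \<sigma> n" for n
      unfolding m_def using \<mu>(1) \<epsilon> less_imp_le[OF scale_pos[of n]] by (intro of_nat_floor) simp
    have sq: "\<exists>Wn. square (a n) (b n) (a' n) (b' n) (w n) (v n) (f n) (f' n) Wn K (m n)" if g: "good n" for n
    proof -
      \<comment> \<open>The additional 2 pays for rounding: a number that is at least 2 loses at
        most half of itself when rounded down.\<close>
      have big: "min_size + 2 \<le> \<mu> * \<epsilon> * \<sigma> n"
        using g \<mu>(1) \<epsilon> by (simp add: good_def pos_divide_le_eq mult_ac)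
      then have m_ge: "\<mu> * \<epsilon> * \<sigma> n / 2 \<le> m n" "min_size \<le> m n"
        unfolding m_def by linarith+
      have es: "0 \<le> \<epsilon> * \<sigma> n" using \<epsilon> scale_pos[of n] by simp
      have b\<eta>: "bconst * \<eta> * \<epsilon> * \<sigma> n \<le> 1 / 8 * (\<epsilon> * \<sigma> n)"
        using mult_right_mono[OF \<eta>(3) es] by (simp add: mult_ac)
      have "1 * (\<epsilon> * \<sigma> n) \<le> bconst * (\<epsilon> * \<sigma> n)" using bconst_ge es by (intro mult_right_mono)
      then have "real (length (w n) + length (U n)) \<le> 6 * (bconst * (\<epsilon> * \<sigma> n))"
        using g b\<eta> by (simp add: U_def good_def mult_ac)
      also have "\<dots> = 96 * bconst * bconst * (\<mu> * \<epsilon> * \<sigma> n / 2)"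
        using bl0 by (simp add: \<mu>_def)
      also have "\<dots> \<le> real N * real (m n)"
        using N m_ge(1) \<mu>(1) es by (intro mult_mono) (auto simp: mult.assoc)
      finally have "length (w n) + length (U n) \<le> N * m n"
        by (simp only: of_nat_mult[symmetric] of_nat_le_iff)
      then have "reach (m n) K (w n) (U n)"
        by (rule K[OF m_ge(2) wU])
      then obtain Wn where "Wn 0 = w n" "Wn K = U n" "\<forall>j<K. move (m n) (Wn j) (Wn (Suc j))"
        unfolding reach_def relpowp_fun_conv by blast
      then show ?thesis
        unfolding square_def using c[of n] eqs[of n] by (intro exI[of _ Wn]) (simp only: U_def simp_thms)
    qed
    then obtain W where W: "\<And>n. good n \<Longrightarrow> square (a n) (b n) (a' n) (b' n) (w n) (v n) (f n) (f' n) (W n) K (m n)"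
      by metis
    have len: "length (W n j) \<le> (1 + real K) * \<epsilon> * \<sigma> n" if g: "good n" and j: "j \<le> K" for n j
    proof -
      have es: "0 \<le> \<epsilon> * \<sigma> n" using \<epsilon> scale_pos[of n] by simp
      have "j \<le> K \<Longrightarrow> length (W n j) \<le> length (w n) + j * m n" for j
      proof (induction j)
        case 0
        then show ?case using W[OF g] by (simp add: square_def)
      next
        case (Suc j)
        then have "move (m n) (W n j) (W n (Suc j))" using W[OF g] by (simp add: square_def)
        from move_length[OF this] show ?case using Suc by simp
      qed
      from this[OF j] have "length (W n j) \<le> length (w n) + K * m n"
        using mult_right_mono[OF j, of "m n"] by linarith
      then have "real (length (W n j)) \<le> length (w n) + real K * real (m n)"
        by (metis of_nat_add of_nat_le_iff of_nat_mult)
      also have "real (length (w n)) \<le> 1 / 8 * (\<epsilon> * \<sigma> n)"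
        using g mult_right_mono[OF \<eta>(3) es] by (simp add: good_def mult_ac)
      also have "real K * real (m n) \<le> real K * (\<epsilon> * \<sigma> n)"
        using m_le[of n] mult_right_mono[OF \<mu>(2) es] by (intro mult_left_mono) (auto simp: mult.assoc)
      finally show ?thesis using es by (simp add: algebra_simps)
    qed
    have bm: "bconst * real (m n) \<le> \<epsilon> / 8 * \<sigma> n" for n
    proof -
      have "bconst * real (m n) \<le> bconst * (\<mu> * \<epsilon> * \<sigma> n)"
        using m_le bl0 by (intro mult_left_mono) auto
      also have "\<dots> = (bconst * \<mu>) * \<epsilon> * \<sigma> n" by (simp only: mult.assoc)
      finally show ?thesis by (simp add: \<mu>(3))
    qed
    have "swept K \<epsilon> a b a' b' W m"
      unfolding swept_def w_def[symmetric] v_def[symmetric] f_def[symmetric] f'_def[symmetric]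
      using ev_good
    proof eventually_elim
      case (elim n)
      then show ?case using W len bm by (simp add: good_def)
    qed
    then show ?thesis by blast
  qed
  then show ?thesis by blast
qed

lemma square_rows:
  "\<exists>K K2 \<Lambda>. 0 \<le> \<Lambda> \<and> (\<forall>\<epsilon> a b a' b'. thin_square \<epsilon> a b a' b' \<longrightarrow> (\<exists>R. filling K K2 \<Lambda> \<epsilon> a b a' b' R))"
proof -
  obtain K where K: "\<And>\<epsilon> a b a' b'. thin_square \<epsilon> a b a' b' \<Longrightarrow> \<exists>W m. swept K \<epsilon> a b a' b' W m"
    using square_words by blast
  \<comment> \<open>Two sides of total length at most
    \<open>4 * bconst * \<epsilon> * \<sigma> n\<close>, traversed in \<open>K2\<close> rows, cost
    at most \<open>\<epsilon> / 8\<close> per row.\<close>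
  define K2 where "K2 = Suc (nat \<lceil>32 * bconst * bconst\<rceil>)"
  have K2: "0 < K2" "32 * bconst * bconst \<le> K2" unfolding K2_def by linarith+
  \<comment> \<open>At time 1 the index is \<open>\<Lambda>0 * \<epsilon> * \<sigma> n\<close>
    rounded down, which is not before the end of any \<open>W n j\<close>. The summand
    \<open>2 * bconst\<close> covers \<open>f n\<close>, up to which clamping may raise a
    position.\<close>
  define \<Lambda>0 where "\<Lambda>0 = 1 + K + 2 * bconst"
  have bl0: "0 < bconst" using bconst_ge by simp
  have \<Lambda>0: "0 \<le> \<Lambda>0" "1 + K \<le> \<Lambda>0" "2 * bconst \<le> \<Lambda>0" using bconst_ge by (simp_all add: \<Lambda>0_def)
  define \<Lambda> where "\<Lambda> = bconst * \<Lambda>0"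
  have \<Lambda>: "0 \<le> \<Lambda>" using bl0 \<Lambda>0 by (simp add: \<Lambda>_def)
  have "\<exists>R. filling K K2 \<Lambda> \<epsilon> a b a' b' R"
    if thin: "thin_square \<epsilon> a b a' b'" for \<epsilon> a b a' b'
  proof -
    have \<epsilon>: "0 < \<epsilon>" and V: "a \<in> vseqs" "b \<in> vseqs" "a' \<in> vseqs" "b' \<in> vseqs"
      and d: "dY (vcls a) (vcls b) < \<eta> * \<epsilon>" "dY (vcls a') (vcls b') < \<eta> * \<epsilon>"
        "dY (vcls a) (vcls a') < 2 * \<epsilon>" "dY (vcls b) (vcls b') < 2 * \<epsilon>"
      using thin by (auto simp: thin_square_def)
    define w v f f' where "w n = geo (a n) (b n)" and "v n = geo (a' n) (b' n)"
      and "f n = geo (a n) (a' n)" and "f' n = geo (b n) (b' n)" for n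
    obtain W m where ev: "eventually (\<lambda>n.
        square (a n) (b n) (a' n) (b' n) (w n) (v n) (f n) (f' n) (W n) K (m n) \<and>
        length (w n) \<le> bconst * \<eta> * \<epsilon> * \<sigma> n \<and> length (v n) \<le> bconst * \<eta> * \<epsilon> * \<sigma> n \<and>
        length (f n) \<le> 2 * bconst * \<epsilon> * \<sigma> n \<and> length (f' n) \<le> 2 * bconst * \<epsilon> * \<sigma> n \<and>
        bconst * real (m n) \<le> \<epsilon> / 8 * \<sigma> n \<and>
        (\<forall>j\<le>K. length (W n j) \<le> (1 + real K) * \<epsilon> * \<sigma> n)) \<omega>"
      using K[OF thin] unfolding swept_def w_def v_def f_def f'_def by blast
    define ix where "ix t n = nat \<lfloor>t * (\<Lambda>0 * \<epsilon>) * \<sigma> n\<rfloor>" for t :: real and n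
    define g where "g j t n = pt (a n) (W n (min j K)) (sq_pos K K2 (f n) (f' n) (W n) j (ix t n))" for j t n
    have ac: "a n \<in> carrier GG" for n using V(1) vseqs_carrier by simp
    have gc: "g j t n \<in> carrier GG" for j t n using ac by (simp add: g_def)
    have es: "0 \<le> \<epsilon> * \<sigma> n" for n using \<epsilon> scale_pos[of n] by simp
    have pos: "0 \<le> t * (\<Lambda>0 * \<epsilon>) * \<sigma> n" if "t \<in> {0..1}" for t n
      using that \<Lambda>0(1) \<epsilon> less_imp_le[OF scale_pos[of n]] by simp
    have ix_le: "real (ix t n) \<le> \<Lambda>0 * (\<epsilon> * \<sigma> n)" if "t \<in> {0..1}" for t n
    proof -
      have "real (ix t n) \<le> t * (\<Lambda>0 * \<epsilon>) * \<sigma> n" unfolding ix_def by (rule of_nat_floor[OF pos[OF that]])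
      also have "\<dots> = t * (\<Lambda>0 * (\<epsilon> * \<sigma> n))" by (simp add: mult_ac)
      also have "\<dots> \<le> 1 * (\<Lambda>0 * (\<epsilon> * \<sigma> n))"
        using that \<Lambda>0(1) es[of n] by (intro mult_right_mono) auto
      finally show ?thesis by simp
    qed
    have near: "eventually (\<lambda>n. vd (a n) (g j t n) \<le> (\<Lambda> * \<epsilon>) * \<sigma> n) \<omega>" if t: "t \<in> {0..1}" and j: "j \<le> K + K2" for t j
      using ev
    proof eventually_elim
      case (elim n)
      let ?p = "sq_pos K K2 (f n) (f' n) (W n) j (ix t n)"
      have "2 * bconst * (\<epsilon> * \<sigma> n) \<le> \<Lambda>0 * (\<epsilon> * \<sigma> n)"
        using \<Lambda>0(3) es by (intro mult_right_mono)
      then have "real (length (f n)) \<le> \<Lambda>0 * (\<epsilon> * \<sigma> n)" using elim by (simp add: mult.assoc)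
      moreover have "?p \<le> max (length (f n)) (ix t n)"
        using elim j by (intro sq_pos_le) blast+
      ultimately have p: "real ?p \<le> \<Lambda>0 * (\<epsilon> * \<sigma> n)"
        using ix_le[OF t, of n] by (simp add: max_def split: if_splits)
      have "vd (a n) (g j t n) = vd (pt (a n) (W n (min j K)) 0) (g j t n)" using ac by simp
      also have "\<dots> \<le> bconst * \<bar>real 0 - real ?p\<bar>" unfolding g_def by (rule vd_pt[OF ac])
      also have "\<dots> \<le> bconst * (\<Lambda>0 * (\<epsilon> * \<sigma> n))" using p bl0 by (intro mult_left_mono) auto
      finally show ?case by (simp add: \<Lambda>_def mult_ac)
    qed
    have gV: "g j t \<in> vseqs" if "t \<in> {0..1}" "j \<le> K + K2" for j t
      using near[OF that] by (rule vseqs_near[OF V(1) gc])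
    define R where "R j t = vcls (g j t)" for j t
    have start: "R j 0 = edge_row K K2 a a' j" if j: "j \<le> K + K2" for j
      unfolding R_def edge_row_def
    proof (rule vcls_cong(2)[OF gV[OF _ j]])
      show "eventually (\<lambda>n. g j 0 n = pt (a n) (geo (a n) (a' n)) (frac_len K K2 j (geo (a n) (a' n)))) \<omega>"
        using ev
      proof eventually_elim
        case (elim n)
        then have "square (a n) (b n) (a' n) (b' n) (w n) (v n) (f n) (f' n) (W n) K (m n)" by blast
        from sq_start[OF this j] show ?case by (simp add: g_def ix_def f_def)
      qed
    qed (use ac in simp_all)
    have finish: "R j 1 = edge_row K K2 b b' j" if j: "j \<le> K + K2" for j
      unfolding R_def edge_row_def
    proof (rule vcls_cong(2)[OF gV[OF _ j]])
      show "eventually (\<lambda>n. g j 1 n = pt (b n) (geo (b n) (b' n)) (frac_len K K2 j (geo (b n) (b' n)))) \<omega>"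
        using ev
      proof eventually_elim
        case (elim n)
        then have sq: "square (a n) (b n) (a' n) (b' n) (w n) (v n) (f n) (f' n) (W n) K (m n)" by blast
        have "length (W n (min j K)) \<le> (1 + real K) * (\<epsilon> * \<sigma> n)" using elim by (simp add: mult.assoc)
        also have "\<dots> \<le> \<Lambda>0 * (\<epsilon> * \<sigma> n)" using \<Lambda>0(2) es by (intro mult_right_mono) simp_all
        finally have "length (W n (min j K)) \<le> ix 1 n"
          by (simp add: ix_def le_nat_iff le_floor_iff mult_ac)
        from sq_end[OF sq j this] show ?case by (simp add: g_def f'_def)
      qed
      show "pt (b n) (geo (b n) (b' n)) (frac_len K K2 j (geo (b n) (b' n))) \<in> carrier GG" for n
        using V(2) vseqs_carrier by simp
    qed simp
    have lip: "dY (R j s) (R j t) \<le> \<Lambda> * \<epsilon> * \<bar>s - t\<bar>" if s: "s \<in> {0..1}" and t: "t \<in> {0..1}" and j: "j \<le> K + K2" for s t j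
      unfolding R_def
    proof (rule vcls_dist_le[OF gV[OF s j] gV[OF t j], where B = bconst])
      show "eventually (\<lambda>n. vd (g j s n) (g j t n) \<le> \<Lambda> * \<epsilon> * \<bar>s - t\<bar> * \<sigma> n + bconst) \<omega>"
        using ev
      proof eventually_elim
        case (elim n)
        then have sq: "square (a n) (b n) (a' n) (b' n) (w n) (v n) (f n) (f' n) (W n) K (m n)" by blast
        have "\<bar>t * (\<Lambda>0 * \<epsilon>) * \<sigma> n - s * (\<Lambda>0 * \<epsilon>) * \<sigma> n\<bar> = \<bar>(s - t) * (\<Lambda>0 * \<epsilon> * \<sigma> n)\<bar>"
          by (simp add: algebra_simps abs_minus_commute)
        also have "\<dots> = \<Lambda>0 * \<epsilon> * \<sigma> n * \<bar>s - t\<bar>"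
        proof -
          have "0 \<le> \<Lambda>0 * \<epsilon> * \<sigma> n" using \<Lambda>0(1) es[of n] by (simp add: mult.assoc)
          from abs_of_nonneg[OF this] show ?thesis
            by (simp only: abs_mult[of "s - t"]) (simp only: mult.commute)
        qed
        finally have "\<bar>real (ix s n) - real (ix t n)\<bar> \<le> \<Lambda>0 * \<epsilon> * \<sigma> n * \<bar>s - t\<bar> + 1"
          unfolding ix_def using nat_floor_lip[OF pos[OF s, of n] pos[OF t, of n]] by linarith
        then have "\<bar>real (sq_pos K K2 (f n) (f' n) (W n) j (ix s n)) - real (sq_pos K K2 (f n) (f' n) (W n) j (ix t n))\<bar>
            \<le> \<Lambda>0 * \<epsilon> * \<sigma> n * \<bar>s - t\<bar> + 1"
          using sq_pos_lip[OF sq, of K2 j "ix s n" "ix t n"] by linarith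
        then have "bconst * \<bar>real (sq_pos K K2 (f n) (f' n) (W n) j (ix s n)) - real (sq_pos K K2 (f n) (f' n) (W n) j (ix t n))\<bar>
            \<le> bconst * (\<Lambda>0 * \<epsilon> * \<sigma> n * \<bar>s - t\<bar> + 1)"
          using bl0 by (intro mult_left_mono) auto
        then have "vd (g j s n) (g j t n) \<le> bconst * (\<Lambda>0 * \<epsilon> * \<sigma> n * \<bar>s - t\<bar> + 1)"
          unfolding g_def using vd_pt[OF ac] order_trans by blast
        then show ?case by (simp add: \<Lambda>_def algebra_simps)
      qed
    qed (use \<Lambda> \<epsilon> in simp)
    have step: "dY (R j t) (R (Suc j) t) \<le> \<epsilon> / 4" if t: "t \<in> {0..1}" and j: "j < K + K2" for t j
      unfolding R_def
    proof (rule vcls_dist_le[OF gV[OF t] gV[OF t], where B = bconst])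
      show "eventually (\<lambda>n. vd (g j t n) (g (Suc j) t n) \<le> \<epsilon> / 4 * \<sigma> n + bconst) \<omega>"
        using ev
      proof eventually_elim
        case (elim n)
        then have sq: "square (a n) (b n) (a' n) (b' n) (w n) (v n) (f n) (f' n) (W n) K (m n)" by blast
        have "bconst * (real (length (f n)) + length (f' n)) \<le> bconst * (4 * bconst * (\<epsilon> * \<sigma> n))"
          using elim bl0 by (intro mult_left_mono) (auto simp: mult.assoc)
        also have "\<dots> \<le> K2 * (\<epsilon> / 8 * \<sigma> n)"
          using mult_right_mono[OF K2(2) es[of n]] by (simp add: mult_ac)
        finally have "bconst * ((real (length (f n)) + length (f' n)) / K2) \<le> \<epsilon> / 8 * \<sigma> n"
          using K2(1) by (simp add: pos_divide_le_eq mult_ac)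
        moreover have "bconst * real (m n) \<le> \<epsilon> / 8 * \<sigma> n" using elim by blast
        \<comment> \<open>One eighth comes from the move and one eighth from pulling the ends;
          rounding goes into the additive constant.\<close>
        ultimately have "bconst * (m n + (length (f n) + length (f' n)) / K2 + 1) \<le> \<epsilon> / 4 * \<sigma> n + bconst"
          unfolding distrib_left[of bconst] of_nat_add by linarith
        then show ?case
          unfolding g_def using sq_step[OF sq j, of "ix t n"] by linarith
      qed
    qed (use \<epsilon> j in simp_all)
    have first: "dY (vcls a) (R 0 t) \<le> \<epsilon> / 8" if t: "t \<in> {0..1}" for t
      unfolding R_def
    proof (rule vcls_dist_le[OF V(1) gV[OF t], where B = 0])
      show "eventually (\<lambda>n. vd (a n) (g 0 t n) \<le> \<epsilon> / 8 * \<sigma> n + 0) \<omega>"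
        using ev
      proof eventually_elim
        case (elim n)
        then have sq: "square (a n) (b n) (a' n) (b' n) (w n) (v n) (f n) (f' n) (W n) K (m n)" by blast
        have "bconst * length (w n) \<le> bconst * (bconst * \<eta> * \<epsilon> * \<sigma> n)"
          using elim bl0 by (intro mult_left_mono) auto
        also have "\<dots> = bconst * (bconst * \<eta>) * (\<epsilon> * \<sigma> n)" by (simp only: mult.assoc)
        finally have "bconst * length (w n) \<le> \<epsilon> / 8 * \<sigma> n" unfolding \<eta>(4) by simp
        then show ?case
          using sq_first[OF sq, of K2 "ix t n"] unfolding g_def by linarith
      qed
    qed (use \<epsilon> in simp_all)
    have last: "dY (vcls a') (R (K + K2) t) \<le> \<epsilon> / 8" if t: "t \<in> {0..1}" for t
      unfolding R_def
    proof (rule vcls_dist_le[OF V(3) gV[OF t], where B = 0])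
      show "eventually (\<lambda>n. vd (a' n) (g (K + K2) t n) \<le> \<epsilon> / 8 * \<sigma> n + 0) \<omega>"
        using ev
      proof eventually_elim
        case (elim n)
        then have sq: "square (a n) (b n) (a' n) (b' n) (w n) (v n) (f n) (f' n) (W n) K (m n)" by blast
        have "bconst * length (v n) \<le> bconst * (bconst * \<eta> * \<epsilon> * \<sigma> n)"
          using elim bl0 by (intro mult_left_mono) auto
        also have "\<dots> = bconst * (bconst * \<eta>) * (\<epsilon> * \<sigma> n)" by (simp only: mult.assoc)
        finally have "bconst * length (v n) \<le> \<epsilon> / 8 * \<sigma> n" unfolding \<eta>(4) by simp
        then show ?case
          using sq_last[OF sq K2(1), of "ix t n"] unfolding g_def by linarith
      qed
    qed (use \<epsilon> in simp_all)
    have close: "dY (vcls a) (R j t) \<le> \<Lambda> * \<epsilon>" if t: "t \<in> {0..1}" and j: "j \<le> K + K2" for t j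
      unfolding R_def using near[OF t j] \<Lambda> \<epsilon>
      by (intro vcls_dist_le[OF V(1) gV[OF t j], where B = 0]) auto
    have "R j t \<in> Y" if "t \<in> {0..1}" "j \<le> K + K2" for j t
      unfolding R_def by (rule vcls_in[OF gV[OF that]])
    then have "filling K K2 \<Lambda> \<epsilon> a b a' b' R"
      unfolding filling_def using start finish lip step first last close by simp
    then show ?thesis by blast
  qed
  then show ?thesis using \<Lambda> by blast
qed

text \<open>Two nearby loops are cut into \<open>k\<close> thin squares; corresponding rows of neighbouring squares match.\<close>

lemma cone_refinable: "\<exists>C\<ge>0. \<forall>c. Y.refinable c C"
proof -
  obtain K K2 \<Lambda> where \<Lambda>: "0 \<le> \<Lambda>"
    and rows: "\<And>\<epsilon> a b a' b'. thin_square \<epsilon> a b a' b' \<Longrightarrow> \<exists>R. filling K K2 \<Lambda> \<epsilon> a b a' b' R"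
    using square_rows by blast
  define Kt where "Kt = K + K2"
  have "Y.refinable c (\<Lambda> + 1)" for c
    unfolding Y.refinable_def
  proof (intro allI impI ballI)
    fix \<epsilon> :: real and P P' assume \<epsilon>: "0 < \<epsilon>" and P: "P \<in> Y.loops c" and P': "P' \<in> Y.loops c"
      and PP': "\<forall>t\<in>{0..1}. dY (P t) (P' t) \<le> \<epsilon>"
    have \<eta>\<epsilon>: "0 < \<eta> * \<epsilon>" "\<eta> * \<epsilon> \<le> \<epsilon> / 8" using \<eta>(1,2) \<epsilon> mult_right_mono[OF \<eta>(2), of \<epsilon>] by auto
    obtain \<delta> where \<delta>: "0 < \<delta>" "\<And>s t. s \<in> {0..1} \<Longrightarrow> t \<in> {0..1} \<Longrightarrow> \<bar>s - t\<bar> < \<delta> \<Longrightarrow> dY (P s) (P t) < \<eta> * \<epsilon>"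
      using Y.loops_modulus[OF P \<eta>\<epsilon>(1)] by blast
    obtain \<delta>' where \<delta>': "0 < \<delta>'" "\<And>s t. s \<in> {0..1} \<Longrightarrow> t \<in> {0..1} \<Longrightarrow> \<bar>s - t\<bar> < \<delta>' \<Longrightarrow> dY (P' s) (P' t) < \<eta> * \<epsilon>"
      using Y.loops_modulus[OF P' \<eta>\<epsilon>(1)] by blast
    obtain k0 where "inverse (real (Suc k0)) < min \<delta> \<delta>'"
      using reals_Archimedean[of "min \<delta> \<delta>'"] \<delta>(1) \<delta>'(1) by auto
    define k where "k = Suc k0"
    have k: "0 < k" "1 / real k < \<delta>" "1 / real k < \<delta>'"
      using \<open>inverse (real (Suc k0)) < min \<delta> \<delta>'\<close> by (simp_all add: k_def inverse_eq_divide)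
    have mod: "dY (P s) (P t) < \<eta> * \<epsilon>" "dY (P' s) (P' t) < \<eta> * \<epsilon>"
      if "s \<in> {0..1}" "t \<in> {0..1}" "\<bar>s - t\<bar> \<le> 1 / k" for s t
      using that k \<delta>(2)[of s t] \<delta>'(2)[of s t] by auto
    define \<tau> where "\<tau> i = real i / k" for i
    have \<tau>: "\<tau> i \<in> {0..1}" if "i \<le> k" for i using that k by (simp add: \<tau>_def)
    have \<tau>S: "\<bar>\<tau> i - \<tau> (Suc i)\<bar> \<le> 1 / k" for i using k by (simp add: \<tau>_def flip: diff_divide_distrib)
    have PY: "P t \<in> Y" "P' t \<in> Y" if "t \<in> {0..1}" for t using that Y.loops_in P P' by auto
    \<comment> \<open>Representatives depend on the cone point only: neighbouring squares share
      corners, and the points at times 0 and 1 get the same sequence.\<close>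
    define a a' where "a i = vrep (P (\<tau> i))" and "a' i = vrep (P' (\<tau> i))" for i
    have a: "a i \<in> vseqs" "vcls (a i) = P (\<tau> i)" "a' i \<in> vseqs" "vcls (a' i) = P' (\<tau> i)" if "i \<le> k" for i
      using vrep PY[OF \<tau>[OF that]] by (auto simp: a_def a'_def)
    have ends: "P 0 = c" "P 1 = c" "P' 0 = c" "P' 1 = c" using P P' by (auto simp: Y.loops_def)
    have aends: "a 0 = vrep c" "a k = vrep c" "a' 0 = vrep c" "a' k = vrep c"
      using k ends by (simp_all add: a_def a'_def \<tau>_def)
    have cY: "c \<in> Y" using PY(1)[of 0] ends by simp
    have "\<exists>R. filling K K2 \<Lambda> \<epsilon> (a i) (a (Suc i)) (a' i) (a' (Suc i)) R" if i: "i < k" for i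
    proof -
      have i': "i \<le> k" "Suc i \<le> k" using i by auto
      have "dY (vcls (a i)) (vcls (a (Suc i))) < \<eta> * \<epsilon>" "dY (vcls (a' i)) (vcls (a' (Suc i))) < \<eta> * \<epsilon>"
        using mod[OF \<tau>[OF i'(1)] \<tau>[OF i'(2)] \<tau>S] a[OF i'(1)] a[OF i'(2)] by auto
      moreover have "dY (vcls (a j)) (vcls (a' j)) < 2 * \<epsilon>" if "j \<le> k" for j
      proof -
        have "dY (vcls (a j)) (vcls (a' j)) \<le> \<epsilon>" using PP' \<tau>[OF that] a[OF that] by simp
        then show ?thesis using \<epsilon> by linarith
      qed
      ultimately have "thin_square \<epsilon> (a i) (a (Suc i)) (a' i) (a' (Suc i))"
        using \<epsilon> a[OF i'(1)] a[OF i'(2)] i' unfolding thin_square_def by blast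
      then show ?thesis by (rule rows)
    qed
    then obtain R where fill: "\<And>i. i < k \<Longrightarrow> filling K K2 \<Lambda> \<epsilon> (a i) (a (Suc i)) (a' i) (a' (Suc i)) (R i)"
      by metis
    have R: "\<And>i j. i < k \<Longrightarrow> j \<le> Kt \<Longrightarrow> R i j 0 = edge_row K K2 (a i) (a' i) j"
        "\<And>i j. i < k \<Longrightarrow> j \<le> Kt \<Longrightarrow> R i j 1 = edge_row K K2 (a (Suc i)) (a' (Suc i)) j"
        "\<And>i j t. i < k \<Longrightarrow> j \<le> Kt \<Longrightarrow> t \<in> {0..1} \<Longrightarrow> R i j t \<in> Y"
        "\<And>i j t. i < k \<Longrightarrow> j \<le> Kt \<Longrightarrow> t \<in> {0..1} \<Longrightarrow> dY (P (\<tau> i)) (R i j t) \<le> \<Lambda> * \<epsilon>"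
        "\<And>i j s t. i < k \<Longrightarrow> j \<le> Kt \<Longrightarrow> s \<in> {0..1} \<Longrightarrow> t \<in> {0..1} \<Longrightarrow> dY (R i j s) (R i j t) \<le> \<Lambda> * \<epsilon> * \<bar>s - t\<bar>"
        "\<And>i j t. i < k \<Longrightarrow> j < Kt \<Longrightarrow> t \<in> {0..1} \<Longrightarrow> dY (R i j t) (R i (Suc j) t) \<le> \<epsilon> / 4"
        "\<And>i t. i < k \<Longrightarrow> t \<in> {0..1} \<Longrightarrow> dY (P (\<tau> i)) (R i 0 t) \<le> \<epsilon> / 8"
        "\<And>i t. i < k \<Longrightarrow> t \<in> {0..1} \<Longrightarrow> dY (P' (\<tau> i)) (R i Kt t) \<le> \<epsilon> / 8"
      using fill a(2,4) unfolding filling_def Kt_def[symmetric] by (auto dest: less_imp_le_nat)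
    define \<Phi> where "\<Phi> j = Y.cat k (\<lambda>i. R i j)" for j
    have \<Phi>_loop: "\<Phi> j \<in> Y.loops c" if j: "j \<le> Kt" for j
    proof -
      have "continuous_map (top_of_set {0..1}) Y.mtopology (\<Phi> j)"
        unfolding \<Phi>_def
      proof (rule Y.cat_continuous[OF k(1), where A = "\<Lambda> * \<epsilon>"])
        show "R i j 1 = R (Suc i) j 0" if "Suc i < k" for i
          using R(1)[OF that j] R(2)[of i j] that j by simp
      qed (use R(3,5) j in auto)
      moreover have "\<Phi> j 0 = c"
        using R(1)[OF k(1) j] edge_row_refl[OF vrep(1)[OF cY]] vrep(2)[OF cY] aends
        by (simp add: \<Phi>_def Y.cat_0[OF k(1)])
      moreover have "\<Phi> j 1 = c"
        using R(2)[of "k - 1" j] j k(1) edge_row_refl[OF vrep(1)[OF cY]] vrep(2)[OF cY] aends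
        by (simp add: \<Phi>_def Y.cat_1[OF k(1)])
      ultimately show ?thesis by (simp add: Y.loops_def)
    qed
    have loc: "slot k t < k" "t * k - slot k t \<in> {0..1}" "\<bar>t - \<tau> (slot k t)\<bar> \<le> 1 / k" if "t \<in> {0..1}" for t :: real
    proof -
      note s = slot[OF k(1) that]
      show "slot k t < k" "t * k - slot k t \<in> {0..1}" using s by auto
      have "t - \<tau> (slot k t) = (t * k - slot k t) / k"
        using k(1) by (simp add: \<tau>_def diff_divide_distrib)
      then show "\<bar>t - \<tau> (slot k t)\<bar> \<le> 1 / k"
        using s k(1) by (simp add: abs_divide divide_right_mono)
    qed
    have base: "dY (P t) (P (\<tau> (slot k t))) \<le> \<epsilon> / 8" "dY (P' t) (P' (\<tau> (slot k t))) \<le> \<epsilon> / 8"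
      if "t \<in> {0..1}" for t
      using mod[OF that \<tau> loc(3)[OF that]] loc(1)[OF that] \<eta>\<epsilon>(2) by auto
    have via: "dY x z \<le> dY x y + dY y z" if "x \<in> Y" "y \<in> Y" "z \<in> Y" for x y z
      using Y.triangle that by blast
    have \<Phi>Y: "\<Phi> j t \<in> Y" if "j \<le> Kt" "t \<in> {0..1}" for j t
      using Y.loops_in[OF \<Phi>_loop[OF that(1)] that(2)] .
    have near: "dY (P t) (\<Phi> j t) \<le> (\<Lambda> + 1) * \<epsilon>" if j: "j \<le> Kt" and t: "t \<in> {0..1}" for j t
      using via[OF PY(1)[OF t] PY(1)[OF \<tau>] \<Phi>Y[OF j t], of "slot k t"] base(1)[OF t] loc(1)[OF t]
        R(4)[OF loc(1)[OF t] j loc(2)[OF t]] \<epsilon> by (simp add: \<Phi>_def Y.cat_def algebra_simps)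
    have first: "dY (P t) (\<Phi> 0 t) \<le> \<epsilon> / 2" if t: "t \<in> {0..1}" for t
      using via[OF PY(1)[OF t] PY(1)[OF \<tau>] \<Phi>Y[OF _ t], of "slot k t" 0] base(1)[OF t] loc(1)[OF t]
        R(7)[OF loc(1)[OF t] loc(2)[OF t]] \<epsilon> by (simp add: \<Phi>_def Y.cat_def)
    have last: "dY (\<Phi> Kt t) (P' t) \<le> \<epsilon> / 2" if t: "t \<in> {0..1}" for t
      using via[OF PY(2)[OF t] PY(2)[OF \<tau>] \<Phi>Y[OF _ t], of "slot k t" Kt] base(2)[OF t] loc(1)[OF t]
        R(8)[OF loc(1)[OF t] loc(2)[OF t]] \<epsilon> Y.commute[of "\<Phi> Kt t" "P' t"] by (simp add: \<Phi>_def Y.cat_def)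
    have step: "dY (\<Phi> j t) (\<Phi> (Suc j) t) \<le> \<epsilon> / 2" if j: "j < Kt" and t: "t \<in> {0..1}" for j t
      using R(6)[OF loc(1)[OF t] j loc(2)[OF t]] \<epsilon> by (simp add: \<Phi>_def Y.cat_def)
    \<comment> \<open>The first and last rows are only close to the loops, so the loops themselves
      are added at both ends.\<close>
    define \<Psi> where "\<Psi> j = (if j = 0 then P else if j \<le> Suc Kt then \<Phi> (j - 1) else P')" for j
    have "\<Psi> 0 = P" "\<forall>j\<ge>Kt + 2. \<Psi> j = P'" by (auto simp: \<Psi>_def)
    moreover have "\<Psi> j \<in> Y.loops c" for j
      using P P' \<Phi>_loop[of "j - 1"] by (auto simp: \<Psi>_def)
    moreover have "dY (\<Psi> j t) (\<Psi> (Suc j) t) \<le> \<epsilon> / 2" if t: "t \<in> {0..1}" for j t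
    proof -
      consider "j = 0" | "1 \<le> j" "j \<le> Kt" | "j = Suc Kt" | "Suc Kt < j" by linarith
      then show ?thesis
      proof cases
        case 2
        then have "j - 1 < Kt" "Suc (j - 1) = j" by auto
        then show ?thesis using step[OF _ t, of "j - 1"] 2 by (simp add: \<Psi>_def)
      qed (use first[OF t] last[OF t] PY[OF t] \<epsilon> in \<open>simp_all add: \<Psi>_def\<close>)
    qed
    moreover have "dY (P t) (\<Psi> j t) \<le> (\<Lambda> + 1) * \<epsilon>" if t: "t \<in> {0..1}" for j t
    proof -
      have "\<epsilon> \<le> (\<Lambda> + 1) * \<epsilon>" "0 \<le> (\<Lambda> + 1) * \<epsilon>" using \<Lambda> \<epsilon> by (simp_all add: algebra_simps)
      then show ?thesis
        using near[OF _ t, of "j - 1"] PP' t PY[OF t] by (auto simp: \<Psi>_def intro: order_trans)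
    qed
    ultimately show "\<exists>Ka Ra. Ra 0 = P \<and> (\<forall>j\<ge>Ka. Ra j = P') \<and> (\<forall>j. Ra j \<in> Y.loops c) \<and>
        (\<forall>j. \<forall>t\<in>{0..1}. dY (Ra j t) (Ra (Suc j) t) \<le> \<epsilon> / 2 \<and> dY (P t) (Ra j t) \<le> (\<Lambda> + 1) * \<epsilon>)"
      by (intro exI[of _ "Kt + 2"] exI[of _ \<Psi>]) blast
  qed
  then show ?thesis using \<Lambda> by (intro exI[of _ "\<Lambda> + 1"]) auto
qed

theorem cone_simply_connected: "simply_connected_space (cone_topology (Cay GG S) dX \<omega> obs \<sigma>)"
proof -
  have top: "cone_topology (Cay GG S) dX \<omega> obs \<sigma> = Y.mtopology"
    by (simp add: cone_topology_def)
  obtain C where C: "0 \<le> C" "\<And>c. Y.refinable c C" using cone_refinable by blast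
  have "Y \<noteq> {}" using cls_in[OF obs_Q] by blast
  moreover have "path_connected_space Y.mtopology"
    unfolding path_connected_space_def pathin_def Y.topspace_mtopology using cone_path_connected by blast
  moreover have "homotopic_with (\<lambda>q. q 0 = c \<and> q 1 = c) (top_of_set {0..1}) Y.mtopology p (\<lambda>_. c)"
    if "pathin Y.mtopology p \<and> p 0 = c \<and> p 1 = c" for p c
  proof -
    have p: "p \<in> Y.loops c" using that by (simp add: Y.loops_def pathin_def)
    have "c \<in> Y" using Y.loops_in[OF p, of 0] that by simp
    then have "(\<lambda>_. c) \<in> Y.loops c" by (simp add: Y.loops_def)
    then show ?thesis
      by (rule Y.refinable_imp_null_homotopic[OF cone_complete C(2,1) p])
  qed
  ultimately show ?thesis
    unfolding simply_connected_space_def top by simp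
qed

end

theorem theorem9p0p1:
  fixes L :: nat
    and S :: "GL_gen gword set set"
    and \<omega> :: "nat filter"
    and \<sigma> :: "nat \<Rightarrow> real"
    and obs :: "nat \<Rightarrow> GL_gen gword set cayley_pt"
  assumes "even L" and "L \<ge> 6"
    and "finite S" and "S \<subseteq> carrier (GL L)" and "generate (GL L) S = carrier (GL L)"
    and "nonprincipal_ultrafilter \<omega>"
    and "\<And>n. \<sigma> n > 0" and "filterlim \<sigma> at_top sequentially"
    and "\<And>n. obs n \<in> Cay (GL L) S"
  shows "simply_connected_space (cone_topology (Cay (GL L) S) (Cay_dist (GL L) S) \<omega> obs \<sigma>)"
proof -
  have GL: "GL L = presented_group (GL_relations L)"
    by (simp add: GL_def)
  interpret cayley_cone L S \<omega> \<sigma> obs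
  proof (intro cayley_cone.intro cone_setting.intro)
    show "snowflake_group L" using assms(2) by unfold_locales simp
    show "Metric_space (Cay (presented_group (GL_relations L)) S) (Cay_dist (presented_group (GL_relations L)) S)"
      using assms(4,5) unfolding GL by (intro Metric_space_Cay group_presented_group)
    show "cone_setting_axioms (Cay (presented_group (GL_relations L)) S) \<omega> \<sigma> obs"
      using assms(6-9) unfolding GL by unfold_locales
    show "cayley_cone_axioms L S"
      using assms(3-5) unfolding GL by unfold_locales
  qed
  show ?thesis
    unfolding GL by (rule cone_simply_connected)
qed

end
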